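(* Let $\varphi\in F^2$ and $m\in L^\infty(\mathbb{R})$ be related by $$\varphi(z)=\left(\frac2\pi\right)^{1/2}\int_{\mathbb{R}}m(x)\,e^{-2\left(x-\frac i2z\right)^2}\,dx,\qquad z\in\mathbb{C}.$$ Then: (1) $S_\varphi\in\mathcal{T}$ if and only if $m\in\operatorname{BUC}(\mathbb{R})$. (2) $S_\varphi=T_f$ for some vertical symbol $f\in L^\infty(\mathbb{C})$ if and only if one can factorize $m=g*m_0$ with $m_0\in L^\infty(\mathbb{R})$, where $g(x)=\sqrt{2/\pi}\,e^{-2x^2}$. In this case, $f(z)=m_0(-\operatorname{Im}(z))$.
   Context: $\mu$ is the Gaussian measure $d\mu(z)=\frac1\pi e^{-|z|^2}dz$ on $\mathbb{C}$, and $F^2=L^2(\mathbb{C},\mu)\cap\operatorname{Hol}(\mathbb{C})$ is the Fock space. Let $P$ be the orthogonal projection of $L^2(\mathbb{C},\mu)$ onto $F^2$; for $f\in L^\infty(\mathbb{C})$ the Toeplitz operator is $T_f g=P(fg)$, $g\in F^2$. The Toeplitz algebra $\mathcal{T}\subset\mathcal{L}(F^2)$ is the $C^*$-algebra generated by all $T_f$, $f\in L^\infty(\mathbb{C})$. A symbol $f\in L^\infty(\mathbb{C})$ is vertical if $f(z+h)=f(z)$ for all $h\in\mathbb{R}$, $z\in\mathbb{C}$. For $\varphi\in F^2$ the singular integral operator is $$S_\varphi f(z)=\int_{\mathbb{C}}f(w)e^{z\overline w}\varphi(z-\overline w)\,d\mu(w),$$ defined at least on the linear span of the reproducing kernels $K_u(w)=e^{w\overline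 u}$ and, when bounded, extended to $F^2$. It is known that $S_\varphi$ is bounded if and only if $\varphi$ is of the displayed form for some $m\in L^\infty(\mathbb{R})$, and then $\|S_\varphi\|=\|m\|_\infty$. $\operatorname{BUC}(\mathbb{R})$ is the space of bounded uniformly continuous functions (elements of $L^\infty$ being identified up to null sets), and $*$ is the usual convolution on $\mathbb{R}$. *)

theory Defs
  imports "HOL-Complex_Analysis.Complex_Analysis" "HOL-Probability.Probability"
begin

definition fock_measure :: "complex measure" where
  "fock_measure = density lborel (\<lambda>z. ennreal (exp (- ((norm z)^2)) / pi))"

definition square_integrable :: "(complex \<Rightarrow> complex) \<Rightarrow> bool" where
  "square_integrable f \<longleftrightarrow>
     f \<in> borel_measurable borel \<and> integrable fock_measure (\<lambda>z. (norm (f z))^2)"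

lemma sets_fock_measure [measurable_cong, simp]: "sets fock_measure = sets borel"
  by (simp add: fock_measure_def)

lemma space_fock_measure [simp]: "space fock_measure = UNIV"
  by (simp add: fock_measure_def)

lemma square_integrable_add:
  assumes "square_integrable f" "square_integrable g"
  shows "square_integrable (\<lambda>z. f z + g z)"
proof -
  have m: "f \<in> borel_measurable borel" "g \<in> borel_measurable borel"
    and i: "integrable fock_measure (\<lambda>z. (norm (f z))^2)"
           "integrable fock_measure (\<lambda>z. (norm (g z))^2)"
    using assms by (auto simp: square_integrable_def)
  have le: "(norm (x + y))^2 \<le> 2 * (norm x)^2 + 2 * (norm y)^2" for x y :: complex
  proof -
    have "(norm (x + y))^2 \<le> (norm x + norm y)^2"
      by (intro power_mono norm_triangle_ineq) auto
    also have "\<dots> \<le> 2 * (norm x)^2 + 2 * (norm y)^2"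
      using zero_le_power2[of "norm x - norm y"] by (simp add: power2_eq_square algebra_simps)
    finally show ?thesis .
  qed
  have "integrable fock_measure (\<lambda>z. (norm (f z + g z))^2)"
  proof (rule Bochner_Integration.integrable_bound)
    show "integrable fock_measure (\<lambda>z. 2 * (norm (f z))^2 + 2 * (norm (g z))^2)"
      using i by (intro Bochner_Integration.integrable_add integrable_mult_right)
    show "(\<lambda>z. (norm (f z + g z))^2) \<in> borel_measurable fock_measure"
      using m by measurable
    show "AE z in fock_measure. norm ((norm (f z + g z))^2)
        \<le> norm (2 * (norm (f z))^2 + 2 * (norm (g z))^2)"
      by (intro AE_I2) (metis le real_norm_def abs_of_nonneg order_trans zero_le_power2)
  qed
  with m show ?thesis by (auto simp: square_integrable_def)
qed

lemma square_integrable_cmult: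
  assumes "square_integrable f"
  shows "square_integrable (\<lambda>z. c * f z)"
  using assms by (auto simp: square_integrable_def norm_mult power_mult_distrib)

lemma integrable_mult_cnj:
  assumes "square_integrable f" "square_integrable g"
  shows "integrable fock_measure (\<lambda>z. f z * cnj (g z))"
proof -
  have m: "f \<in> borel_measurable borel" "g \<in> borel_measurable borel"
    and i: "integrable fock_measure (\<lambda>z. (norm (f z))^2)"
           "integrable fock_measure (\<lambda>z. (norm (g z))^2)"
    using assms by (auto simp: square_integrable_def)
  have le: "norm x * norm y \<le> (norm x)^2 + (norm y)^2" for x y :: complex
  proof -
    have "0 \<le> norm x * norm y" by simp
    then show ?thesis
      using sum_squares_bound[of "norm x" "norm y"] by linarith
  qed
  show ?thesis
  proof (rule Bochner_Integration.integrable_bound)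
    show "integrable fock_measure (\<lambda>z. (norm (f z))^2 + (norm (g z))^2)"
      using i by (rule Bochner_Integration.integrable_add)
    show "(\<lambda>z. f z * cnj (g z)) \<in> borel_measurable fock_measure"
    proof -
      have "cnj \<in> borel_measurable borel"
        by (intro borel_measurable_continuous_onI continuous_intros)
      with m show ?thesis by simp
    qed
    show "AE z in fock_measure. norm (f z * cnj (g z)) \<le> norm ((norm (f z))^2 + (norm (g z))^2)"
      by (simp only: norm_mult complex_mod_cnj real_norm_def le abs_of_nonneg
          add_nonneg_nonneg zero_le_power2) simp
  qed
qed

text \<open>Distinct entire functions differ on a set of positive measure, so the Fock space can be
  taken to consist of honest functions rather than of classes modulo null sets.\<close>

typedef fock = "{f. f holomorphic_on UNIV \<and> square_integrable f}"
  morphisms fock_fun Abs_fock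
  by (rule exI[of _ "\<lambda>_. 0"]) (auto simp: square_integrable_def)

declare [[coercion fock_fun]]

setup_lifting type_definition_fock

lemma fock_eqI: "(\<And>z. fock_fun f z = fock_fun g z) \<Longrightarrow> f = g"
  by (simp add: fock_fun_inject[symmetric] fun_eq_iff)

lemma square_integrable_fock [simp]: "square_integrable (fock_fun f)"
  using fock_fun[of f] by simp

lemma holomorphic_fock: "fock_fun f holomorphic_on UNIV"
  using fock_fun[of f] by simp

lift_definition cscale :: "complex \<Rightarrow> fock \<Rightarrow> fock" is "\<lambda>c f z. c * f z"
  by (auto intro: square_integrable_cmult intro!: holomorphic_intros)

instantiation fock :: real_vector
begin

lift_definition zero_fock :: fock is "\<lambda>_. 0"
  by (auto simp: square_integrable_def)

lift_definition plus_fock :: "fock \<Rightarrow> fock \<Rightarrow> fock" is "\<lambda>f g z. f z + g z"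
  by (auto intro: square_integrable_add intro!: holomorphic_intros)

definition "scaleR_fock r (f :: fock) = cscale (complex_of_real r) f"

definition "uminus_fock (f :: fock) = cscale (-1) f"

definition "minus_fock (f :: fock) g = f + - g"

lemma fock_fun_scaleR: "fock_fun (r *\<^sub>R f) z = complex_of_real r * fock_fun f z"
  by (simp add: scaleR_fock_def cscale.rep_eq)

lemma fock_fun_uminus: "fock_fun (- f) z = - fock_fun f z"
  by (simp add: uminus_fock_def cscale.rep_eq)

lemma fock_fun_minus: "fock_fun (f - g) z = fock_fun f z - fock_fun g z"
  by (simp add: minus_fock_def plus_fock.rep_eq fock_fun_uminus)

instance
  by standard
    (auto intro!: fock_eqI simp: plus_fock.rep_eq zero_fock.rep_eq fock_fun_scaleR
       fock_fun_uminus fock_fun_minus algebra_simps)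

end

lemmas fock_fun_simps [simp] =
  plus_fock.rep_eq zero_fock.rep_eq cscale.rep_eq
  fock_fun_scaleR fock_fun_uminus fock_fun_minus

lemma vector_space_cscale: "vector_space cscale"
  by standard (auto intro!: fock_eqI simp: algebra_simps)

definition cinner :: "fock \<Rightarrow> fock \<Rightarrow> complex" where
  "cinner f g = (LINT z|fock_measure. f z * cnj (g z))"

lemma cinner_self: "cinner f f = complex_of_real (LINT z|fock_measure. (norm (fock_fun f z))^2)"
  unfolding cinner_def integral_complex_of_real[symmetric] by (simp only: complex_norm_square)

lemma cinner_commute: "cinner f g = cnj (cinner g f)"
proof -
  have "cnj (cinner g f) = (LINT z|fock_measure. cnj (g z * cnj (f z)))"
    unfolding cinner_def by (rule Bochner_Integration.integral_cnj[symmetric])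
  then show ?thesis
    by (simp only: cinner_def complex_cnj_mult complex_cnj_cnj mult.commute)
qed

lemma cinner_add_left: "cinner (f + g) h = cinner f h + cinner g h"
  by (simp add: cinner_def distrib_right integrable_mult_cnj)

lemma cinner_cscale_left: "cinner (cscale c f) g = c * cinner f g"
  by (simp add: cinner_def mult.assoc)

lemma AE_fock_measure: "(AE z in fock_measure. P z) \<longleftrightarrow> (AE z in lborel. P z)"
  unfolding fock_measure_def by (subst AE_density) auto

lemma cinner_self_eq_0:
  assumes "(LINT z|fock_measure. (norm (fock_fun f z))^2) = 0"
  shows "f = 0"
proof -
  have "integrable fock_measure (\<lambda>z. (norm (fock_fun f z))^2)"
    using square_integrable_fock[of f] by (simp add: square_integrable_def)
  then have "AE z in fock_measure. (norm (fock_fun f z))^2 = 0"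
    using assms by (subst (asm) integral_nonneg_eq_0_iff_AE) auto
  then have ae: "AE z in lborel. fock_fun f z = 0"
    by (simp add: AE_fock_measure)
  have "continuous_on UNIV (fock_fun f)"
    by (rule holomorphic_on_imp_continuous_on[OF holomorphic_fock])
  then have op: "open {z. fock_fun f z \<noteq> 0}"
    by (intro open_Collect_neq) auto
  have "{z. fock_fun f z \<noteq> 0} \<in> null_sets lborel"
    using ae op by (subst AE_iff_null_sets) auto
  then have "negligible {z. fock_fun f z \<noteq> 0}"
    by (simp add: negligible_iff_null_sets null_sets_completionI)
  with op have "{z. fock_fun f z \<noteq> 0} = {}"
    using open_not_negligible by blast
  then show ?thesis by (auto intro!: fock_eqI)
qed

instantiation fock :: real_inner
begin

definition "inner_fock f g = Re (cinner f g)"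
definition "norm_fock (f :: fock) = sqrt (inner f f)"
definition "sgn_fock (f :: fock) = f /\<^sub>R norm f"
definition "dist_fock (f :: fock) g = norm (f - g)"
definition [code del]:
  "(uniformity :: (fock \<times> fock) filter) = (INF e\<in>{0<..}. principal {(x, y). dist x y < e})"
definition [code del]:
  "open_fock (U :: fock set) =
     (\<forall>x\<in>U. eventually (\<lambda>(x', y). x' = x \<longrightarrow> y \<in> U) uniformity)"

instance
proof
  fix f g h :: fock and r :: real
  show "inner f g = inner g f"
    using arg_cong[OF cinner_commute[of f g], of Re] by (simp add: inner_fock_def)
  show "inner (f + g) h = inner f h + inner g h"
    by (simp add: inner_fock_def cinner_add_left)
  show "inner (r *\<^sub>R f) g = r * inner f g"
    by (simp add: inner_fock_def scaleR_fock_def cinner_cscale_left)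
  show "0 \<le> inner f f"
    by (simp add: inner_fock_def cinner_self)
  show "inner f f = 0 \<longleftrightarrow> f = 0"
    using cinner_self_eq_0[of f] by (auto simp: inner_fock_def cinner_self)
qed (simp_all add: norm_fock_def sgn_fock_def dist_fock_def uniformity_fock_def open_fock_def)

end

lemma norm_cscale: "norm (cscale c f) = norm c * norm f"
  by (simp add: norm_fock_def inner_fock_def cinner_self norm_mult power_mult_distrib
      real_sqrt_mult)

text \<open>The type of bounded operators \<open>fock \<Rightarrow>\<^sub>L fock\<close> consists of real linear maps,
  with the operator norm; the complex linear ones are singled out as
  the maps linear with respect to \<open>cscale\<close>.\<close>

definition bounded_clinear_ops :: "(fock \<Rightarrow>\<^sub>L fock) set" where
  "bounded_clinear_ops = {A. Vector_Spaces.linear cscale cscale (blinfun_apply A)}"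

lemma bounded_linear_cscale: "bounded_linear (cscale c)"
  by (rule bounded_linear_intro[where K = "norm c"])
     (auto intro!: fock_eqI simp: algebra_simps norm_cscale)

lift_definition cscale_op :: "complex \<Rightarrow> (fock \<Rightarrow>\<^sub>L fock) \<Rightarrow> (fock \<Rightarrow>\<^sub>L fock)"
  is "\<lambda>c (A :: fock \<Rightarrow> fock) f. cscale c (A f)"
  by (rule bounded_linear_compose[OF bounded_linear_cscale])

lemma vector_space_cscale_op: "vector_space cscale_op"
  by standard
    (auto intro!: blinfun_eqI fock_eqI simp: cscale_op.rep_eq blinfun.bilinear_simps algebra_simps)

definition hilbert_adjoint :: "(fock \<Rightarrow>\<^sub>L fock) \<Rightarrow> (fock \<Rightarrow>\<^sub>L fock)" where
  "hilbert_adjoint A = (THE B :: fock \<Rightarrow>\<^sub>L fock. \<forall>f g. cinner (A f) g = cinner f (B g))"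

definition cstar_subalgebra :: "(fock \<Rightarrow>\<^sub>L fock) set \<Rightarrow> bool" where
  "cstar_subalgebra \<A> \<longleftrightarrow>
     \<A> \<subseteq> bounded_clinear_ops \<and>
     module.subspace cscale_op \<A> \<and>
     (\<forall>A\<in>\<A>. \<forall>B\<in>\<A>. A o\<^sub>L B \<in> \<A>) \<and>
     (\<forall>A\<in>\<A>. hilbert_adjoint A \<in> \<A>) \<and>
     closed \<A>"

definition cstar_generated :: "(fock \<Rightarrow>\<^sub>L fock) set \<Rightarrow> (fock \<Rightarrow>\<^sub>L fock) set" where
  "cstar_generated \<G> = \<Inter>{\<A>. cstar_subalgebra \<A> \<and> \<G> \<subseteq> \<A>}"

text \<open>Elements of \<open>L\<^sup>\<infinity>\<close> are represented by Borel measurable, essentially bounded functions;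
  identities between them are stated almost everywhere.\<close>

definition Linfty :: "('a::euclidean_space \<Rightarrow> complex) set" where
  "Linfty = {f \<in> borel_measurable borel. \<exists>C. AE x in lborel. norm (f x) \<le> C}"

text \<open>Orthogonal projection of \<open>L\<^sup>2\<close> onto the Fock space, for square integrable arguments.\<close>

definition fock_proj :: "(complex \<Rightarrow> complex) \<Rightarrow> fock" where
  "fock_proj f = (THE g::fock. \<forall>h::fock. (LINT z|fock_measure. (f z - g z) * cnj (h z)) = 0)"

text \<open>For \<open>f\<close> in \<open>L\<^sup>\<infinity>\<close> the map below is bounded and linear, so that \<open>Blinfun\<close>
  only changes its type.\<close>

definition toeplitz :: "(complex \<Rightarrow> complex) \<Rightarrow> (fock \<Rightarrow>\<^sub>L fock)" where
  "toeplitz f = Blinfun (\<lambda>g::fock. fock_proj (\<lambda>z. f z * g z))"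

definition toeplitz_algebra :: "(fock \<Rightarrow>\<^sub>L fock) set" where
  "toeplitz_algebra = cstar_generated (toeplitz ` Linfty)"

text \<open>Invariance under each real translation as an identity in \<open>L\<^sup>\<infinity>\<close>.\<close>

definition vertical :: "(complex \<Rightarrow> complex) \<Rightarrow> bool" where
  "vertical f \<longleftrightarrow> (\<forall>h::real. AE z in lborel. f (z + complex_of_real h) = f z)"

lemma norm_exp_kernel:
  "(norm (exp (w * cnj u)))^2 * exp (- ((norm w)^2)) =
     (\<Prod>b\<in>Basis. exp (2 * (u \<bullet> b) * (w \<bullet> b) - (w \<bullet> b)^2))"
proof -
  have "(norm (exp (w * cnj u)))^2 * exp (- ((norm w)^2)) =
      exp (2 * Re (w * cnj u) - ((norm w)^2))"
    by (simp only: norm_exp_eq_Re exp_double[symmetric] exp_add[symmetric]) simp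
  also have "\<dots> = exp ((2 * Re u * Re w - (Re w)^2) + (2 * Im u * Im w - (Im w)^2))"
    by (simp add: cmod_power2 algebra_simps)
  also have "\<dots> = (\<Prod>b\<in>Basis. exp (2 * (u \<bullet> b) * (w \<bullet> b) - (w \<bullet> b)^2))"
    by (simp add: Basis_complex_def exp_add inner_complex_def)
  finally show ?thesis .
qed

lemma nn_integral_exp_quadratic: "(\<integral>\<^sup>+ x. ennreal (exp (2 * a * x - x^2)) \<partial>lborel) < \<infinity>"
proof -
  have "exp (2 * a * x - x^2) = exp (a^2) * sqrt pi * normal_density a (sqrt (1/2)) x" for x :: real
    by (simp add: normal_density_def power2_diff exp_add[symmetric] exp_diff[symmetric]
        exp_minus[symmetric] field_simps)
  then have "integrable lborel (\<lambda>x. exp (2 * a * x - x^2))"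
    using integrable_normal_density[of "sqrt (1/2)" a] by simp
  then show ?thesis
    by (auto simp: integrable_iff_bounded)
qed

lemma square_integrable_kernel: "square_integrable (\<lambda>w. exp (w * cnj u))"
proof -
  have "(\<integral>\<^sup>+ w. ennreal ((norm (exp (w * cnj u)))^2) \<partial>fock_measure) =
      (\<integral>\<^sup>+ w. ennreal (1 / pi) *
        (\<Prod>b\<in>Basis. ennreal (exp (2 * (u \<bullet> b) * (w \<bullet> b) - (w \<bullet> b)^2))) \<partial>lborel)"
  proof -
    have "ennreal (exp (- ((norm w)^2)) / pi) * ennreal ((norm (exp (w * cnj u)))^2) =
        ennreal (1 / pi) *
        (\<Prod>b\<in>Basis. ennreal (exp (2 * (u \<bullet> b) * (w \<bullet> b) - (w \<bullet> b)^2)))" for w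
    proof -
      have "exp (- ((norm w)^2)) / pi * (norm (exp (w * cnj u)))^2 =
          1 / pi * (\<Prod>b\<in>Basis. exp (2 * (u \<bullet> b) * (w \<bullet> b) - (w \<bullet> b)^2))"
        unfolding norm_exp_kernel[symmetric] by (simp only: times_divide_eq_left times_divide_eq_right mult_1_left mult.commute)
      then show ?thesis
        by (simp only: prod_ennreal[OF exp_ge_zero] ennreal_mult'[symmetric]
            zero_le_power2 divide_nonneg_pos exp_ge_zero pi_gt_zero zero_le_one)
    qed
    then show ?thesis
      unfolding fock_measure_def by (subst nn_integral_density) auto
  qed
  also have "\<dots> = ennreal (1 / pi) *
      (\<Prod>b\<in>Basis. \<integral>\<^sup>+ x. ennreal (exp (2 * (u \<bullet> b) * x - x^2)) \<partial>lborel)"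
    by (subst nn_integral_cmult, measurable)
       (intro arg_cong2[where f = times] refl
          nn_integral_lborel_prod[where f = "\<lambda>b x. ennreal (exp (2 * (u \<bullet> b) * x - x^2))"], auto)
  also have "\<dots> < \<infinity>"
    using nn_integral_exp_quadratic
    by (auto simp: ennreal_mult_less_top Basis_complex_def)
  finally show ?thesis
    by (auto simp: square_integrable_def integrable_iff_bounded)
qed

lift_definition fock_kernel :: "complex \<Rightarrow> fock" is "\<lambda>u w. exp (w * cnj u)"
  by (auto intro!: holomorphic_intros square_integrable_kernel)

text \<open>The bounded operator on the Fock space that extends the integral operator given on the
  linear span of the reproducing kernels. This span is dense, so there is at most one such
  operator; the description is meaningful when the integral operator is bounded.\<close>

definition singular_integral :: "fock \<Rightarrow> (fock \<Rightarrow>\<^sub>L fock)" where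
  "singular_integral \<phi> = (THE A :: fock \<Rightarrow>\<^sub>L fock. A \<in> bounded_clinear_ops \<and>
     (\<forall>f\<in>module.span cscale (range fock_kernel). \<forall>z.
        A f z = (LINT w|fock_measure. f w * exp (z * cnj w) * \<phi> (z - cnj w))))"

definition BUC :: "(real \<Rightarrow> complex) set" where
  "BUC = {b. bounded (range b) \<and> uniformly_continuous_on UNIV b}"

definition convolve :: "(real \<Rightarrow> complex) \<Rightarrow> (real \<Rightarrow> complex) \<Rightarrow> real \<Rightarrow> complex" where
  "convolve f g x = (LINT y|lborel. f (x - y) * g y)"

definition gauss :: "real \<Rightarrow> complex" where
  "gauss x = complex_of_real (sqrt (2 / pi) * exp (- 2 * x^2))"

end

theory Submission
  imports Defs "HOL-Real_Asymp.Real_Asymp"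
begin

text \<open>Under the Bargmann transform the Fock space becomes \<open>L\<^sup>2\<close> of the line and \<open>S\<^sub>\<phi>\<close> becomes
  multiplication by \<open>m\<close>, while the Toeplitz operator with symbol \<open>f(z) = m\<^sub>0(- Im z)\<close> becomes multiplication
  by \<open>g * m\<^sub>0\<close>; both facts are read off from Gaussian integrals on reproducing kernels. Part (2) then
  amounts to injectivity of the Fourier transform.

  For part (1), imaginary Weyl translations \<open>W\<^sub>s\<close> correspond to translations of \<open>m\<close>. The operators \<open>A\<close> for which
  \<open>W\<^sub>s A - A W\<^sub>s\<close> tends to 0 in norm as \<open>s\<close> tends to 0 form a C*-algebra, and Toeplitz operators belong to it
  because \<open>h\<close> is moved by at most \<open>(2 (1 - exp(- |a|^2 / 2)))^(1/2) |h|\<close> under a twisted translation by \<open>a\<close>.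
  If the multiplication operator of \<open>m\<close> lies in this algebra, the convolutions of \<open>m\<close> with narrow Gaussians are
  uniformly equicontinuous, so \<open>m\<close> is uniformly continuous. Conversely, the \<open>k \<in> L\<^sup>1\<close> for which
  all \<open>k * m\<^sub>0\<close> give operators in the Toeplitz algebra form a closed subspace that contains \<open>g\<close> and is stable under
  multiplication by characters, hence contains \<open>g(x) cos(\<delta> x)^n\<close> and in the limit every narrow Gaussian;
  and a function in BUC is the uniform limit of its convolutions with those.\<close>

subsection \<open>Riesz representation\<close>

text \<open>On the line a real Weyl translation by a is multiplication by exp (- 2 i a x), an
  imaginary one by i s is the shift from x to x + s. Every Weyl operator is a multiple of a Toeplitz
  operator with unimodular symbol, so modulations stay inside the Toeplitz algebra, while shifts
  detect continuity of \<open>m\<close>. Both directions of part (1) have to reach Gaussians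
  narrower than \<open>gauss\<close>, whose width is dictated by the reproducing kernels. The device
  is the same in both: cos (y / sqrt n)^(2 n) tends to exp (- y^2), and a cosine is the mean of two
  modulations. In the forward direction the weight exp (- 2 x^2) cos^(2 n) is read as the square of
  a function in the span of the kernels; the quadratic form of a commutator at that function bounds
  increments of Gaussian means of \<open>m\<close>, with a bound that does not depend on the width.
  Equicontinuity of these means does not yet make them converge to \<open>m\<close>. Convergence
  comes from commuting two Gaussian convolutions, and the limit is identified because convolution
  with \<open>gauss\<close> is injective on bounded functions.\<close>

lemma cauchy_schwarz_integral:
  fixes f g :: "'a \<Rightarrow> complex"
  assumes [measurable]: "f \<in> borel_measurable M" "g \<in> borel_measurable M"
    and f: "integrable M (\<lambda>x. (norm (f x))^2)" and g: "integrable M (\<lambda>x. (norm (g x))^2)"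
  shows integrable_mult_L2: "integrable M (\<lambda>x. f x * g x)"
    and "norm (LINT x|M. f x * g x)
      \<le> sqrt (LINT x|M. (norm (f x))^2) * sqrt (LINT x|M. (norm (g x))^2)"
proof -
  show int: "integrable M (\<lambda>x. f x * g x)"
  proof (rule Bochner_Integration.integrable_bound)
    show "integrable M (\<lambda>x. (norm (f x))^2 + (norm (g x))^2)"
      using f g by simp
    have "norm (f x) * norm (g x) \<le> (norm (f x))^2 + (norm (g x))^2" for x
      using sum_squares_bound[of "norm (f x)" "norm (g x)"]
        mult_nonneg_nonneg[of "norm (f x)" "norm (g x)"] by (simp del: mult_nonneg_nonneg)
    then show "AE x in M. norm (f x * g x) \<le> norm ((norm (f x))^2 + (norm (g x))^2)"
      by (simp add: norm_mult)
  qed simp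
  then have int': "integrable M (\<lambda>x. norm (f x) * norm (g x))"
    using integrable_norm[OF int] by (simp add: norm_mult)
  define A B I where "A = (LINT x|M. (norm (f x))^2)" and "B = (LINT x|M. (norm (g x))^2)"
    and "I = (LINT x|M. norm (f x) * norm (g x))"
  have nn: "A \<ge> 0" "B \<ge> 0" "I \<ge> 0"
    by (auto simp: A_def B_def I_def)
  have quad: "0 \<le> t^2 * A - 2 * t * I + B" for t
  proof -
    have "0 \<le> (LINT x|M. (t * norm (f x) - norm (g x))^2)"
      by simp
    also have "\<dots> = (LINT x|M. t^2 * (norm (f x))^2 - 2 * t * (norm (f x) * norm (g x)) + (norm (g x))^2)"
      by (simp add: power2_eq_square algebra_simps)
    also have "\<dots> = t^2 * A - 2 * t * I + B"
      unfolding A_def B_def I_def using f g int' by simp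
    finally show ?thesis .
  qed
  have "I^2 \<le> A * B"
  proof (cases "A = 0")
    case True
    have "I = 0"
    proof (rule ccontr)
      assume "I \<noteq> 0"
      then have "I > 0" using nn by simp
      \<comment> \<open>With A = 0 the quadratic is affine in t; this t gives it the value
        -1.\<close>
      then show False using quad[of "(B + 1) / (2 * I)"] True by simp
    qed
    then show ?thesis using True by simp
  next
    case False
    then have "A > 0" using nn by simp
    \<comment> \<open>The minimiser of the quadratic; its value there is B - I^2 / A.\<close>
    then show ?thesis using quad[of "I / A"]
      by (simp add: power2_eq_square field_simps)
  qed
  then have "I \<le> sqrt A * sqrt B"
    using nn by (simp add: real_sqrt_mult[symmetric] real_le_rsqrt)
  moreover have "norm (LINT x|M. f x * g x) \<le> I"
    unfolding I_def using integral_norm_bound[of M "\<lambda>x. f x * g x"] by (simp add: norm_mult)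
  ultimately show "norm (LINT x|M. f x * g x)
      \<le> sqrt (LINT x|M. (norm (f x))^2) * sqrt (LINT x|M. (norm (g x))^2)"
    by (simp add: A_def B_def)
qed

text \<open>The functional is given by its graph over a possibly incomplete subspace; that it is well defined
  need not be checked, since this is implied by the bound.\<close>

lemma riesz_graph:
  fixes G :: "('a::{real_inner, complete_space} \<times> real) set"
  assumes G: "subspace G" and C: "C \<ge> 0" and bound: "\<And>d r. (d, r) \<in> G \<Longrightarrow> \<bar>r\<bar> \<le> C * norm d"
  shows "\<exists>g. norm g \<le> C \<and> (\<forall>(d, r)\<in>G. inner d g = r)"
proof -
  \<comment> \<open>If the functional is the inner product with g, then J (d, r) = |d - g|^2 -
    |g|^2. So g is sought as the limit of a minimising sequence of J over G.\<close>
  define J where "J = (\<lambda>(d::'a, r). (norm d)^2 - 2 * r)"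
  have lower: "- (C^2) \<le> J p" if "p \<in> G" for p
  proof -
    obtain d r where p: "p = (d, r)" by (cases p)
    have "r \<le> C * norm d" using bound[of d r] that p by auto
    moreover have "0 \<le> (norm d - C)^2" by simp
    ultimately show ?thesis by (simp add: J_def p power2_eq_square algebra_simps)
  qed
  then have bdd: "bdd_below (J ` G)" by (auto intro!: bdd_belowI2)
  have ne: "G \<noteq> {}" using subspace_0[OF G] by auto
  define I where "I = Inf (J ` G)"
  have I_le: "I \<le> J p" if "p \<in> G" for p
    unfolding I_def using bdd that by (rule cINF_lower)
  have "\<exists>p\<in>G. J p < I + 1 / real (Suc n)" for n
    using cInf_lessD[of "J ` G" "I + 1 / real (Suc n)"] ne by (auto simp: I_def)
  then obtain p where p: "\<And>n. p n \<in> G" "\<And>n. J (p n) < I + 1 / real (Suc n)"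
    by metis
  define d r where "d n = fst (p n)" and "r n = snd (p n)" for n
  have dr: "p n = (d n, r n)" for n by (simp add: d_def r_def)
  \<comment> \<open>The midpoint of two near minimisers lies in G; the parallelogram law then bounds
    their distance by their excess over the infimum.\<close>
  have dist_d: "(norm (d n - d k))^2 \<le> 2 * (1 / real (Suc n) + 1 / real (Suc k))" for n k
  proof -
    have "(1/2) *\<^sub>R (p n + p k) \<in> G"
      using G p by (intro subspace_scale subspace_add) auto
    then have "I \<le> J ((1/2) *\<^sub>R (p n + p k))" by (rule I_le)
    also have "\<dots> = (norm ((1/2) *\<^sub>R (d n + d k)))^2 - (r n + r k)"
      by (simp add: J_def dr field_simps)
    also have "\<dots> = (J (p n) + J (p k)) / 2 - (norm (d n - d k))^2 / 4"
      unfolding J_def dr power2_norm_eq_inner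
      by (simp add: inner_add inner_diff inner_commute) argo
    finally have le: "I \<le> (J (p n) + J (p k)) / 2 - (norm (d n - d k))^2 / 4" .
    have "x \<le> 2 * (a + b)" if "I \<le> (j + k) / 2 - x / 4" "j < I + a" "k < I + b" for x j k a b :: real
      using that by (simp add: field_simps)
    from this[OF le p(2)[of n] p(2)[of k]] show ?thesis .
  qed
  have "Cauchy d"
  proof (rule metric_CauchyI)
    fix e :: real assume e: "e > 0"
    obtain N where N: "1 / real (Suc N) < e^2 / 4"
      using nat_approx_posE[of "e^2 / 4"] e by auto
    show "\<exists>M. \<forall>n\<ge>M. \<forall>k\<ge>M. dist (d n) (d k) < e"
    proof (intro exI allI impI)
      fix n k assume "n \<ge> N" "k \<ge> N"
      then have "1 / real (Suc n) \<le> 1 / real (Suc N)" "1 / real (Suc k) \<le> 1 / real (Suc N)"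
        by (auto intro!: divide_left_mono)
      moreover have "x < y" if "a \<le> c" "b \<le> c" "x \<le> 2 * (a + b)" "c < y / 4" for a b c x y :: real
        using that by simp
      ultimately have "(norm (d n - d k))^2 < e^2" using dist_d[of n k] N by blast
      then show "dist (d n) (d k) < e" using e by (simp add: dist_norm power_less_imp_less_base)
    qed
  qed
  then obtain g where g: "d \<longlonglongrightarrow> g" using Cauchy_convergent_iff convergent_def by blast
  have rep: "inner e g = s" if es: "(e, s) \<in> G" for e s
  proof -
    have lim0: "(\<lambda>n. - (1 / real (Suc n))) \<longlonglongrightarrow> - 0"
      by (intro tendsto_minus LIMSEQ_Suc[OF lim_const_over_n])
    \<comment> \<open>First variation: moving from \<open>p n\<close> in the direction (e, s) cannot
      lower J by more than 1 / (n + 1), and n tends to infinity.\<close>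
    have nonneg: "0 \<le> 2 * t * (inner g e - s) + t^2 * (norm e)^2" for t
    proof -
      have le: "- (1 / real (Suc n)) \<le> 2 * t * (inner (d n) e - s) + t^2 * (norm e)^2" for n
      proof -
        have "p n + t *\<^sub>R (e, s) \<in> G"
          using G p es by (intro subspace_scale subspace_add) auto
        then have "I \<le> J (p n + t *\<^sub>R (e, s))" by (rule I_le)
        also have "\<dots> = (norm (d n + t *\<^sub>R e))^2 - 2 * (r n + t * s)"
          by (simp add: J_def dr)
        also have "\<dots> = J (p n) + 2 * t * (inner (d n) e - s) + t^2 * (norm e)^2"
          unfolding J_def dr power2_norm_eq_inner
          by (simp add: inner_add inner_commute power2_eq_square algebra_simps)
        finally show ?thesis using p(2)[of n] by linarith
      qed
      have "(\<lambda>n. 2 * t * (inner (d n) e - s) + t^2 * (norm e)^2) \<longlonglongrightarrow>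
          2 * t * (inner g e - s) + t^2 * (norm e)^2"
        by (intro tendsto_intros g)
      from LIMSEQ_le[OF lim0 this] le show ?thesis by auto
    qed
    define a where "a = inner g e - s"
    have "a = 0"
    proof (rule ccontr)
      assume a: "a \<noteq> 0"
      \<comment> \<open>The added 1 keeps the test step t = - a / N defined when e = 0.\<close>
      define N where "N = (norm e)^2 + 1"
      have N: "N > 0" by (simp add: N_def add_nonneg_pos)
      have "0 \<le> 2 * (- a / N) * a + (- a / N)^2 * (norm e)^2"
        using nonneg[of "- a / N"] by (simp add: a_def)
      also have "\<dots> \<le> 2 * (- a / N) * a + (- a / N)^2 * N"
        by (intro add_left_mono mult_left_mono) (auto simp: N_def)
      also have "\<dots> = - (a^2 / N)"
        using N by (simp add: power2_eq_square field_simps)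
      finally show False using a N by (simp add: divide_le_0_iff)
    qed
    then show ?thesis by (simp add: a_def inner_commute)
  qed
  have "norm g \<le> C"
  proof -
    have "inner (d n) g \<le> C * norm (d n)" for n
      using bound[of "d n" "r n"] rep[of "d n" "r n"] p(1)[of n] by (simp add: dr)
    moreover have "(\<lambda>n. inner (d n) g) \<longlonglongrightarrow> inner g g" "(\<lambda>n. C * norm (d n)) \<longlonglongrightarrow> C * norm g"
      by (intro tendsto_intros g)+
    ultimately have "inner g g \<le> C * norm g"
      by (meson LIMSEQ_le)
    then have "norm g * norm g \<le> C * norm g"
      by (simp add: power2_norm_eq_inner[symmetric] power2_eq_square)
    then show ?thesis using C
      by (cases "norm g = 0") (auto simp: mult_le_cancel_right)
  qed
  with rep show ?thesis by blast
qed

subsection \<open>The Gaussian measure on the plane\<close>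

lemma measurable_Complex [measurable]: "(\<lambda>(x, y). Complex x y) \<in> borel \<Otimes>\<^sub>M borel \<rightarrow>\<^sub>M borel"
  unfolding borel_prod
  by (intro borel_measurable_continuous_onI) (auto simp: case_prod_unfold Complex_eq intro!: continuous_intros)

lemma lborel_complex:
  "distr (lborel \<Otimes>\<^sub>M lborel) borel (\<lambda>(x, y). Complex x y) = (lborel :: complex measure)"
proof (rule lborel_eqI[symmetric])
  fix l u :: complex
  assume lu: "\<And>b. b \<in> Basis \<Longrightarrow> l \<bullet> b \<le> u \<bullet> b"
  have le: "Re l \<le> Re u" "Im l \<le> Im u"
    using lu[of 1] lu[of \<i>] by (auto simp: Basis_complex_def)
  have "(\<lambda>(x, y). Complex x y) -` box l u \<inter> space (lborel \<Otimes>\<^sub>M lborel) = box (Re l) (Re u) \<times> box (Im l) (Im u)"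
    by (auto simp: box_def Basis_complex_def space_pair_measure)
  then show "emeasure (distr (lborel \<Otimes>\<^sub>M lborel) borel (\<lambda>(x, y). Complex x y)) (box l u) =
      ennreal (\<Prod>b\<in>Basis. (u - l) \<bullet> b)"
    using le by (subst emeasure_distr)
      (auto simp: lborel.emeasure_pair_measure_Times Basis_complex_def ennreal_mult)
qed simp

lemma nn_integral_complex:
  assumes [measurable]: "F \<in> borel_measurable borel"
  shows "(\<integral>\<^sup>+ z. F z \<partial>lborel) = (\<integral>\<^sup>+ x. \<integral>\<^sup>+ y. F (Complex x y) \<partial>lborel \<partial>lborel)"
    (is ?A) and nn_integral_complex':
    "(\<integral>\<^sup>+ z. F z \<partial>lborel) = (\<integral>\<^sup>+ y. \<integral>\<^sup>+ x. F (Complex x y) \<partial>lborel \<partial>lborel)"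
proof -
  have "(\<integral>\<^sup>+ z. F z \<partial>lborel) = (\<integral>\<^sup>+ p. F (case p of (x, y) \<Rightarrow> Complex x y) \<partial>(lborel \<Otimes>\<^sub>M lborel))"
    by (subst lborel_complex[symmetric], subst nn_integral_distr) auto
  also have "\<dots> = (\<integral>\<^sup>+ x. \<integral>\<^sup>+ y. F (Complex x y) \<partial>lborel \<partial>lborel)"
    by (subst lborel.nn_integral_fst[symmetric]) auto
  finally show A: ?A .
  show "(\<integral>\<^sup>+ z. F z \<partial>lborel) = (\<integral>\<^sup>+ y. \<integral>\<^sup>+ x. F (Complex x y) \<partial>lborel \<partial>lborel)"
    unfolding A by (subst lborel_pair.Fubini'[symmetric]) auto
qed

text \<open>The rotation splits into two one-dimensional affine substitutions, first in x for fixed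
  y with factor 1 / |c|, then in y for fixed x with factor |c|. The first one divides by c, hence
  the restriction to c \<noteq> 0.\<close>

lemma nn_integral_rotation:
  fixes F :: "complex \<Rightarrow> ennreal"
  assumes F[measurable]: "F \<in> borel_measurable borel" and c: "c \<noteq> 0" and cs: "c^2 + s^2 = 1"
  shows "(\<integral>\<^sup>+ z. F (Complex c s * z) \<partial>lborel) = (\<integral>\<^sup>+ z. F z \<partial>lborel)"
proof -
  have m1[measurable]: "(\<lambda>z. Complex c s * z) \<in> borel_measurable borel"
    by (intro borel_measurable_continuous_onI continuous_intros)
  have m2: "(\<lambda>p. Complex (fst p) (s * (fst p / c) + snd p / c)) \<in> borel \<Otimes>\<^sub>M borel \<rightarrow>\<^sub>M borel"
    unfolding borel_prod
    by (intro borel_measurable_continuous_onI) (auto simp: Complex_eq c intro!: continuous_intros)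
  have m3: "(\<lambda>(x, y). F (Complex x (s * (x / c) + y / c))) \<in> borel_measurable (borel \<Otimes>\<^sub>M borel)"
    using measurable_compose[OF m2 F] by (simp add: case_prod_unfold)
  have [measurable]: "(\<lambda>x. Complex x a) \<in> borel_measurable borel" "(\<lambda>x. Complex a x) \<in> borel_measurable borel" for a
    by (intro borel_measurable_continuous_onI; simp add: Complex_eq; intro continuous_intros)+
  have "(\<integral>\<^sup>+ z. F (Complex c s * z) \<partial>lborel) =
      (\<integral>\<^sup>+ y. \<integral>\<^sup>+ x. F (Complex (c * x - s * y) (s * x + c * y)) \<partial>lborel \<partial>lborel)"
    by (subst nn_integral_complex') (auto simp: complex_eq_iff mult_ac intro!: nn_integral_cong arg_cong[where f = F])
  also have "\<dots> = (\<integral>\<^sup>+ y. ennreal \<bar>1 / c\<bar> * (\<integral>\<^sup>+ x. F (Complex x (s * (x / c) + y / c)) \<partial>lborel) \<partial>lborel)"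
  proof (intro nn_integral_cong)
    fix y
    have [measurable]: "(\<lambda>x. Complex (c * x - s * y) (s * x + c * y)) \<in> borel_measurable borel"
      by (intro borel_measurable_continuous_onI; simp add: Complex_eq; intro continuous_intros)
    have "(\<integral>\<^sup>+ x. F (Complex (c * x - s * y) (s * x + c * y)) \<partial>lborel) = ennreal \<bar>1 / c\<bar> *
        (\<integral>\<^sup>+ x. F (Complex (c * (s * y / c + 1 / c * x) - s * y) (s * (s * y / c + 1 / c * x) + c * y)) \<partial>lborel)"
      using c by (intro nn_integral_real_affine) auto
    also have "\<dots> = ennreal \<bar>1 / c\<bar> * (\<integral>\<^sup>+ x. F (Complex x (s * (x / c) + y / c)) \<partial>lborel)"
    proof -
      have "s * (s * y / c + 1 / c * x) + c * y = s * (x / c) + y / c" for x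
      proof -
        have "s * (s * y / c + 1 / c * x) + c * y = (y * (c^2 + s^2) + s * x) / c"
          using c by (simp add: field_simps power2_eq_square)
        then show ?thesis using c by (simp add: cs field_simps)
      qed
      then show ?thesis using c by (simp add: field_simps)
    qed
    finally show "(\<integral>\<^sup>+ x. F (Complex (c * x - s * y) (s * x + c * y)) \<partial>lborel) =
        ennreal \<bar>1 / c\<bar> * (\<integral>\<^sup>+ x. F (Complex x (s * (x / c) + y / c)) \<partial>lborel)" .
  qed
  also have "\<dots> = ennreal \<bar>1 / c\<bar> * (\<integral>\<^sup>+ y. \<integral>\<^sup>+ x. F (Complex x (s * (x / c) + y / c)) \<partial>lborel \<partial>lborel)"
    using m3 by (intro nn_integral_cmult) (auto intro!: lborel.borel_measurable_nn_integral measurable_compose[OF measurable_pair_swap'] simp: case_prod_unfold)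
  also have "\<dots> = ennreal \<bar>1 / c\<bar> * (\<integral>\<^sup>+ x. \<integral>\<^sup>+ y. F (Complex x (s * (x / c) + y / c)) \<partial>lborel \<partial>lborel)"
    using m3 by (subst lborel_pair.Fubini') auto
  also have "\<dots> = ennreal \<bar>1 / c\<bar> * (\<integral>\<^sup>+ x. ennreal \<bar>c\<bar> * (\<integral>\<^sup>+ y. F (Complex x y) \<partial>lborel) \<partial>lborel)"
  proof -
    have "(\<integral>\<^sup>+ y. F (Complex x (s * (x / c) + y / c)) \<partial>lborel) = ennreal \<bar>c\<bar> * (\<integral>\<^sup>+ y. F (Complex x y) \<partial>lborel)" for x
    proof -
      have [measurable]: "(\<lambda>y. Complex x (s * (x / c) + y / c)) \<in> borel_measurable borel"
        using c by (intro borel_measurable_continuous_onI; simp add: Complex_eq; intro continuous_intros) auto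
      have "(\<integral>\<^sup>+ y. F (Complex x (s * (x / c) + y / c)) \<partial>lborel) = ennreal \<bar>c\<bar> *
          (\<integral>\<^sup>+ y. F (Complex x (s * (x / c) + (- s * x + c * y) / c)) \<partial>lborel)"
        using c by (intro nn_integral_real_affine) auto
      moreover have "s * (x / c) + (- s * x + c * y) / c = y" for y
        using c by (simp add: field_simps)
      ultimately show ?thesis by simp
    qed
    then show ?thesis by simp
  qed
  also have "\<dots> = (\<integral>\<^sup>+ x. \<integral>\<^sup>+ y. F (Complex x y) \<partial>lborel \<partial>lborel)"
    using c by (subst nn_integral_cmult)
      (auto intro!: lborel.borel_measurable_nn_integral simp: mult.assoc[symmetric] ennreal_mult'[symmetric])
  also have "\<dots> = (\<integral>\<^sup>+ z. F z \<partial>lborel)"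
    by (rule nn_integral_complex[symmetric]) fact
  finally show ?thesis .
qed

lemma lborel_complex_rotation:
  fixes \<xi> :: complex
  assumes "norm \<xi> = 1"
  shows "distr lborel borel ((*) \<xi>) = lborel"
proof -
  have m[measurable]: "(*) (\<zeta>::complex) \<in> borel_measurable borel" for \<zeta>
    by (intro borel_measurable_continuous_onI continuous_intros)
  have nz: "distr lborel borel ((*) \<zeta>) = lborel" if "norm \<zeta> = 1" "Re \<zeta> \<noteq> 0" for \<zeta> :: complex
  proof (rule measure_eqI)
    fix A assume "A \<in> sets (distr lborel borel ((*) \<zeta>))"
    then have [measurable]: "A \<in> sets borel" by simp
    have "(Re \<zeta>)^2 + (Im \<zeta>)^2 = 1" using that by (simp add: cmod_def)
    from nn_integral_rotation[of "indicator A", OF _ that(2) this]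
    have "(\<integral>\<^sup>+ z. indicator A (\<zeta> * z) \<partial>lborel) = emeasure lborel A"
      by simp
    then show "emeasure (distr lborel borel ((*) \<zeta>)) A = emeasure lborel A"
      by (subst nn_integral_indicator[symmetric], simp, subst nn_integral_distr) simp_all
  qed simp
  show ?thesis
  proof (cases "Re \<xi> = 0")
    case True
    \<comment> \<open>A rotation by a purely imaginary number is the square of a rotation whose real
      part is nonzero, to which \<open>nz\<close> applies twice.\<close>
    define \<zeta> where "\<zeta> = csqrt \<xi>"
    have sq: "\<zeta> * \<zeta> = \<xi>" unfolding \<zeta>_def by (metis power2_csqrt power2_eq_square)
    have n: "norm \<zeta> = 1" using assms unfolding \<zeta>_def by simp
    have "Re \<zeta> \<noteq> 0"
    proof
      assume "Re \<zeta> = 0"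
      then have "\<zeta> = \<i> * Im \<zeta>" by (simp add: complex_eq_iff)
      moreover have "Im \<zeta> = 1 \<or> Im \<zeta> = -1" using n \<open>Re \<zeta> = 0\<close> by (simp add: cmod_def abs_if split: if_splits)
      ultimately have "\<xi> = -1" using sq by auto
      then show False using True by simp
    qed
    from nz[OF n this] have eq: "distr lborel borel ((*) \<zeta>) = lborel" .
    have "distr lborel borel ((*) \<xi>) = distr (distr lborel borel ((*) \<zeta>)) borel ((*) \<zeta>)"
      by (subst distr_distr) (auto simp: comp_def sq[symmetric] mult.assoc fun_eq_iff intro!: arg_cong[where f = "distr lborel borel"])
    then show ?thesis using eq by simp
  qed (use nz assms in auto)
qed

lemma integral_fock_measure:
  fixes f :: "complex \<Rightarrow> 'a::{banach, second_countable_topology}"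
  assumes [measurable]: "f \<in> borel_measurable borel"
  shows "(LINT z|fock_measure. f z) = (LINT z|lborel. (exp (- ((norm z)^2)) / pi) *\<^sub>R f z)"
  unfolding fock_measure_def by (subst integral_density) auto

lemma integrable_fock_measure:
  fixes f :: "complex \<Rightarrow> 'a::{banach, second_countable_topology}"
  assumes [measurable]: "f \<in> borel_measurable borel"
  shows "integrable fock_measure f \<longleftrightarrow> integrable lborel (\<lambda>z. (exp (- ((norm z)^2)) / pi) *\<^sub>R f z)"
  unfolding fock_measure_def by (subst integrable_density) auto

lemma fock_measure_rotation:
  fixes f :: "complex \<Rightarrow> 'a::{banach, second_countable_topology}"
  assumes [measurable]: "f \<in> borel_measurable borel" and "norm \<xi> = 1"
  shows integrable_fock_measure_rotation:
      "integrable fock_measure (\<lambda>z. f (\<xi> * z)) \<longleftrightarrow> integrable fock_measure f"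
    and integral_fock_measure_rotation: "(LINT z|fock_measure. f (\<xi> * z)) = (LINT z|fock_measure. f z)"
proof -
  have m[measurable]: "(*) (\<zeta>::complex) \<in> borel_measurable borel" for \<zeta>
    by (intro borel_measurable_continuous_onI continuous_intros)
  define h where "h z = (exp (- ((norm z)^2)) / pi) *\<^sub>R f z" for z
  have [measurable]: "h \<in> borel_measurable borel" unfolding h_def by measurable
  have h: "(exp (- ((norm z)^2)) / pi) *\<^sub>R f (\<xi> * z) = h (\<xi> * z)" for z
    using assms(2) by (simp add: h_def norm_mult)
  have "integrable lborel (\<lambda>z. h (\<xi> * z)) \<longleftrightarrow> integrable (distr lborel borel ((*) \<xi>)) h"
    by (rule integrable_distr_eq[symmetric]) simp_all
  then show "integrable fock_measure (\<lambda>z. f (\<xi> * z)) \<longleftrightarrow> integrable fock_measure f"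
    using assms(2) by (simp add: integrable_fock_measure h lborel_complex_rotation) (simp add: h_def[abs_def])
  have "(LINT z|lborel. h (\<xi> * z)) = (LINT z|distr lborel borel ((*) \<xi>). h z)"
    by (rule integral_distr[symmetric]) simp_all
  then show "(LINT z|fock_measure. f (\<xi> * z)) = (LINT z|fock_measure. f z)"
    using assms(2) by (simp add: integral_fock_measure h lborel_complex_rotation) (simp add: h_def[abs_def])
qed

lemma prob_space_fock_measure: "prob_space fock_measure"
proof
  define n where "n = normal_density 0 (sqrt (1 / 2))"
  have n: "n x = exp (- (x^2)) / sqrt pi" for x
    by (simp add: n_def normal_density_def)
  have n1: "(\<integral>\<^sup>+ x. ennreal (n x) \<partial>lborel) = 1"
    unfolding n_def using integral_normal_density[of "sqrt (1/2)" 0] integrable_normal_density[of "sqrt (1/2)" 0]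
    by (subst nn_integral_eq_integral) (auto simp: normal_density_nonneg)
  have [measurable]: "n \<in> borel_measurable borel" by (simp add: n_def)
  have nn: "n x \<ge> 0" for x by (simp add: n)
  have "emeasure fock_measure (space fock_measure) = (\<integral>\<^sup>+ z. ennreal (exp (- ((norm z)^2)) / pi) \<partial>(lborel :: complex measure))"
    unfolding fock_measure_def by (simp add: emeasure_density)
  also have "\<dots> = (\<integral>\<^sup>+ x. \<integral>\<^sup>+ y. ennreal (n x) * ennreal (n y) \<partial>lborel \<partial>lborel)"
    by (subst nn_integral_complex)
      (auto intro!: nn_integral_cong arg_cong[where f = ennreal] simp: ennreal_mult[symmetric] nn n cmod_power2 exp_add[symmetric])
  also have "\<dots> = 1" using n1 by (simp add: nn_integral_cmult)
  finally show "emeasure fock_measure (space fock_measure) = 1" .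
qed

interpretation fock_measure: prob_space fock_measure
  by (rule prob_space_fock_measure)

text \<open>Cauchy's formula at 0 for the function taking u to h (u w) on the unit circle. Putting w
  into the function rather than into the radius covers w = 0 as well.\<close>

lemma circle_mean_value:
  assumes h: "h holomorphic_on UNIV"
  shows "set_integrable lborel {0..1} (\<lambda>t. h (exp (2 * of_real pi * \<i> * of_real t) * w))"
    and "(LINT t:{0..1}|lborel. h (exp (2 * of_real pi * \<i> * of_real t) * w)) = h 0"
proof -
  define e where "e t = exp (2 * of_real pi * \<i> * complex_of_real t)" for t
  have cont: "continuous_on S (\<lambda>t. h (e t * w))" for S
  proof (rule continuous_on_compose2[OF holomorphic_on_imp_continuous_on[OF h]])
    show "continuous_on S (\<lambda>t. e t * w)"
      unfolding e_def by (intro continuous_intros)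
  qed simp
  then show int: "set_integrable lborel {0..1} (\<lambda>t. h (exp (2 * of_real pi * \<i> * of_real t) * w))"
    unfolding e_def by (rule borel_integrable_atLeastAtMost')
  have "(\<lambda>u. h (u * w)) holomorphic_on cball 0 1"
  proof -
    have "(\<lambda>u. u * w) holomorphic_on cball 0 1"
      by (intro holomorphic_intros)
    from holomorphic_on_compose_gen[OF this h] show ?thesis by (simp add: comp_def)
  qed
  from Cauchy_integral_circlepath_simple[OF this, of 0]
  have C: "((\<lambda>u. h (u * w) / u) has_contour_integral 2 * of_real pi * \<i> * h 0) (circlepath 0 1)"
    by simp
  have cp: "circlepath 0 1 t = e t" for t
    by (simp add: circlepath e_def)
  have vd: "vector_derivative (circlepath 0 1) (at t within {0..1}) = 2 * of_real pi * \<i> * e t"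
    if "t \<in> {0..1}" for t
    using that by (simp add: vector_derivative_circlepath01 e_def)
  from C have "((\<lambda>t. h (e t * w) / e t * (2 * of_real pi * \<i> * e t)) has_integral 2 * of_real pi * \<i> * h 0) {0..1}"
    unfolding has_contour_integral_def
    by (rule has_integral_eq[rotated]) (simp add: cp vd)
  then have "((\<lambda>t. (1 / (2 * of_real pi * \<i>)) * (h (e t * w) / e t * (2 * of_real pi * \<i> * e t))) has_integral
      (1 / (2 * of_real pi * \<i>)) * (2 * of_real pi * \<i> * h 0)) {0..1}"
    by (rule has_integral_mult_right)
  then have "((\<lambda>t. h (e t * w)) has_integral h 0) {0..1}"
    by (simp add: e_def field_simps)
  then show "(LINT t:{0..1}|lborel. h (exp (2 * of_real pi * \<i> * of_real t) * w)) = h 0"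
    using set_borel_integral_eq_integral(2)[OF int] by (simp add: e_def integral_unique)
qed

text \<open>The measure is invariant under rotations, so h may be replaced by its mean over all
  rotations; by Fubini and \<open>circle_mean_value\<close> this mean is the constant h 0.\<close>

lemma fock_measure_mean_value:
  assumes h: "h holomorphic_on UNIV" and int: "integrable fock_measure h"
  shows "(LINT z|fock_measure. h z) = h 0"
proof -
  define e where "e t = exp (2 * of_real pi * \<i> * complex_of_real t)" for t
  have ne: "norm (e t) = 1" for t by (simp add: e_def)
  have [measurable]: "h \<in> borel_measurable borel"
    using holomorphic_on_imp_continuous_on[OF h] by (rule borel_measurable_continuous_onI)
  have e2: "(\<lambda>p. e (fst p) * snd p) \<in> borel \<Otimes>\<^sub>M borel \<rightarrow>\<^sub>M borel"
    unfolding borel_prod e_def by (intro borel_measurable_continuous_onI continuous_intros)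
  define k where "k t z = indicator {0..1} t *\<^sub>R h (e t * z)" for t z
  interpret P: pair_sigma_finite lborel fock_measure
    by (intro pair_sigma_finite.intro fock_measure.sigma_finite_measure_axioms lborel.sigma_finite_measure_axioms)
  have "integrable (lborel \<Otimes>\<^sub>M fock_measure) (case_prod k)"
  proof (rule P.Fubini_integrable)
    have "(\<lambda>p. h (e (fst p) * snd p)) \<in> borel_measurable (borel \<Otimes>\<^sub>M borel)"
      by (rule measurable_compose[OF e2]) fact
    then have "(\<lambda>p. h (e (fst p) * snd p)) \<in> borel_measurable (lborel \<Otimes>\<^sub>M fock_measure)"
      by (simp cong: measurable_cong_sets)
    then show "case_prod k \<in> borel_measurable (lborel \<Otimes>\<^sub>M fock_measure)"
      unfolding k_def case_prod_unfold by measurable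
    have eq: "(LINT z|fock_measure. norm (case (t, z) of (t, z) \<Rightarrow> k t z)) =
        indicator {0..1} t *\<^sub>R (LINT z|fock_measure. norm (h z))" for t
      using integral_fock_measure_rotation[of "\<lambda>z. norm (h z)" "e t"] ne by (simp add: k_def indicator_def)
    show "integrable lborel (\<lambda>t. LINT z|fock_measure. norm (case (t, z) of (t, z) \<Rightarrow> k t z))"
      unfolding eq by (intro integrable_scaleR_left integrable_real_indicator) auto
    show "AE t in lborel. integrable fock_measure (\<lambda>z. case (t, z) of (t, z) \<Rightarrow> k t z)"
      using integrable_fock_measure_rotation[of h] ne int by (auto simp: k_def)
  qed
  from P.Fubini_integral[OF this]
  have "(LINT z|fock_measure. (LINT t|lborel. k t z)) = (LINT t|lborel. (LINT z|fock_measure. k t z))" .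
  moreover have "(LINT t|lborel. k t z) = h 0" for z
    using circle_mean_value(2)[OF h, of z] by (simp add: k_def e_def set_lebesgue_integral_def)
  moreover have "(LINT z|fock_measure. k t z) = indicator {0..1} t *\<^sub>R (LINT z|fock_measure. h z)" for t
    using integral_fock_measure_rotation[of h "e t"] ne by (simp add: k_def)
  ultimately show ?thesis using fock_measure.prob_space by simp
qed

text \<open>Substituting z + w for w turns weight times kernel into the weight times exp (- w cnj
  z), because - |z + w|^2 + z cnj (z + w) = - |w|^2 - w cnj z; the mean value property then
  evaluates at w = 0. Integrability of the product is assumed instead of membership in the Fock
  space, so that h may be exp (cnj a w) times an element of that space.\<close>

lemma fock_reproducing:
  assumes h: "h holomorphic_on UNIV" and int: "integrable fock_measure (\<lambda>w. h w * exp (z * cnj w))"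
  shows "(LINT w|fock_measure. h w * exp (z * cnj w)) = h z"
proof -
  have [measurable]: "h \<in> borel_measurable borel"
    using holomorphic_on_imp_continuous_on[OF h] by (rule borel_measurable_continuous_onI)
  have c[measurable]: "cnj \<in> borel_measurable borel"
    by (intro borel_measurable_continuous_onI continuous_intros)
  have p[measurable]: "(+) (a::complex) \<in> borel_measurable borel" for a
    by (intro borel_measurable_continuous_onI continuous_intros)
  define F where "F w = (exp (- ((norm w)^2)) / pi) *\<^sub>R (h w * exp (z * cnj w))" for w
  have [measurable]: "F \<in> borel_measurable borel" unfolding F_def by measurable
  define H where "H w = h (z + w) * exp (- w * cnj z)" for w
  have H: "H holomorphic_on UNIV"
  proof -
    have "(\<lambda>w. z + w) holomorphic_on UNIV"
      by (intro holomorphic_intros)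
    from holomorphic_on_compose_gen[OF this h] have "(\<lambda>w. h (z + w)) holomorphic_on UNIV"
      by (simp add: comp_def)
    then show ?thesis unfolding H_def by (intro holomorphic_intros)
  qed
  then have [measurable]: "H \<in> borel_measurable borel"
    by (intro borel_measurable_continuous_onI holomorphic_on_imp_continuous_on)
  have FH: "F (z + w) = (exp (- ((norm w)^2)) / pi) *\<^sub>R H w" for w
  proof -
    have "complex_of_real (exp (- ((norm (z + w))^2))) * exp (z * cnj (z + w)) =
        complex_of_real (exp (- ((norm w)^2))) * exp (- w * cnj z)"
      unfolding exp_of_real[symmetric] of_real_minus complex_norm_square exp_add[symmetric]
      by (rule arg_cong[where f = exp]) (simp add: algebra_simps)
    then show ?thesis
      by (simp add: F_def H_def scaleR_conv_of_real mult_ac)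
  qed
  have "integrable lborel F"
    using int unfolding F_def by (subst (asm) integrable_fock_measure) auto
  then have "integrable lborel (\<lambda>w. F (z + w))"
    using integrable_distr_eq[of "(+) z" lborel borel F] by (simp add: lborel_distr_plus)
  then have intH: "integrable fock_measure H"
    unfolding FH by (subst integrable_fock_measure) auto
  have "(LINT w|fock_measure. h w * exp (z * cnj w)) = (LINT w|lborel. F w)"
    unfolding F_def by (subst integral_fock_measure) auto
  also have "\<dots> = (LINT w|lborel. F (z + w))"
    using integral_distr[of "(+) z" lborel borel F] by (simp add: lborel_distr_plus)
  also have "\<dots> = (LINT w|fock_measure. H w)"
    unfolding FH by (subst integral_fock_measure) auto
  also have "\<dots> = H 0"
    by (rule fock_measure_mean_value[OF H intH])
  finally show ?thesis by (simp add: H_def)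
qed

subsection \<open>The Fock space as a Hilbert space\<close>

lemma borel_measurable_fock [measurable]: "fock_fun f \<in> borel_measurable borel"
  using square_integrable_fock[of f] by (simp add: square_integrable_def)

lemma integrable_norm_fock: "integrable fock_measure (\<lambda>z. (norm (fock_fun f z))^2)"
  using square_integrable_fock[of f] by (simp add: square_integrable_def)

lemma norm_fock_eq: "norm f = sqrt (LINT z|fock_measure. (norm (fock_fun f z))^2)"
  by (simp add: norm_fock_def inner_fock_def cinner_self)

lemma fock_kernel_apply [simp]: "fock_fun (fock_kernel u) w = exp (w * cnj u)"
  by (simp add: fock_kernel.rep_eq)

lemma cinner_fock_kernel: "cinner f (fock_kernel u) = fock_fun f u"
proof -
  have eq: "fock_fun f w * cnj (fock_fun (fock_kernel u) w) = fock_fun f w * exp (u * cnj w)" for w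
    by (simp add: exp_cnj mult.commute)
  have "integrable fock_measure (\<lambda>w. fock_fun f w * cnj (fock_fun (fock_kernel u) w))"
    by (rule integrable_mult_cnj) (simp_all add: square_integrable_kernel)
  then show ?thesis
    unfolding cinner_def eq by (intro fock_reproducing holomorphic_fock)
qed

lemma cinner_fock_kernel_left: "cinner (fock_kernel u) f = cnj (fock_fun f u)"
  using cinner_commute[of "fock_kernel u" f] by (simp add: cinner_fock_kernel)

lemma L2_cauchy_schwarz:
  assumes "square_integrable F" "square_integrable G"
  shows "norm (LINT z|fock_measure. F z * cnj (G z)) \<le>
    sqrt (LINT z|fock_measure. (norm (F z))^2) * sqrt (LINT z|fock_measure. (norm (G z))^2)"
proof -
  have [measurable]: "cnj \<in> borel_measurable borel"
    by (intro borel_measurable_continuous_onI continuous_intros)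
  have [measurable]: "F \<in> borel_measurable borel" "G \<in> borel_measurable borel"
    using assms by (auto simp: square_integrable_def)
  have "F \<in> borel_measurable fock_measure" "(\<lambda>z. cnj (G z)) \<in> borel_measurable fock_measure"
    by measurable
  from cauchy_schwarz_integral(2)[OF this] show ?thesis
    using assms by (simp add: square_integrable_def)
qed

lemma cinner_cauchy_schwarz: "norm (cinner f g) \<le> norm f * norm g"
  unfolding cinner_def norm_fock_eq by (rule L2_cauchy_schwarz) simp_all

lemma cinner_simps:
  "cinner (f + g) h = cinner f h + cinner g h"
  "cinner h (f + g) = cinner h f + cinner h g"
  "cinner (f - g) h = cinner f h - cinner g h"
  "cinner h (f - g) = cinner h f - cinner h g"
  "cinner (cscale c f) h = c * cinner f h"
  "cinner h (cscale c f) = cnj c * cinner h f"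
  "cinner 0 h = 0" "cinner h 0 = 0"
proof -
  note l = cinner_add_left cinner_cscale_left
  have r: "cinner h (f + g) = cinner h f + cinner h g" "cinner h (cscale c f) = cnj c * cinner h f" for f g h c
    by (subst (1 2 3) cinner_commute, simp add: l) (subst (1 2) cinner_commute, simp add: l)
  show "cinner (f + g) h = cinner f h + cinner g h" "cinner h (f + g) = cinner h f + cinner h g"
    "cinner (cscale c f) h = c * cinner f h" "cinner h (cscale c f) = cnj c * cinner h f"
    by (fact l r)+
  show "cinner (f - g) h = cinner f h - cinner g h" "cinner h (f - g) = cinner h f - cinner h g"
    by (simp_all add: minus_fock_def uminus_fock_def l r)
  have "cscale 0 0 = 0" by (rule fock_eqI) simp
  then show "cinner 0 h = 0" "cinner h 0 = 0"
    using l(2)[of 0 0 h] r(2)[of h 0 0] by simp_all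
qed

lemma cinner_norm: "cinner f f = complex_of_real ((norm f)^2)"
  by (simp add: cinner_self norm_fock_eq)

lemma inner_fock_Re: "inner f g = Re (cinner f g)"
  by (rule inner_fock_def)

lemma fock_eqI_kernel:
  assumes "\<And>u. cinner (fock_kernel u) h = cinner (fock_kernel u) h'"
  shows "h = h'"
  using assms by (intro fock_eqI) (simp add: cinner_fock_kernel_left)

lemma norm_fock_kernel: "norm (fock_kernel u) = exp ((norm u)^2 / 2)"
proof -
  have "complex_of_real ((norm (fock_kernel u))^2) = exp (u * cnj u)"
    using cinner_fock_kernel[of "fock_kernel u" u] by (simp add: cinner_norm)
  also have "\<dots> = complex_of_real (exp ((norm u)^2))"
    unfolding exp_of_real[symmetric] complex_norm_square ..
  also have "exp ((norm u)^2) = (exp ((norm u)^2 / 2))^2"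
    by (simp add: exp_double[symmetric])
  finally show ?thesis
    unfolding of_real_eq_iff by (simp add: power2_eq_iff_nonneg)
qed

lemma fock_pointwise_bound: "norm (fock_fun f u) \<le> norm f * exp ((norm u)^2 / 2)"
  using cinner_cauchy_schwarz[of f "fock_kernel u"] by (simp add: cinner_fock_kernel norm_fock_kernel)

lemma nn_integral_norm_fock:
  "(\<integral>\<^sup>+ z. ennreal ((norm (fock_fun f z))^2) \<partial>fock_measure) = ennreal ((norm f)^2)"
  by (subst nn_integral_eq_integral) (auto simp: integrable_norm_fock norm_fock_eq)

text \<open>Fatou's lemma. In the completeness proof it is applied to the differences
  \<open>X n - X k\<close> as k tends to infinity, with a Cauchy bound as e.\<close>

lemma fock_fatou:
  assumes lim: "\<And>z. (\<lambda>k. fock_fun (X k) z) \<longlonglongrightarrow> h z" and bound: "\<And>k. k \<ge> N \<Longrightarrow> norm (X k) \<le> e"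
    and h[measurable]: "h \<in> borel_measurable borel"
  shows "square_integrable h" and "(LINT z|fock_measure. (norm (h z))^2) \<le> e^2"
proof -
  have e: "e \<ge> 0" using bound[of N] norm_ge_zero[of "X N"] by linarith
  have "(\<integral>\<^sup>+ z. ennreal ((norm (h z))^2) \<partial>fock_measure) =
      (\<integral>\<^sup>+ z. liminf (\<lambda>k. ennreal ((norm (fock_fun (X k) z))^2)) \<partial>fock_measure)"
  proof (intro nn_integral_cong)
    fix z
    have "(\<lambda>k. ennreal ((norm (fock_fun (X k) z))^2)) \<longlonglongrightarrow> ennreal ((norm (h z))^2)"
      by (intro tendsto_intros lim)
    then show "ennreal ((norm (h z))^2) = liminf (\<lambda>k. ennreal ((norm (fock_fun (X k) z))^2))"
      using lim_imp_Liminf[OF sequentially_bot] by metis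
  qed
  also have "\<dots> \<le> liminf (\<lambda>k. \<integral>\<^sup>+ z. ennreal ((norm (fock_fun (X k) z))^2) \<partial>fock_measure)"
    by (rule nn_integral_liminf) simp
  also have "\<dots> \<le> ennreal (e^2)"
  proof (rule Liminf_le)
    show "\<forall>\<^sub>F k in sequentially. (\<integral>\<^sup>+ z. ennreal ((norm (fock_fun (X k) z))^2) \<partial>fock_measure) \<le> ennreal (e^2)"
      unfolding nn_integral_norm_fock
      by (intro eventually_sequentiallyI[of N] ennreal_leI power_mono bound) auto
  qed simp
  finally have le: "(\<integral>\<^sup>+ z. ennreal ((norm (h z))^2) \<partial>fock_measure) \<le> ennreal (e^2)" .
  then show si: "square_integrable h"
    by (auto simp: square_integrable_def integrable_iff_bounded intro: le_less_trans)
  then have "ennreal (LINT z|fock_measure. (norm (h z))^2) \<le> ennreal (e^2)"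
    using le by (subst nn_integral_eq_integral[symmetric]) (auto simp: square_integrable_def)
  then show "(LINT z|fock_measure. (norm (h z))^2) \<le> e^2"
    by (simp add: ennreal_le_iff)
qed

text \<open>By \<open>fock_pointwise_bound\<close> a Cauchy sequence is uniformly Cauchy on every
  disc of radius 1, so its pointwise limit is entire; Fatou's lemma supplies square integrability
  and convergence in norm.\<close>

instance fock :: complete_space
proof
  fix X :: "nat \<Rightarrow> fock" assume X: "Cauchy X"
  have unif: "uniformly_Cauchy_on (cball z 1) (\<lambda>n. fock_fun (X n))" for z
  proof (rule uniformly_Cauchy_onI)
    fix e :: real assume e: "e > 0"
    define B where "B = exp ((norm z + 1)^2 / 2)"
    have B: "B > 0" by (simp add: B_def)
    obtain M where M: "\<And>m n. m \<ge> M \<Longrightarrow> n \<ge> M \<Longrightarrow> norm (X m - X n) < e / B"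
      using metric_CauchyD[OF X, of "e / B"] e B by (auto simp: dist_norm)
    show "\<exists>M. \<forall>x\<in>cball z 1. \<forall>m\<ge>M. \<forall>n\<ge>M. dist (fock_fun (X m) x) (fock_fun (X n) x) < e"
    proof (intro exI ballI allI impI)
      fix x m n assume x: "x \<in> cball z 1" and mn: "m \<ge> M" "n \<ge> M"
      have "norm x \<le> norm z + 1"
        using x norm_triangle_ineq2[of x z] by (simp add: dist_norm norm_minus_commute)
      then have "exp ((norm x)^2 / 2) \<le> B" by (simp add: B_def power_mono)
      then have "norm (X m - X n) * exp ((norm x)^2 / 2) \<le> norm (X m - X n) * B"
        by (intro mult_left_mono) auto
      also have "\<dots> < e" using M[OF mn] B by (simp add: field_simps)
      finally have "norm (fock_fun (X m - X n) x) < e"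
        using fock_pointwise_bound[of "X m - X n" x] by linarith
      then show "dist (fock_fun (X m) x) (fock_fun (X n) x) < e" by (simp add: dist_norm)
    qed
  qed
  have "\<exists>l. (\<lambda>n. fock_fun (X n) z) \<longlonglongrightarrow> l" for z
  proof -
    have "uniformly_convergent_on (cball z 1) (\<lambda>n. fock_fun (X n))"
      by (rule Cauchy_uniformly_convergent[OF unif])
    then show ?thesis
      by (auto simp: uniformly_convergent_on_def dest!: tendsto_uniform_limitI[where x = z])
  qed
  then obtain h where h: "\<And>z. (\<lambda>n. fock_fun (X n) z) \<longlonglongrightarrow> h z" by metis
  have "h holomorphic_on UNIV"
  proof (rule holomorphic_uniform_sequence[OF open_UNIV])
    fix z :: complex
    obtain l where l: "uniform_limit (cball z 1) (\<lambda>n. fock_fun (X n)) l sequentially"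
      using Cauchy_uniformly_convergent[OF unif] by (auto simp: uniformly_convergent_on_def)
    have eq: "l x = h x" if "x \<in> cball z 1" for x
      using tendsto_uniform_limitI[OF l that] h LIMSEQ_unique by blast
    have "uniform_limit (cball z 1) (\<lambda>n. fock_fun (X n)) l sequentially =
        uniform_limit (cball z 1) (\<lambda>n. fock_fun (X n)) h sequentially"
      by (rule uniform_limit_cong') (auto intro: eq)
    then have "uniform_limit (cball z 1) (\<lambda>n. fock_fun (X n)) h sequentially"
      using l by simp
    then show "\<exists>d>0. cball z d \<subseteq> UNIV \<and> uniform_limit (cball z d) (\<lambda>n. fock_fun (X n)) h sequentially"
      by (intro exI[of _ 1]) auto
  qed (rule holomorphic_fock)
  moreover from this have [measurable]: "h \<in> borel_measurable borel"
    by (intro borel_measurable_continuous_onI holomorphic_on_imp_continuous_on)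
  have diff: "square_integrable (\<lambda>z. fock_fun (X n) z - h z)
      \<and> (LINT z|fock_measure. (norm (fock_fun (X n) z - h z))^2) \<le> e^2"
    if "\<And>k. k \<ge> n \<Longrightarrow> norm (X n - X k) \<le> e" for n e
  proof -
    have "(\<lambda>k. fock_fun (X n - X k) z) \<longlonglongrightarrow> fock_fun (X n) z - h z" for z
      unfolding fock_fun_simps by (intro tendsto_intros h)
    from fock_fatou[of "\<lambda>k. X n - X k", OF this that] show ?thesis by simp
  qed
  have small: "\<exists>N. \<forall>n\<ge>N. \<forall>k\<ge>n. norm (X n - X k) \<le> e" if "e > 0" for e
    using metric_CauchyD[OF X that] by (force simp: dist_norm intro: less_imp_le)
  have "square_integrable h"
  proof -
    obtain n where "\<And>k. k \<ge> n \<Longrightarrow> norm (X n - X k) \<le> 1"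
      using small[of 1] by auto
    from diff[of n 1, OF this] have "square_integrable (\<lambda>z. fock_fun (X n) z - h z)" by blast
    from square_integrable_add[OF square_integrable_fock[of "X n"] square_integrable_cmult[OF this, of "-1"]]
    show ?thesis by simp
  qed
  ultimately have H: "fock_fun (Abs_fock h) = h"
    by (intro Abs_fock_inverse) simp
  have "X \<longlonglongrightarrow> Abs_fock h"
  proof (rule metric_LIMSEQ_I)
    fix e :: real assume e: "e > 0"
    obtain N where N: "\<And>n k. n \<ge> N \<Longrightarrow> k \<ge> n \<Longrightarrow> norm (X n - X k) \<le> e / 2"
      using small[of "e / 2"] e by auto
    show "\<exists>N. \<forall>n\<ge>N. dist (X n) (Abs_fock h) < e"
    proof (intro exI[of _ N] allI impI)
      fix n assume "n \<ge> N"
      then have "(LINT z|fock_measure. (norm (fock_fun (X n) z - h z))^2) \<le> (e / 2)^2"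
        using diff[of n "e / 2"] N by blast
      then have "norm (X n - Abs_fock h) \<le> e / 2"
        unfolding norm_fock_eq using e by (intro real_le_lsqrt) (auto simp: H)
      then show "dist (X n) (Abs_fock h) < e" using e by (simp add: dist_norm)
    qed
  qed
  then show "convergent X" by (rule convergentI)
qed

text \<open>The real version is applied to the real parts; since the graph is closed under
  \<open>cscale \<i>\<close>, the same vector also yields the imaginary parts.\<close>

lemma fock_riesz_graph:
  fixes G :: "(fock \<times> complex) set"
  assumes G0: "(0, 0) \<in> G" and add: "\<And>d r e s. (d, r) \<in> G \<Longrightarrow> (e, s) \<in> G \<Longrightarrow> (d + e, r + s) \<in> G"
    and scale: "\<And>c d r. (d, r) \<in> G \<Longrightarrow> (cscale c d, c * r) \<in> G"
    and C: "C \<ge> 0" and bound: "\<And>d r. (d, r) \<in> G \<Longrightarrow> norm r \<le> C * norm d"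
  shows "\<exists>g. norm g \<le> C \<and> (\<forall>(d, r)\<in>G. cinner d g = r)"
proof -
  define G' where "G' = (\<lambda>(d, r). (d, Re r)) ` G"
  have "subspace G'"
  proof (rule subspaceI)
    show "0 \<in> G'" using G0 by (force simp: G'_def zero_prod_def)
    show "x + y \<in> G'" if "x \<in> G'" "y \<in> G'" for x y
      using that add by (force simp: G'_def)
    show "c *\<^sub>R x \<in> G'" if x: "x \<in> G'" for c x
    proof -
      obtain d r where d: "x = (d, Re r)" "(d, r) \<in> G" using x by (auto simp: G'_def)
      have "(c *\<^sub>R d, Re (of_real c * r)) \<in> G'"
        using scale[OF d(2), of "of_real c"] by (force simp: G'_def scaleR_fock_def)
      then show ?thesis by (simp add: d)
    qed
  qed
  moreover have "\<bar>r\<bar> \<le> C * norm d" if "(d, r) \<in> G'" for d r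
    using that bound abs_Re_le_cmod order_trans by (fastforce simp: G'_def)
  ultimately obtain g where g: "norm g \<le> C" "\<forall>(d, r)\<in>G'. inner d g = r"
    using riesz_graph[OF _ C] by blast
  have re: "Re (cinner d g) = Re r" if "(d, r) \<in> G" for d r
    using g(2) that by (force simp: G'_def inner_fock_Re)
  have "cinner d g = r" if d: "(d, r) \<in> G" for d r
    using re[OF d] re[OF scale[OF d, of \<i>]] by (simp add: complex_eq_iff cinner_simps)
  then show ?thesis using g(1) by blast
qed

lemma bounded_clinear_ops_iff:
  "A \<in> bounded_clinear_ops \<longleftrightarrow> (\<forall>c f. blinfun_apply A (cscale c f) = cscale c (blinfun_apply A f))"
  by (auto simp: bounded_clinear_ops_def Vector_Spaces.linear_iff vector_space_cscale blinfun.add_right)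

text \<open>A vector h is found for each g separately; as the vectors \<open>e i\<close> are total
  it is unique, and uniqueness makes the choice linear in g.\<close>

lemma operator_of_form:
  fixes e :: "'i \<Rightarrow> fock" and L :: "'i \<Rightarrow> fock \<Rightarrow> complex"
  assumes total: "\<And>h h'. (\<And>i. cinner (e i) h = cinner (e i) h') \<Longrightarrow> h = h'"
    and ex: "\<And>g. \<exists>h. norm h \<le> C * norm g \<and> (\<forall>i. cinner (e i) h = L i g)"
    and add: "\<And>i g g'. L i (g + g') = L i g + L i g'"
    and scale: "\<And>i c g. L i (cscale c g) = cnj c * L i g"
  obtains A :: "fock \<Rightarrow>\<^sub>L fock" where "A \<in> bounded_clinear_ops"
    "\<And>g. norm (blinfun_apply A g) \<le> C * norm g" "\<And>i g. cinner (e i) (blinfun_apply A g) = L i g"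
proof -
  obtain A where A: "\<And>g. norm (A g) \<le> C * norm g" "\<And>i g. cinner (e i) (A g) = L i g"
    using ex by metis
  have A_add: "A (g + g') = A g + A g'" for g g'
    by (rule total) (simp add: A cinner_simps add)
  have A_scale: "A (cscale c g) = cscale c (A g)" for c g
    by (rule total) (simp add: A cinner_simps scale)
  have "bounded_linear A"
    using A(1) A_scale by (intro bounded_linear_intro[where K = C]) (auto simp: A_add scaleR_fock_def mult.commute)
  then have ap: "blinfun_apply (Blinfun A) = A" by (rule bounded_linear_Blinfun_apply)
  show ?thesis
    by (rule that[of "Blinfun A"]) (simp_all add: ap A bounded_clinear_ops_iff A_scale)
qed

lemma ex_adjoint:
  assumes "A \<in> bounded_clinear_ops"
  obtains B :: "fock \<Rightarrow>\<^sub>L fock" where "B \<in> bounded_clinear_ops" "norm B \<le> norm A"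
    "\<And>f g. cinner (blinfun_apply A f) g = cinner f (blinfun_apply B g)"
proof -
  have sc: "blinfun_apply A (cscale c f) = cscale c (blinfun_apply A f)" for c f
    using assms by (simp add: bounded_clinear_ops_iff)
  have ex: "\<exists>h. norm h \<le> norm A * norm g \<and> (\<forall>d. cinner d h = cinner (blinfun_apply A d) g)" for g
  proof -
    define G where "G = range (\<lambda>d. (d, cinner (blinfun_apply A d) g))"
    have "\<exists>h. norm h \<le> norm A * norm g \<and> (\<forall>(d, r)\<in>G. cinner d h = r)"
    proof (rule fock_riesz_graph)
      show "(0, 0) \<in> G" by (force simp: G_def cinner_simps)
      show "(d + e, r + s) \<in> G" if "(d, r) \<in> G" "(e, s) \<in> G" for d r e s
        using that by (auto simp: G_def cinner_simps blinfun.add_right)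
      show "(cscale c d, c * r) \<in> G" if "(d, r) \<in> G" for c d r
        using that by (auto simp: G_def cinner_simps sc)
      show "norm r \<le> norm A * norm g * norm d" if "(d, r) \<in> G" for d r
      proof -
        have "norm r \<le> norm (blinfun_apply A d) * norm g"
          using that cinner_cauchy_schwarz by (auto simp: G_def)
        also have "\<dots> \<le> (norm A * norm d) * norm g"
          by (intro mult_right_mono norm_blinfun) auto
        finally show ?thesis by (simp add: mult_ac)
      qed
    qed simp
    then show ?thesis by (auto simp: G_def)
  qed
  obtain B :: "fock \<Rightarrow>\<^sub>L fock" where B: "B \<in> bounded_clinear_ops" "\<And>g. norm (blinfun_apply B g) \<le> norm A * norm g"
      "\<And>d g. cinner d (blinfun_apply B g) = cinner (blinfun_apply A d) g"
    by (rule operator_of_form[of "\<lambda>d. d" "norm A" "\<lambda>d g. cinner (blinfun_apply A d) g"])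
       (auto simp: cinner_simps ex intro: fock_eqI_kernel)
  show ?thesis
  proof (rule that[OF B(1)])
    show "norm B \<le> norm A" by (rule norm_blinfun_bound) (auto simp: B(2))
    show "cinner (blinfun_apply A f) g = cinner f (blinfun_apply B g)" for f g
      using B(3)[of f g] by simp
  qed
qed

lemma hilbert_adjoint:
  assumes "A \<in> bounded_clinear_ops"
  shows "hilbert_adjoint A \<in> bounded_clinear_ops" "norm (hilbert_adjoint A) \<le> norm A"
    "cinner (blinfun_apply A f) g = cinner f (blinfun_apply (hilbert_adjoint A) g)"
proof -
  obtain B :: "fock \<Rightarrow>\<^sub>L fock" where B: "B \<in> bounded_clinear_ops" "norm B \<le> norm A"
    "\<And>f g. cinner (blinfun_apply A f) g = cinner f (blinfun_apply B g)"
    using ex_adjoint[OF assms] by blast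
  have "hilbert_adjoint A = B"
    unfolding hilbert_adjoint_def
  proof (rule the_equality)
    fix B' :: "fock \<Rightarrow>\<^sub>L fock" assume "\<forall>f g. cinner (blinfun_apply A f) g = cinner f (blinfun_apply B' g)"
    then have "cinner f (blinfun_apply B' g) = cinner f (blinfun_apply B g)" for f g
      using B(3) by metis
    then show "B' = B" by (intro blinfun_eqI fock_eqI_kernel) auto
  qed (simp add: B(3))
  then show "hilbert_adjoint A \<in> bounded_clinear_ops" "norm (hilbert_adjoint A) \<le> norm A"
    "cinner (blinfun_apply A f) g = cinner f (blinfun_apply (hilbert_adjoint A) g)"
    using B by auto
qed

text \<open>Pairing with \<open>fock_kernel u\<close> is evaluation at u, so agreement on the
  kernels says that the adjoints produce functions with the same values everywhere. Equal adjoints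
  give equal operators; this takes the place of a density argument.\<close>

lemma bounded_clinear_ops_eqI:
  assumes A: "A \<in> bounded_clinear_ops" and B: "B \<in> bounded_clinear_ops"
    and eq: "\<And>u. blinfun_apply A (fock_kernel u) = blinfun_apply B (fock_kernel u)"
  shows "A = B"
proof (intro blinfun_eqI)
  fix f
  have "hilbert_adjoint A = hilbert_adjoint B"
    by (intro blinfun_eqI fock_eqI_kernel)
       (simp add: hilbert_adjoint(3)[OF A, symmetric] hilbert_adjoint(3)[OF B, symmetric] eq)
  then have "cinner (blinfun_apply A f) g = cinner (blinfun_apply B f) g" for g
    by (simp add: hilbert_adjoint(3)[OF A] hilbert_adjoint(3)[OF B])
  then show "blinfun_apply A f = blinfun_apply B f"
    by (intro fock_eqI) (metis cinner_fock_kernel)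
qed

subsection \<open>Toeplitz and Weyl operators\<close>

text \<open>Membership in \<open>Linfty\<close> with a named bound, which later becomes an operator
  norm bound; \<open>0 \<le> C\<close> lets C serve as a factor in estimates.\<close>

definition ess_bounded :: "('a::euclidean_space \<Rightarrow> complex) \<Rightarrow> real \<Rightarrow> bool" where
  "ess_bounded f C \<longleftrightarrow> f \<in> borel_measurable borel \<and> 0 \<le> C \<and> (AE x in lborel. norm (f x) \<le> C)"

lemma Linfty_iff: "f \<in> Linfty \<longleftrightarrow> (\<exists>C. ess_bounded f C)"
proof
  assume "f \<in> Linfty"
  then obtain C where f: "f \<in> borel_measurable borel" and C: "AE x in lborel. norm (f x) \<le> C"
    by (auto simp: Linfty_def)
  from C have "AE x in lborel. norm (f x) \<le> max C 0" by eventually_elim simp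
  with f show "\<exists>C. ess_bounded f C" by (auto simp: ess_bounded_def intro!: exI[of _ "max C 0"])
qed (auto simp: Linfty_def ess_bounded_def)

lemma LinftyE:
  assumes "f \<in> Linfty"
  obtains C where "ess_bounded f C"
  using assms by (auto simp: Linfty_iff)

lemma borel_measurable_cnj [measurable (raw)]:
  "f \<in> borel_measurable M \<Longrightarrow> (\<lambda>x. cnj (f x)) \<in> borel_measurable M"
  by (rule measurable_compose[of _ _ borel])
     (auto intro!: borel_measurable_continuous_onI continuous_intros)

lemma square_integrable_mult_Linfty:
  assumes f: "ess_bounded f C" and g: "square_integrable g"
  shows "square_integrable (\<lambda>z. f z * g z)"
    and "sqrt (LINT z|fock_measure. (norm (f z * g z))^2) \<le> C * sqrt (LINT z|fock_measure. (norm (g z))^2)"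
proof -
  have [measurable]: "f \<in> borel_measurable borel" "g \<in> borel_measurable borel"
    and ig: "integrable fock_measure (\<lambda>z. (norm (g z))^2)" and C: "C \<ge> 0"
    using f g by (auto simp: ess_bounded_def square_integrable_def)
  have ae: "AE z in fock_measure. (norm (f z * g z))^2 \<le> C^2 * (norm (g z))^2"
  proof -
    have "AE z in lborel. norm (f z) \<le> C" using f by (simp add: ess_bounded_def)
    then show ?thesis
      unfolding AE_fock_measure
      by eventually_elim (auto simp: norm_mult power_mult_distrib intro!: mult_right_mono power_mono)
  qed
  have int: "integrable fock_measure (\<lambda>z. (norm (f z * g z))^2)"
    by (rule Bochner_Integration.integrable_bound[OF integrable_mult_right[OF ig, of "C^2"]])
       (use ae in auto)
  then show "square_integrable (\<lambda>z. f z * g z)"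
    by (simp add: square_integrable_def)
  have "(LINT z|fock_measure. (norm (f z * g z))^2) \<le> (LINT z|fock_measure. C^2 * (norm (g z))^2)"
    by (rule integral_mono_AE[OF int _ ae]) (simp add: ig)
  then have "sqrt (LINT z|fock_measure. (norm (f z * g z))^2) \<le> sqrt (C^2 * (LINT z|fock_measure. (norm (g z))^2))"
    by (intro real_sqrt_le_mono) simp
  then show "sqrt (LINT z|fock_measure. (norm (f z * g z))^2) \<le> C * sqrt (LINT z|fock_measure. (norm (g z))^2)"
    using C by (simp add: real_sqrt_mult)
qed

text \<open>Riesz representation of the functional taking h to the integral of h times the conjugate
  of F. It shows that the description in \<open>fock_proj_def\<close> has exactly one
  solution.\<close>

lemma fock_proj:
  assumes F: "square_integrable F"
  shows cinner_fock_proj: "cinner (fock_proj F) h = (LINT z|fock_measure. F z * cnj (fock_fun h z))"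
    and norm_fock_proj: "norm (fock_proj F) \<le> sqrt (LINT z|fock_measure. (norm (F z))^2)"
proof -
  define L where "L h = (LINT z|fock_measure. fock_fun h z * cnj (F z))" for h
  have int: "integrable fock_measure (\<lambda>z. fock_fun h z * cnj (F z))" for h
    by (rule integrable_mult_cnj) (simp_all add: F)
  have "\<exists>g. norm g \<le> sqrt (LINT z|fock_measure. (norm (F z))^2) \<and> (\<forall>(d, r)\<in>range (\<lambda>h. (h, L h)). cinner d g = r)"
  proof (rule fock_riesz_graph)
    show "(0, 0) \<in> range (\<lambda>h. (h, L h))" by (force simp: L_def)
    show "(d + e, r + s) \<in> range (\<lambda>h. (h, L h))" if "(d, r) \<in> range (\<lambda>h. (h, L h))" "(e, s) \<in> range (\<lambda>h. (h, L h))" for d r e s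
      using that int by (auto simp: L_def distrib_right)
    show "(cscale c d, c * r) \<in> range (\<lambda>h. (h, L h))" if "(d, r) \<in> range (\<lambda>h. (h, L h))" for c d r
      using that by (auto simp: L_def mult.assoc)
    show "norm r \<le> sqrt (LINT z|fock_measure. (norm (F z))^2) * norm d" if "(d, r) \<in> range (\<lambda>h. (h, L h))" for d r
      using that L2_cauchy_schwarz[OF square_integrable_fock[of d] F]
      by (auto simp: L_def norm_fock_eq mult.commute)
  qed simp
  then obtain g where g: "norm g \<le> sqrt (LINT z|fock_measure. (norm (F z))^2)" "\<And>h. cinner h g = L h"
    by auto
  have g': "cinner g h = (LINT z|fock_measure. F z * cnj (fock_fun h z))" for h
    unfolding cinner_commute[of g h] g(2) L_def Bochner_Integration.integral_cnj[symmetric]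
    by (simp add: mult.commute)
  have int': "integrable fock_measure (\<lambda>z. F z * cnj (fock_fun h z))" for h
    by (rule integrable_mult_cnj) (simp_all add: F)
  have int'': "integrable fock_measure (\<lambda>z. fock_fun k z * cnj (fock_fun h z))" for h k
    by (rule integrable_mult_cnj) simp_all
  have eq: "(LINT z|fock_measure. (F z - fock_fun k z) * cnj (fock_fun h z)) = cinner g h - cinner k h" for h k
    unfolding g' unfolding cinner_def left_diff_distrib by (subst Bochner_Integration.integral_diff[OF int' int'']) simp
  have "fock_proj F = g"
    unfolding fock_proj_def
  proof (rule the_equality)
    show "\<forall>h. (LINT z|fock_measure. (F z - fock_fun g z) * cnj (fock_fun h z)) = 0"
      by (simp add: eq)
    fix k assume "\<forall>h. (LINT z|fock_measure. (F z - fock_fun k z) * cnj (fock_fun h z)) = 0"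
    then have "cinner g h = cinner k h" for h by (simp add: eq)
    then show "k = g" by (intro fock_eqI) (metis cinner_fock_kernel)
  qed
  with g(1) g' show "cinner (fock_proj F) h = (LINT z|fock_measure. F z * cnj (fock_fun h z))"
    "norm (fock_proj F) \<le> sqrt (LINT z|fock_measure. (norm (F z))^2)" by auto
qed

text \<open>Boundedness and linearity, checked here, are what makes \<open>Blinfun\<close> return
  the given map. From here on the operator is handled through its sesquilinear form.\<close>

lemma toeplitz:
  assumes f: "ess_bounded f C"
  shows toeplitz_in_ops: "toeplitz f \<in> bounded_clinear_ops"
    and cinner_toeplitz: "cinner (blinfun_apply (toeplitz f) g) h = (LINT z|fock_measure. f z * fock_fun g z * cnj (fock_fun h z))"
proof -
  define A where "A g = fock_proj (\<lambda>z. f z * fock_fun g z)" for g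
  have si: "square_integrable (\<lambda>z. f z * fock_fun g z)" for g
    by (rule square_integrable_mult_Linfty[OF f]) simp
  have A: "cinner (A g) h = (LINT z|fock_measure. f z * fock_fun g z * cnj (fock_fun h z))" for g h
    unfolding A_def by (rule cinner_fock_proj[OF si])
  have nA: "norm (A g) \<le> C * norm g" for g
    unfolding A_def
    by (rule order_trans[OF norm_fock_proj[OF si]])
      (use square_integrable_mult_Linfty(2)[OF f square_integrable_fock, of g] in \<open>simp only: norm_fock_eq[of g]\<close>)
  have int: "integrable fock_measure (\<lambda>z. f z * fock_fun g z * cnj (fock_fun h z))" for g h
    by (rule integrable_mult_cnj) (simp_all add: si)
  have total: "k = k'" if "\<And>h. cinner k h = cinner k' h" for k k'
    using that by (intro fock_eqI) (metis cinner_fock_kernel)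
  have add: "A (g + g') = A g + A g'" for g g'
    by (rule total) (simp add: A cinner_simps distrib_left distrib_right int)
  have scale: "A (cscale c g) = cscale c (A g)" for c g
  proof (rule total)
    have eq: "f z * (c * fock_fun g z) * cnj (fock_fun h z) = c * (f z * fock_fun g z * cnj (fock_fun h z))" for z h
      by (simp add: mult_ac)
    then show "cinner (A (cscale c g)) h = cinner (cscale c (A g)) h" for h
      by (simp only: A cinner_simps fock_fun_simps eq Bochner_Integration.integral_mult_right_zero)
  qed
  have "bounded_linear A"
    by (rule bounded_linear_intro[where K = C]) (use add scale nA in \<open>auto simp: scaleR_fock_def mult.commute\<close>)
  then have ap: "blinfun_apply (toeplitz f) = A"
    unfolding toeplitz_def A_def by (rule bounded_linear_Blinfun_apply)
  show "toeplitz f \<in> bounded_clinear_ops" by (simp add: bounded_clinear_ops_iff ap scale)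
  show "cinner (blinfun_apply (toeplitz f) g) h = (LINT z|fock_measure. f z * fock_fun g z * cnj (fock_fun h z))"
    by (simp add: ap A)
qed

section \<open>Weyl operators and their commutators with Toeplitz operators\<close>

definition weyl_symbol :: "complex \<Rightarrow> complex \<Rightarrow> complex" where
  "weyl_symbol a w = exp (a * cnj w - cnj a * w)"

lemma norm_weyl_symbol [simp]: "norm (weyl_symbol a w) = 1"
  by (simp add: weyl_symbol_def)

lemma cnj_weyl_symbol: "cnj (weyl_symbol a w) = weyl_symbol (- a) w"
  by (simp add: weyl_symbol_def exp_cnj)

lemma borel_measurable_weyl_symbol [measurable]: "weyl_symbol a \<in> borel_measurable borel"
  unfolding weyl_symbol_def by (intro borel_measurable_continuous_onI continuous_intros)

lemma ess_bounded_weyl_symbol: "ess_bounded (weyl_symbol a) 1"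
  by (simp add: ess_bounded_def)

text \<open>The unitary Weyl translation, whose usual formula is \<open>fock_fun_weyl\<close>. As a
  multiple of a Toeplitz operator it lies in the Toeplitz algebra by construction; the projection
  loses the factor exp (- |a|^2 / 2), which the scalar restores.\<close>

definition weyl :: "complex \<Rightarrow> (fock \<Rightarrow>\<^sub>L fock)" where
  "weyl a = cscale_op (complex_of_real (exp ((norm a)^2 / 2))) (toeplitz (weyl_symbol (- a)))"

lemma weyl_eq: "blinfun_apply (weyl a) h =
    cscale (complex_of_real (exp ((norm a)^2 / 2))) (blinfun_apply (toeplitz (weyl_symbol (- a))) h)"
  by (simp add: weyl_def cscale_op.rep_eq)

lemma weyl_in_ops: "weyl a \<in> bounded_clinear_ops"
  using toeplitz_in_ops[OF ess_bounded_weyl_symbol, of "- a"]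
  by (auto simp: bounded_clinear_ops_iff weyl_eq intro!: fock_eqI)

text \<open>The antiholomorphic factor exp (- a cnj w) of the symbol merges with exp (z cnj w) to
  the kernel at z - a, so that \<open>fock_reproducing\<close> evaluates the holomorphic function
  exp (cnj a w) h(w) there.\<close>

lemma fock_fun_weyl:
  "fock_fun (blinfun_apply (weyl a) h) z = exp (z * cnj a - complex_of_real ((norm a)^2 / 2)) * fock_fun h (z - a)"
proof -
  have int: "integrable fock_measure (\<lambda>w. (weyl_symbol (- a) w * fock_fun h w) * cnj (fock_fun (fock_kernel z) w))"
    by (rule integrable_mult_cnj) (auto intro!: square_integrable_mult_Linfty ess_bounded_weyl_symbol simp: square_integrable_kernel)
  have eq: "(weyl_symbol (- a) w * fock_fun h w) * cnj (fock_fun (fock_kernel z) w) =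
      (exp (cnj a * w) * fock_fun h w) * exp ((z - a) * cnj w)" for w
  proof -
    have "weyl_symbol (- a) w * exp (z * cnj w) = exp (cnj a * w) * exp ((z - a) * cnj w)"
      by (simp add: weyl_symbol_def exp_add[symmetric] algebra_simps)
    then show ?thesis by (simp add: exp_cnj mult_ac)
  qed
  have "fock_fun (blinfun_apply (toeplitz (weyl_symbol (- a))) h) z =
      (LINT w|fock_measure. (exp (cnj a * w) * fock_fun h w) * exp ((z - a) * cnj w))"
    unfolding eq[symmetric] cinner_toeplitz[OF ess_bounded_weyl_symbol, symmetric] by (simp only: cinner_fock_kernel)
  also have "\<dots> = exp (cnj a * (z - a)) * fock_fun h (z - a)"
    using int unfolding eq by (intro fock_reproducing holomorphic_intros holomorphic_fock)
  finally have "fock_fun (blinfun_apply (weyl a) h) z =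
      exp (complex_of_real ((norm a)^2 / 2) + cnj a * (z - a)) * fock_fun h (z - a)"
    by (simp add: weyl_eq exp_add exp_of_real[symmetric])
  also have "complex_of_real ((norm a)^2 / 2) + cnj a * (z - a) = z * cnj a - complex_of_real ((norm a)^2 / 2)"
    by (simp only: of_real_divide complex_norm_square) (simp add: field_simps)
  finally show ?thesis .
qed

lemma weyl_inverse: "blinfun_apply (weyl (- a)) (blinfun_apply (weyl a) h) = h"
proof (rule fock_eqI)
  fix z
  have "(- (z * cnj a) - complex_of_real ((norm a)^2 / 2)) + ((z + a) * cnj a - complex_of_real ((norm a)^2 / 2)) = 0"
    by (simp only: of_real_divide complex_norm_square) (simp add: field_simps)
  then show "fock_fun (blinfun_apply (weyl (- a)) (blinfun_apply (weyl a) h)) z = fock_fun h z"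
    by (simp add: fock_fun_weyl mult.assoc[symmetric] exp_add[symmetric])
qed

lemma cinner_weyl_adjoint: "cinner (blinfun_apply (weyl a) f) g = cinner f (blinfun_apply (weyl (- a)) g)"
proof -
  have "cinner f (blinfun_apply (weyl (- a)) g) =
      complex_of_real (exp ((norm a)^2 / 2)) * cnj (LINT z|fock_measure. weyl_symbol a z * fock_fun g z * cnj (fock_fun f z))"
    by (subst cinner_commute) (simp add: weyl_eq cinner_simps cinner_toeplitz[OF ess_bounded_weyl_symbol])
  also have "cnj (LINT z|fock_measure. weyl_symbol a z * fock_fun g z * cnj (fock_fun f z)) =
      (LINT z|fock_measure. weyl_symbol (- a) z * fock_fun f z * cnj (fock_fun g z))"
    unfolding Bochner_Integration.integral_cnj[symmetric] by (simp add: cnj_weyl_symbol mult_ac)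
  finally show ?thesis
    by (simp add: weyl_eq cinner_simps cinner_toeplitz[OF ess_bounded_weyl_symbol])
qed

lemma cinner_weyl: "cinner (blinfun_apply (weyl a) f) (blinfun_apply (weyl a) g) = cinner f g"
  by (simp add: cinner_weyl_adjoint weyl_inverse)

lemma norm_weyl [simp]: "norm (blinfun_apply (weyl a) f) = norm f"
proof -
  have "(norm (blinfun_apply (weyl a) f))^2 = (norm f)^2"
    using cinner_weyl[of a f f] unfolding cinner_norm of_real_eq_iff .
  then show ?thesis by simp
qed

text \<open>The twisted translate \<open>w \<mapsto> weyl_symbol a w * weyl a h w\<close> is not holomorphic, but its
  projection to the Fock space is a multiple of \<open>h\<close>; hence its distance to \<open>h\<close> is explicit.\<close>

lemma twisted_translation_distance:
  "(LINT w|fock_measure. (norm (weyl_symbol a w * fock_fun (blinfun_apply (weyl a) h) w - fock_fun h w))^2)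
     = 2 * (1 - exp (- ((norm a)^2 / 2))) * (norm h)^2" (is "?I = _")
  and square_integrable_twisted_translation:
  "square_integrable (\<lambda>w. weyl_symbol a w * fock_fun (blinfun_apply (weyl a) h) w - fock_fun h w)"
proof -
  define F where "F w = weyl_symbol a w * fock_fun (blinfun_apply (weyl a) h) w" for w
  have F: "square_integrable F"
    unfolding F_def by (rule square_integrable_mult_Linfty[OF ess_bounded_weyl_symbol]) simp
  have "square_integrable (\<lambda>w. F w + (-1) * fock_fun h w)"
    by (intro square_integrable_add square_integrable_cmult F square_integrable_fock)
  then show "square_integrable (\<lambda>w. weyl_symbol a w * fock_fun (blinfun_apply (weyl a) h) w - fock_fun h w)"
    by (simp add: F_def)
  have "(LINT w|fock_measure. F w * cnj (fock_fun h w)) = cinner (blinfun_apply (toeplitz (weyl_symbol a)) (blinfun_apply (weyl a) h)) h"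
    by (simp add: cinner_toeplitz[OF ess_bounded_weyl_symbol] F_def)
  \<comment> \<open>\<open>toeplitz (weyl_symbol a)\<close> is exp (- |a|^2 / 2) times
    \<open>weyl (- a)\<close>, which undoes \<open>weyl a\<close>; this makes the cross term
    explicit.\<close>
  also have "blinfun_apply (toeplitz (weyl_symbol a)) (blinfun_apply (weyl a) h) =
      cscale (complex_of_real (exp (- ((norm a)^2 / 2)))) (blinfun_apply (weyl (- a)) (blinfun_apply (weyl a) h))"
    by (rule fock_eqI) (simp add: weyl_eq[of "- a"] exp_minus del: of_real_exp)
  finally have inner: "(LINT w|fock_measure. F w * cnj (fock_fun h w)) = complex_of_real (exp (- ((norm a)^2 / 2)) * (norm h)^2)"
    by (simp add: weyl_inverse cinner_simps cinner_norm)
  have int: "integrable fock_measure (\<lambda>w. F w * cnj (fock_fun h w))"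
    by (rule integrable_mult_cnj) (simp_all add: F)
  have nF: "norm (F w) = norm (fock_fun (blinfun_apply (weyl a) h) w)" for w
    by (simp add: F_def norm_mult)
  have pt: "(norm (x - y))^2 = (norm x)^2 + (norm y)^2 - 2 * Re (x * cnj y)" for x y :: complex
    by (simp add: cmod_power2 power2_diff algebra_simps)
  have "?I = (LINT w|fock_measure. (norm (F w))^2 + (norm (fock_fun h w))^2 - 2 * Re (F w * cnj (fock_fun h w)))"
    unfolding F_def[symmetric] pt ..
  also have "\<dots> = (norm (blinfun_apply (weyl a) h))^2 + (norm h)^2 - 2 * Re (LINT w|fock_measure. F w * cnj (fock_fun h w))"
  proof -
    define R where "R w = F w * cnj (fock_fun h w)" for w
    have "integrable fock_measure R" using int by (simp add: R_def[abs_def])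
    then show ?thesis
      unfolding nF R_def[symmetric] using integrable_norm_fock by (simp add: norm_fock_eq)
  qed
  finally show "?I = 2 * (1 - exp (- ((norm a)^2 / 2))) * (norm h)^2"
    unfolding inner by (simp add: algebra_simps)
qed

lemma norm_blinfun_le_cinner:
  fixes A :: "fock \<Rightarrow>\<^sub>L fock"
  assumes "B \<ge> 0" "\<And>f g. norm (cinner (blinfun_apply A f) g) \<le> B * norm f * norm g"
  shows "norm A \<le> B"
proof (rule norm_blinfun_bound)
  fix f
  have "norm (blinfun_apply A f) * norm (blinfun_apply A f) \<le> (B * norm f) * norm (blinfun_apply A f)"
    using assms(2)[of f "blinfun_apply A f"] by (simp add: cinner_norm power2_eq_square norm_mult)
  then show "norm (blinfun_apply A f) \<le> B * norm f"
    using assms(1) by (cases "norm (blinfun_apply A f) = 0") (auto simp: mult_le_cancel_right)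
qed fact

text \<open>The form of the commutator is a difference of two integrals, with the translate on h in
  the first and on g in the second. Both translates are untwisted with the same factor
  \<open>weyl_symbol (- a)\<close>; the main terms then cancel, and each of the two remainders costs
  C times the distance in \<open>twisted_translation_distance\<close>.\<close>

lemma norm_commutator_weyl_toeplitz:
  assumes f: "ess_bounded f C"
  shows "norm ((weyl a o\<^sub>L toeplitz f) - (toeplitz f o\<^sub>L weyl a)) \<le> 2 * C * sqrt (2 * (1 - exp (- ((norm a)^2 / 2))))"
proof (rule norm_blinfun_le_cinner)
  define \<delta> where "\<delta> = sqrt (2 * (1 - exp (- ((norm a)^2 / 2))))"
  have C: "C \<ge> 0" using f by (simp add: ess_bounded_def)
  then show "0 \<le> 2 * C * sqrt (2 * (1 - exp (- ((norm a)^2 / 2))))" by simp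
  fix g h
  define V where "V b k w = weyl_symbol b w * fock_fun (blinfun_apply (weyl b) k) w - fock_fun k w" for b k w
  have V: "square_integrable (V b k)" for b k
    unfolding V_def by (rule square_integrable_twisted_translation)
  have nV: "sqrt (LINT w|fock_measure. (norm (V b k w))^2) = \<delta> * norm k" if "norm b = norm a" for b k
    unfolding V_def twisted_translation_distance \<delta>_def that by (simp add: real_sqrt_mult)
  have unV: "fock_fun (blinfun_apply (weyl b) k) w = weyl_symbol (- b) w * (V b k w + fock_fun k w)" for b k w
  proof -
    have "weyl_symbol (- b) w * weyl_symbol b w = 1"
      by (simp add: weyl_symbol_def exp_add[symmetric])
    then show ?thesis by (simp add: V_def mult.assoc[symmetric])
  qed
  have fs: "ess_bounded (\<lambda>w. f w * weyl_symbol (- a) w) C"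
    using f by (auto simp: ess_bounded_def norm_mult)
  let ?s = "\<lambda>w. f w * weyl_symbol (- a) w"
  have i: "integrable fock_measure (\<lambda>w. ?s w * F w * cnj (G w))" if "square_integrable F" "square_integrable G" for F G
    by (rule integrable_mult_cnj[OF square_integrable_mult_Linfty(1)[OF fs that(1)] that(2)])
  have b: "norm (LINT w|fock_measure. ?s w * F w * cnj (G w)) \<le>
      C * sqrt (LINT w|fock_measure. (norm (F w))^2) * sqrt (LINT w|fock_measure. (norm (G w))^2)"
    if "square_integrable F" "square_integrable G" for F G
    by (rule order_trans[OF L2_cauchy_schwarz[OF square_integrable_mult_Linfty(1)[OF fs that(1)] that(2)]])
       (intro mult_right_mono square_integrable_mult_Linfty(2)[OF fs that(1)], simp)
  have i': "integrable fock_measure (\<lambda>w. f w * fock_fun g w * cnj (fock_fun h w))" for g h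
    by (rule integrable_mult_cnj[OF square_integrable_mult_Linfty(1)[OF f]]) simp_all
  have "cinner (blinfun_apply ((weyl a o\<^sub>L toeplitz f) - (toeplitz f o\<^sub>L weyl a)) g) h =
      (LINT w|fock_measure. f w * fock_fun g w * cnj (fock_fun (blinfun_apply (weyl (- a)) h) w)) -
      (LINT w|fock_measure. f w * fock_fun (blinfun_apply (weyl a) g) w * cnj (fock_fun h w))"
    unfolding blinfun.diff_left blinfun_apply_blinfun_compose cinner_simps cinner_weyl_adjoint cinner_toeplitz[OF f] ..
  also have "\<dots> = (LINT w|fock_measure. ?s w * fock_fun g w * cnj (V (- a) h w) - ?s w * V a g w * cnj (fock_fun h w))"
    unfolding Bochner_Integration.integral_diff[OF i'[of g "blinfun_apply (weyl (- a)) h"] i'[of "blinfun_apply (weyl a) g" h], symmetric]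
  proof (intro Bochner_Integration.integral_cong refl)
    fix w
    show "f w * fock_fun g w * cnj (fock_fun (blinfun_apply (weyl (- a)) h) w) -
        f w * fock_fun (blinfun_apply (weyl a) g) w * cnj (fock_fun h w) =
        ?s w * fock_fun g w * cnj (V (- a) h w) - ?s w * V a g w * cnj (fock_fun h w)"
      unfolding unV by (simp add: cnj_weyl_symbol algebra_simps)
  qed
  also have "\<dots> = (LINT w|fock_measure. ?s w * fock_fun g w * cnj (V (- a) h w)) -
      (LINT w|fock_measure. ?s w * V a g w * cnj (fock_fun h w))"
    by (intro Bochner_Integration.integral_diff i V square_integrable_fock)
  also have "norm \<dots> \<le> C * norm g * (\<delta> * norm h) + C * (\<delta> * norm g) * norm h"
    using b[OF square_integrable_fock V, of g "- a" h] b[OF V square_integrable_fock, of a g h]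
    unfolding nV[of "- a", simplified] nV[of a, simplified] norm_fock_eq[symmetric]
    by (intro norm_triangle_le_diff add_mono)
  also have "\<dots> = 2 * C * \<delta> * norm g * norm h" by (simp add: algebra_simps)
  finally show "norm (cinner (blinfun_apply ((weyl a o\<^sub>L toeplitz f) - (toeplitz f o\<^sub>L weyl a)) g) h)
      \<le> 2 * C * sqrt (2 * (1 - exp (- ((norm a)^2 / 2)))) * norm g * norm h"
    unfolding \<delta>_def .
qed

subsection \<open>Multiplication operators\<close>

text \<open>Write b = p + i q. The real shift p / (2 s) completes the square, and rescaling by t = 1
  / sqrt (2 s) leaves the standard normal density times exp (i q t y), whose integral is a
  characteristic function.\<close>

lemma gaussian_integral:
  fixes b :: complex and s :: real
  assumes s: "s > 0"
  shows integrable_gaussian: "integrable lborel (\<lambda>x. exp (b * of_real x - of_real (s * x^2)))"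
    and "(LINT x|lborel. exp (b * of_real x - of_real (s * x^2))) = of_real (sqrt (pi / s)) * exp (b^2 / of_real (4 * s))"
proof -
  define t where "t = 1 / sqrt (2 * s)"
  have t: "t > 0" "t^2 * s = 1 / 2" using s by (auto simp: t_def power_divide)
  define p q where "p = Re b" and "q = Im b"
  have b: "b = of_real p + \<i> * of_real q" by (simp add: p_def q_def complex_eq_iff)
  define K where "K = of_real (sqrt (2 * pi)) * exp (of_real (p^2 / (4 * s)) + \<i> * of_real (q * p / (2 * s)))"
  have eq: "exp (b * of_real (p / (2 * s) + t * y) - of_real (s * (p / (2 * s) + t * y)^2)) =
      K * (std_normal_density y *\<^sub>R iexp (q * t * y))" for y
  proof -
    have 1: "- (s * (p / (2 * s) + t * y)^2) + p * (p / (2 * s) + t * y) = p^2 / (4 * s) - y^2 / 2"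
    proof -
      have "- (s * (p / (2 * s) + t * y)^2) + p * (p / (2 * s) + t * y) = p^2 / (4 * s) - (t^2 * s) * y^2"
        using s by (simp add: power2_eq_square field_simps)
      then show ?thesis by (simp add: t(2))
    qed
    have "b * of_real (p / (2 * s) + t * y) - of_real (s * (p / (2 * s) + t * y)^2) =
        of_real (- (s * (p / (2 * s) + t * y)^2) + p * (p / (2 * s) + t * y)) + \<i> * of_real (q * (p / (2 * s) + t * y))"
      by (simp add: b algebra_simps add_divide_distrib)
    also have "\<dots> = (of_real (p^2 / (4 * s)) + \<i> * of_real (q * p / (2 * s))) + of_real (- (y^2 / 2)) + \<i> * of_real (q * t * y)"
      unfolding 1 by (simp add: algebra_simps)
    finally have "exp (b * of_real (p / (2 * s) + t * y) - of_real (s * (p / (2 * s) + t * y)^2)) =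
        exp (of_real (p^2 / (4 * s)) + \<i> * of_real (q * p / (2 * s))) * of_real (exp (- (y^2 / 2))) * iexp (q * t * y)"
      by (simp only: exp_add exp_of_real)
    then show ?thesis
      by (simp add: K_def std_normal_density_def scaleR_conv_of_real)
  qed
  have int: "integrable lborel (\<lambda>y. std_normal_density y *\<^sub>R iexp (q * t * y))"
    by (rule Bochner_Integration.integrable_bound[OF integrable_normal_density[of 1 0]])
       (auto simp: std_normal_density_def)
  have char: "(LINT y|lborel. std_normal_density y *\<^sub>R iexp (q * t * y)) = of_real (exp (- ((q * t)^2) / 2))"
  proof -
    have "char std_normal_distribution (q * t) = (LINT y|lborel. std_normal_density y *\<^sub>R iexp (q * t * y))"
      unfolding char_def by (subst integral_density) (auto simp: std_normal_density_def)
    then show ?thesis by (simp add: char_std_normal_distribution)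
  qed
  let ?f = "\<lambda>x. exp (b * of_real x - of_real (s * x^2))"
  have "integrable lborel (\<lambda>y. ?f (p / (2 * s) + t * y))"
    unfolding eq using int by (rule integrable_mult_right)
  moreover have "t \<noteq> 0" using t by simp
  ultimately show "integrable lborel ?f"
    using lborel_integrable_real_affine_iff[of t ?f "p / (2 * s)"] by blast
  have "(LINT x|lborel. ?f x) = \<bar>t\<bar> *\<^sub>R (LINT y|lborel. ?f (p / (2 * s) + t * y))"
    using t by (intro lborel_integral_real_affine) simp
  also have "\<dots> = of_real t * (K * of_real (exp (- ((q * t)^2) / 2)))"
    unfolding eq integral_mult_right_zero char using t by (simp add: scaleR_conv_of_real)
  also have "\<dots> = of_real (sqrt (pi / s)) * exp (b^2 / of_real (4 * s))"
  proof -
    have 1: "t * sqrt (2 * pi) = sqrt (pi / s)"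
      by (simp add: t_def real_sqrt_divide real_sqrt_mult)
    have tt: "t^2 = 1 / (2 * s)" using t(2) s by (simp add: field_simps)
    have 2: "of_real (p^2 / (4 * s)) + \<i> * of_real (q * p / (2 * s)) + of_real (- ((q * t)^2) / 2) = b^2 / of_real (4 * s)"
      using s by (simp add: b power_mult_distrib tt power2_sum power2_diff field_simps)
    have "of_real t * (K * of_real (exp (- ((q * t)^2) / 2))) =
        of_real (t * sqrt (2 * pi)) * exp (of_real (p^2 / (4 * s)) + \<i> * of_real (q * p / (2 * s)) + of_real (- ((q * t)^2) / 2))"
      unfolding K_def exp_add exp_of_real by (simp add: mult_ac)
    then show ?thesis unfolding 1 2 .
  qed
  finally show "(LINT x|lborel. ?f x) = of_real (sqrt (pi / s)) * exp (b^2 / of_real (4 * s))" .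
qed

section \<open>Square integrable functions on the line and the Bargmann transform\<close>

definition L2_line :: "(real \<Rightarrow> complex) \<Rightarrow> bool" where
  "L2_line p \<longleftrightarrow> p \<in> borel_measurable borel \<and> integrable lborel (\<lambda>x. (norm (p x))^2)"

lemma L2_lineD [measurable_dest]: "L2_line p \<Longrightarrow> p \<in> borel_measurable borel"
  by (simp add: L2_line_def)

lemma L2_line_pairing:
  assumes p: "L2_line p" and q: "L2_line q"
  shows integrable_L2_line: "integrable lborel (\<lambda>x. p x * cnj (q x))"
    and L2_line_cauchy_schwarz: "norm (LINT x|lborel. p x * cnj (q x)) \<le>
      sqrt (LINT x|lborel. (norm (p x))^2) * sqrt (LINT x|lborel. (norm (q x))^2)"
proof -
  have m: "p \<in> borel_measurable lborel" "(\<lambda>x. cnj (q x)) \<in> borel_measurable lborel"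
    using p q by measurable
  have i: "integrable lborel (\<lambda>x. (norm (p x))^2)" "integrable lborel (\<lambda>x. (norm (cnj (q x)))^2)"
    using p q by (auto simp: L2_line_def)
  show "integrable lborel (\<lambda>x. p x * cnj (q x))"
    by (rule integrable_mult_L2[OF m i])
  show "norm (LINT x|lborel. p x * cnj (q x)) \<le>
      sqrt (LINT x|lborel. (norm (p x))^2) * sqrt (LINT x|lborel. (norm (q x))^2)"
    using cauchy_schwarz_integral(2)[OF m i] by simp
qed

lemma L2_line_add:
  assumes p: "L2_line p" and q: "L2_line q"
  shows "L2_line (\<lambda>x. p x + q x)"
proof -
  have [measurable]: "p \<in> borel_measurable borel" "q \<in> borel_measurable borel"
    using p q by measurable
  have "integrable lborel (\<lambda>x. (norm (p x + q x))^2)"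
  proof (rule Bochner_Integration.integrable_bound)
    show "integrable lborel (\<lambda>x. 2 * (norm (p x))^2 + 2 * (norm (q x))^2)"
      using p q by (auto simp: L2_line_def)
    have "(norm (a + b))^2 \<le> 2 * (norm a)^2 + 2 * (norm b)^2" for a b :: complex
    proof -
      have "(norm (a + b))^2 \<le> (norm a + norm b)^2"
        by (intro power_mono norm_triangle_ineq) auto
      also have "\<dots> \<le> 2 * (norm a)^2 + 2 * (norm b)^2"
        using zero_le_power2[of "norm a - norm b"] by (simp add: power2_eq_square algebra_simps)
      finally show ?thesis .
    qed
    then show "AE x in lborel. norm ((norm (p x + q x))^2) \<le> norm (2 * (norm (p x))^2 + 2 * (norm (q x))^2)"
      by simp
  qed simp
  then show ?thesis by (simp add: L2_line_def)
qed

lemma L2_line_mult: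
  assumes m: "ess_bounded m C" and p: "L2_line p"
  shows "L2_line (\<lambda>x. m x * p x)"
    and "sqrt (LINT x|lborel. (norm (m x * p x))^2) \<le> C * sqrt (LINT x|lborel. (norm (p x))^2)"
proof -
  have [measurable]: "m \<in> borel_measurable borel" "p \<in> borel_measurable borel"
    and ip: "integrable lborel (\<lambda>z. (norm (p z))^2)" and C: "C \<ge> 0"
    using m p by (auto simp: ess_bounded_def L2_line_def)
  have "AE x in lborel. norm (m x) \<le> C" using m by (simp add: ess_bounded_def)
  then have ae: "AE x in lborel. (norm (m x * p x))^2 \<le> C^2 * (norm (p x))^2"
    by eventually_elim (auto simp: norm_mult power_mult_distrib intro!: mult_right_mono power_mono)
  have int: "integrable lborel (\<lambda>x. (norm (m x * p x))^2)"
    by (rule Bochner_Integration.integrable_bound[OF integrable_mult_right[OF ip, of "C^2"]])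
       (use ae in auto)
  then show "L2_line (\<lambda>x. m x * p x)"
    by (simp add: L2_line_def)
  have "(LINT x|lborel. (norm (m x * p x))^2) \<le> (LINT x|lborel. C^2 * (norm (p x))^2)"
    by (rule integral_mono_AE[OF int _ ae]) (simp add: ip)
  then have "sqrt (LINT x|lborel. (norm (m x * p x))^2) \<le> sqrt (C^2 * (LINT x|lborel. (norm (p x))^2))"
    by (intro real_sqrt_le_mono) simp
  then show "sqrt (LINT x|lborel. (norm (m x * p x))^2) \<le> C * sqrt (LINT x|lborel. (norm (p x))^2)"
    using C by (simp add: real_sqrt_mult)
qed

lemma ess_bounded_const: "ess_bounded (\<lambda>_. c) (norm c)"
  by (simp add: ess_bounded_def)

lemma ess_bounded_cnj: "ess_bounded m C \<Longrightarrow> ess_bounded (\<lambda>x. cnj (m x)) C"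
  by (simp add: ess_bounded_def borel_measurable_cnj)

text \<open>The Bargmann transform of \<open>\<psi>\<close> has the value \<open>LINT x|lborel. \<psi> x * cnj (bargmann_kernel z x)\<close>
  at \<open>z\<close>; it sends \<open>bargmann_kernel u\<close> to \<open>fock_kernel u\<close>.\<close>

definition bargmann_kernel :: "complex \<Rightarrow> real \<Rightarrow> complex" where
  "bargmann_kernel u x = of_real (sqrt (sqrt (2 / pi))) *
     exp (- 2 * \<i> * cnj u * of_real x - of_real (x^2) + (cnj u)^2 / 2)"

lemma bargmann_kernel_mult_cnj:
  "bargmann_kernel u x * cnj (bargmann_kernel v x) =
    of_real (sqrt (2 / pi)) * exp ((v^2 + (cnj u)^2) / 2) * exp (2 * \<i> * (v - cnj u) * of_real x - of_real (2 * x^2))"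
proof -
  have c: "complex_of_real (sqrt (sqrt (2 / pi))) * complex_of_real (sqrt (sqrt (2 / pi))) = of_real (sqrt (2 / pi))"
    unfolding of_real_mult[symmetric] by (subst real_sqrt_mult_self) simp
  have "bargmann_kernel u x * cnj (bargmann_kernel v x) = of_real (sqrt (2 / pi)) *
      exp ((- 2 * \<i> * cnj u * of_real x - of_real (x^2) + (cnj u)^2 / 2) +
        cnj (- 2 * \<i> * cnj v * of_real x - of_real (x^2) + (cnj v)^2 / 2))"
    unfolding bargmann_kernel_def c[symmetric] exp_add exp_cnj[symmetric] by (simp add: mult_ac)
  also have "(- 2 * \<i> * cnj u * of_real x - of_real (x^2) + (cnj u)^2 / 2) +
        cnj (- 2 * \<i> * cnj v * of_real x - of_real (x^2) + (cnj v)^2 / 2) =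
      (v^2 + (cnj u)^2) / 2 + (2 * \<i> * (v - cnj u) * of_real x - of_real (2 * x^2))"
    by (simp add: field_simps)
  finally show ?thesis by (simp add: exp_add mult.assoc)
qed

lemma borel_measurable_bargmann_kernel [measurable]: "bargmann_kernel u \<in> borel_measurable borel"
  unfolding bargmann_kernel_def by (intro borel_measurable_continuous_onI continuous_intros)

lemma L2_line_bargmann_kernel: "L2_line (bargmann_kernel u)"
proof -
  have "complex_of_real ((norm (bargmann_kernel u x))^2) = bargmann_kernel u x * cnj (bargmann_kernel u x)" for x
    by (rule complex_norm_square)
  moreover have "integrable lborel (\<lambda>x. bargmann_kernel u x * cnj (bargmann_kernel u x))"
    unfolding bargmann_kernel_mult_cnj by (intro integrable_mult_right integrable_gaussian) simp
  ultimately have "integrable lborel (\<lambda>x. complex_of_real ((norm (bargmann_kernel u x))^2))"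
    by simp
  then show ?thesis
    unfolding L2_line_def complex_of_real_integrable_eq by simp
qed

text \<open>This identity fixes the constant (2 / pi)^(1/4) in \<open>bargmann_kernel\<close>: the
  functions on the line get the same Gram matrix as the reproducing kernels.\<close>

lemma bargmann_kernel_inner:
  "(LINT x|lborel. bargmann_kernel u x * cnj (bargmann_kernel v x)) = fock_fun (fock_kernel u) v"
proof -
  have "(LINT x|lborel. bargmann_kernel u x * cnj (bargmann_kernel v x)) =
    of_real (sqrt (2 / pi)) * exp ((v^2 + (cnj u)^2) / 2) * (of_real (sqrt (pi / 2)) * exp ((2 * \<i> * (v - cnj u))^2 / of_real (4 * 2)))"
    unfolding bargmann_kernel_mult_cnj by (subst integral_mult_right_zero, subst gaussian_integral(2)) simp_all
  also have "\<dots> = of_real (sqrt (2 / pi) * sqrt (pi / 2)) * exp ((v^2 + (cnj u)^2) / 2 + (2 * \<i> * (v - cnj u))^2 / of_real (4 * 2))"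
    by (simp add: exp_add mult_ac)
  also have "(v^2 + (cnj u)^2) / 2 + (2 * \<i> * (v - cnj u))^2 / of_real (4 * 2) = v * cnj u"
    by (simp add: power_mult_distrib power2_diff field_simps)
  also have "sqrt (2 / pi) * sqrt (pi / 2) = 1" by (simp add: real_sqrt_mult[symmetric])
  finally show ?thesis by simp
qed

text \<open>The element \<open>f\<close> is a linear combination of reproducing kernels, and \<open>p\<close> is the same combination of
  the functions \<open>bargmann_kernel\<close>; a relation saves the choice of coefficients.\<close>

inductive bargmann_rel :: "fock \<Rightarrow> (real \<Rightarrow> complex) \<Rightarrow> bool" where
  zero: "bargmann_rel 0 (\<lambda>_. 0)"
| step: "bargmann_rel f p \<Longrightarrow> bargmann_rel (f + cscale c (fock_kernel u)) (\<lambda>x. p x + c * bargmann_kernel u x)"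

lemma bargmann_rel_kernel: "bargmann_rel (fock_kernel u) (bargmann_kernel u)"
proof -
  have "cscale 1 (fock_kernel u) = fock_kernel u" by (rule fock_eqI) simp
  then show ?thesis using bargmann_rel.step[OF bargmann_rel.zero, of 1 u] by simp
qed

lemma bargmann_rel_add:
  assumes "bargmann_rel f p" "bargmann_rel g q"
  shows "bargmann_rel (f + g) (\<lambda>x. p x + q x)"
  using assms(2,1)
  by (induction rule: bargmann_rel.induct) (auto simp: add.assoc[symmetric] intro: bargmann_rel.step)

lemma cscale_add: "cscale c (f + g) = cscale c f + cscale c g"
  by (rule fock_eqI) (simp add: distrib_left)

lemma cscale_cscale: "cscale c (cscale d f) = cscale (c * d) f"
  by (rule fock_eqI) simp

lemma bargmann_rel_cscale:
  assumes "bargmann_rel f p"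
  shows "bargmann_rel (cscale c f) (\<lambda>x. c * p x)"
  using assms
proof (induction rule: bargmann_rel.induct)
  case zero
  have "cscale c 0 = 0" by (rule fock_eqI) simp
  then show ?case by (simp add: bargmann_rel.zero)
next
  case (step f p d u)
  then show ?case
    using bargmann_rel.step[OF step.IH, of "c * d" u]
    by (simp add: cscale_add cscale_cscale distrib_left mult.assoc)
qed

lemma L2_line_cmult: "L2_line p \<Longrightarrow> L2_line (\<lambda>x. c * p x)"
  by (rule L2_line_mult[OF ess_bounded_const])

lemma L2_line_bargmann_rel: "bargmann_rel f p \<Longrightarrow> L2_line p"
  by (induction rule: bargmann_rel.induct)
     (auto intro!: L2_line_add L2_line_cmult L2_line_bargmann_kernel simp: L2_line_def[of "\<lambda>_. 0"])

text \<open>The Gram identity \<open>bargmann_kernel_inner\<close>, extended to linear combinations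
  in one argument and then in the other. In particular f determines p up to a null set.\<close>

lemma bargmann_rel_inner:
  assumes f: "bargmann_rel f p" and g: "bargmann_rel g q"
  shows "(LINT x|lborel. p x * cnj (q x)) = cinner f g"
proof -
  have kernel: "(LINT x|lborel. p x * cnj (bargmann_kernel v x)) = fock_fun f v" for v
    using f
  proof (induction rule: bargmann_rel.induct)
    case (step f p c u)
    have "(LINT x|lborel. (p x + c * bargmann_kernel u x) * cnj (bargmann_kernel v x)) =
        (LINT x|lborel. p x * cnj (bargmann_kernel v x) + c * (bargmann_kernel u x * cnj (bargmann_kernel v x)))"
      by (simp add: algebra_simps)
    also have "\<dots> = (LINT x|lborel. p x * cnj (bargmann_kernel v x)) + c * (LINT x|lborel. bargmann_kernel u x * cnj (bargmann_kernel v x))"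
      using L2_line_bargmann_rel[OF step.hyps] L2_line_bargmann_kernel
      by (simp add: integrable_L2_line)
    finally show ?case using step.IH by (simp add: bargmann_kernel_inner)
  qed simp
  show ?thesis
    using g
  proof (induction rule: bargmann_rel.induct)
    case (step g q c u)
    have "(LINT x|lborel. p x * cnj (q x + c * bargmann_kernel u x)) =
        (LINT x|lborel. p x * cnj (q x) + cnj c * (p x * cnj (bargmann_kernel u x)))"
      by (simp add: algebra_simps)
    also have "\<dots> = (LINT x|lborel. p x * cnj (q x)) + cnj c * (LINT x|lborel. p x * cnj (bargmann_kernel u x))"
      using L2_line_bargmann_rel[OF step.hyps] L2_line_bargmann_rel[OF f] L2_line_bargmann_kernel
      by (simp add: integrable_L2_line)
    finally show ?case using step.IH by (simp add: kernel cinner_simps cinner_fock_kernel)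
  qed (simp add: cinner_simps)
qed

lemma bargmann_rel_norm:
  assumes "bargmann_rel f p"
  shows "sqrt (LINT x|lborel. (norm (p x))^2) = norm f"
proof -
  have "complex_of_real (LINT x|lborel. (norm (p x))^2) = (LINT x|lborel. p x * cnj (p x))"
    unfolding integral_complex_of_real[symmetric] by (simp only: complex_norm_square)
  also have "\<dots> = complex_of_real ((norm f)^2)"
    using bargmann_rel_inner[OF assms assms] by (simp add: cinner_norm)
  finally show ?thesis unfolding of_real_eq_iff by simp
qed

text \<open>Cauchy-Schwarz and the isometry \<open>bargmann_rel_norm\<close> bound the functional
  taking f to the integral of p times the conjugate of \<psi>. That several p may belong to one f is
  harmless in the graph form of the Riesz theorem.\<close>

lemma ex_bargmann:
  assumes \<psi>: "L2_line \<psi>"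
  shows "\<exists>g. norm g \<le> sqrt (LINT x|lborel. (norm (\<psi> x))^2) \<and>
    (\<forall>f p. bargmann_rel f p \<longrightarrow> cinner f g = (LINT x|lborel. p x * cnj (\<psi> x)))"
proof -
  define G where "G = {(f, LINT x|lborel. p x * cnj (\<psi> x)) | f p. bargmann_rel f p}"
  have GI: "(f, LINT x|lborel. p x * cnj (\<psi> x)) \<in> G" if "bargmann_rel f p" for f p
    unfolding G_def mem_Collect_eq using that by (intro exI conjI) (rule refl)
  have int: "integrable lborel (\<lambda>x. p x * cnj (\<psi> x))" if "bargmann_rel f p" for f p
    by (intro integrable_L2_line L2_line_bargmann_rel[OF that] \<psi>)
  have "\<exists>g. norm g \<le> sqrt (LINT x|lborel. (norm (\<psi> x))^2) \<and> (\<forall>(d, r)\<in>G. cinner d g = r)"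
  proof (rule fock_riesz_graph)
    show "(0, 0) \<in> G"
      using GI[OF bargmann_rel.zero] by simp
    show "(d + e, r + s) \<in> G" if dr: "(d, r) \<in> G" and es: "(e, s) \<in> G" for d r e s
    proof -
      obtain p where p: "bargmann_rel d p" "r = (LINT x|lborel. p x * cnj (\<psi> x))"
        using dr by (auto simp: G_def)
      obtain q where q: "bargmann_rel e q" "s = (LINT x|lborel. q x * cnj (\<psi> x))"
        using es by (auto simp: G_def)
      have "r + s = (LINT x|lborel. (p x + q x) * cnj (\<psi> x))"
        unfolding p(2) q(2) distrib_right by (intro Bochner_Integration.integral_add[symmetric] int[OF p(1)] int[OF q(1)])
      then show ?thesis
        using GI[OF bargmann_rel_add[OF p(1) q(1)]] by (simp only:)
    qed
    show "(cscale c d, c * r) \<in> G" if dr: "(d, r) \<in> G" for c d r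
    proof -
      obtain p where p: "bargmann_rel d p" "r = (LINT x|lborel. p x * cnj (\<psi> x))"
        using dr by (auto simp: G_def)
      have "c * r = (LINT x|lborel. (c * p x) * cnj (\<psi> x))"
        unfolding p(2) mult.assoc by simp
      then show ?thesis
        using GI[OF bargmann_rel_cscale[OF p(1)], of c] by (simp only:)
    qed
    show "norm r \<le> sqrt (LINT x|lborel. (norm (\<psi> x))^2) * norm d" if dr: "(d, r) \<in> G" for d r
    proof -
      obtain p where p: "bargmann_rel d p" "r = (LINT x|lborel. p x * cnj (\<psi> x))"
        using dr by (auto simp: G_def)
      show ?thesis
        using L2_line_cauchy_schwarz[OF L2_line_bargmann_rel[OF p(1)] \<psi>]
        unfolding bargmann_rel_norm[OF p(1)] p(2) by (simp add: mult.commute)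
    qed
  qed simp
  then obtain g where g: "norm g \<le> sqrt (LINT x|lborel. (norm (\<psi> x))^2)" "\<forall>(d, r)\<in>G. cinner d g = r"
    by blast
  show ?thesis
  proof (intro exI[of _ g] conjI allI impI)
    show "cinner f g = (LINT x|lborel. p x * cnj (\<psi> x))" if "bargmann_rel f p" for f p
      using bspec[OF g(2) GI[OF that]] by simp
  qed (rule g(1))
qed

text \<open>For square integrable \<psi> the choice is unique, since pairings with the kernels
  determine an element of the Fock space. Defined through these pairings, it is the adjoint of the
  isometry from the span of the kernels into L^2.\<close>

definition bargmann :: "(real \<Rightarrow> complex) \<Rightarrow> fock" where
  "bargmann \<psi> = (SOME g. norm g \<le> sqrt (LINT x|lborel. (norm (\<psi> x))^2) \<and>
    (\<forall>f p. bargmann_rel f p \<longrightarrow> cinner f g = (LINT x|lborel. p x * cnj (\<psi> x))))"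

lemma bargmann:
  assumes "L2_line \<psi>"
  shows norm_bargmann: "norm (bargmann \<psi>) \<le> sqrt (LINT x|lborel. (norm (\<psi> x))^2)"
    and cinner_bargmann: "bargmann_rel f p \<Longrightarrow> cinner f (bargmann \<psi>) = (LINT x|lborel. p x * cnj (\<psi> x))"
  using someI_ex[OF ex_bargmann[OF assms]] unfolding bargmann_def[symmetric] by blast+

lemma bargmann_add:
  assumes "L2_line \<psi>" "L2_line \<eta>"
  shows "bargmann (\<lambda>x. \<psi> x + \<eta> x) = bargmann \<psi> + bargmann \<eta>"
  using assms L2_line_add[OF assms]
  by (intro fock_eqI_kernel)
     (simp add: cinner_simps cinner_bargmann[OF _ bargmann_rel_kernel] distrib_left integrable_L2_line L2_line_bargmann_kernel)

lemma bargmann_cmult: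
  assumes "L2_line \<psi>"
  shows "bargmann (\<lambda>x. c * \<psi> x) = cscale c (bargmann \<psi>)"
proof (rule fock_eqI_kernel)
  fix u
  have "cinner (fock_kernel u) (bargmann (\<lambda>x. c * \<psi> x)) = (LINT x|lborel. cnj c * (bargmann_kernel u x * cnj (\<psi> x)))"
    by (subst cinner_bargmann[OF L2_line_cmult[OF assms] bargmann_rel_kernel]) (simp add: mult_ac)
  also have "\<dots> = cinner (fock_kernel u) (cscale c (bargmann \<psi>))"
    by (simp add: cinner_simps cinner_bargmann[OF assms bargmann_rel_kernel])
  finally show "cinner (fock_kernel u) (bargmann (\<lambda>x. c * \<psi> x)) = cinner (fock_kernel u) (cscale c (bargmann \<psi>))" .
qed

text \<open>The operator is the adjoint of the map taking f to
  \<open>bargmann (\<lambda>x. cnj (m x) * p x)\<close>. That map is available only on the span of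
  the kernels, where f has a companion p; the Riesz theorem, applied for each g, yields an operator
  on the whole space.\<close>

lemma ex_mult_op:
  assumes m: "ess_bounded m C"
  obtains A :: "fock \<Rightarrow>\<^sub>L fock" where "A \<in> bounded_clinear_ops" "norm A \<le> C"
    "\<And>f p g. bargmann_rel f p \<Longrightarrow> cinner f (blinfun_apply A g) = cinner (bargmann (\<lambda>x. cnj (m x) * p x)) g"
proof -
  have C: "C \<ge> 0" using m by (simp add: ess_bounded_def)
  have mp: "L2_line (\<lambda>x. cnj (m x) * p x)" if "bargmann_rel f p" for f p
    by (rule L2_line_mult[OF ess_bounded_cnj[OF m] L2_line_bargmann_rel[OF that]])
  have nB: "norm (bargmann (\<lambda>x. cnj (m x) * p x)) \<le> C * norm f" if "bargmann_rel f p" for f p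
    using norm_bargmann[OF mp[OF that]] L2_line_mult(2)[OF ess_bounded_cnj[OF m] L2_line_bargmann_rel[OF that]]
    unfolding bargmann_rel_norm[OF that] by linarith
  have ex: "\<exists>h. norm h \<le> C * norm g \<and> (\<forall>f p. bargmann_rel f p \<longrightarrow> cinner f h = cinner (bargmann (\<lambda>x. cnj (m x) * p x)) g)" for g
  proof -
    define G where "G = {(f, cinner (bargmann (\<lambda>x. cnj (m x) * p x)) g) | f p. bargmann_rel f p}"
    have GI: "(f, cinner (bargmann (\<lambda>x. cnj (m x) * p x)) g) \<in> G" if "bargmann_rel f p" for f p
      unfolding G_def mem_Collect_eq using that by (intro exI conjI) (rule refl)
    have "\<exists>h. norm h \<le> C * norm g \<and> (\<forall>(d, r)\<in>G. cinner d h = r)"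
    proof (rule fock_riesz_graph)
      have "bargmann (\<lambda>_. 0) = 0"
        using nB[OF bargmann_rel.zero] by simp
      then show "(0, 0) \<in> G"
        using GI[OF bargmann_rel.zero] by (simp add: cinner_simps)
      show "(d + e, r + s) \<in> G" if dr: "(d, r) \<in> G" and es: "(e, s) \<in> G" for d r e s
      proof -
        obtain p where p: "bargmann_rel d p" "r = cinner (bargmann (\<lambda>x. cnj (m x) * p x)) g"
          using dr by (auto simp: G_def)
        obtain q where q: "bargmann_rel e q" "s = cinner (bargmann (\<lambda>x. cnj (m x) * q x)) g"
          using es by (auto simp: G_def)
        have "r + s = cinner (bargmann (\<lambda>x. cnj (m x) * (p x + q x))) g"
          unfolding p(2) q(2) distrib_left bargmann_add[OF mp[OF p(1)] mp[OF q(1)]] cinner_simps ..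
        then show ?thesis
          using GI[OF bargmann_rel_add[OF p(1) q(1)]] by (simp only:)
      qed
      show "(cscale c d, c * r) \<in> G" if dr: "(d, r) \<in> G" for c d r
      proof -
        obtain p where p: "bargmann_rel d p" "r = cinner (bargmann (\<lambda>x. cnj (m x) * p x)) g"
          using dr by (auto simp: G_def)
        have "c * r = cinner (bargmann (\<lambda>x. cnj (m x) * (c * p x))) g"
          unfolding p(2) mult.left_commute[of _ c] bargmann_cmult[OF mp[OF p(1)]] cinner_simps ..
        then show ?thesis
          using GI[OF bargmann_rel_cscale[OF p(1)], of c] by (simp only:)
      qed
      show "norm r \<le> C * norm g * norm d" if dr: "(d, r) \<in> G" for d r
      proof -
        obtain p where p: "bargmann_rel d p" "r = cinner (bargmann (\<lambda>x. cnj (m x) * p x)) g"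
          using dr by (auto simp: G_def)
        have "norm r \<le> norm (bargmann (\<lambda>x. cnj (m x) * p x)) * norm g"
          unfolding p(2) by (rule cinner_cauchy_schwarz)
        also have "\<dots> \<le> (C * norm d) * norm g"
          by (intro mult_right_mono nB[OF p(1)]) simp
        finally show ?thesis by (simp add: mult_ac)
      qed
    qed (simp add: C)
    then obtain h where h: "norm h \<le> C * norm g" "\<forall>(d, r)\<in>G. cinner d h = r" by blast
    show ?thesis
    proof (intro exI[of _ h] conjI allI impI)
      show "cinner f h = cinner (bargmann (\<lambda>x. cnj (m x) * p x)) g" if "bargmann_rel f p" for f p
        using bspec[OF h(2) GI[OF that]] by simp
    qed (rule h(1))
  qed
  define L where "L u g = cinner (bargmann (\<lambda>x. cnj (m x) * bargmann_kernel u x)) g" for u g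
  have ex': "\<exists>h. norm h \<le> C * norm g \<and> (\<forall>u. cinner (fock_kernel u) h = L u g)" for g
    using ex[of g] bargmann_rel_kernel unfolding L_def by blast
  obtain A :: "fock \<Rightarrow>\<^sub>L fock" where A: "A \<in> bounded_clinear_ops" "\<And>g. norm (blinfun_apply A g) \<le> C * norm g"
      "\<And>u g. cinner (fock_kernel u) (blinfun_apply A g) = L u g"
    by (rule operator_of_form[of fock_kernel C L, OF fock_eqI_kernel ex']) (auto simp: L_def cinner_simps)
  show ?thesis
  proof (rule that[OF A(1)])
    show "norm A \<le> C" using C A(2) by (rule norm_blinfun_bound)
    fix f p g assume rel: "bargmann_rel f p"
    \<comment> \<open>\<open>operator_of_form\<close> was used with the kernels alone; comparison
      with the Riesz vector of the same g carries the formula to the whole span.\<close>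
    obtain h where h: "\<And>f p. bargmann_rel f p \<Longrightarrow> cinner f h = cinner (bargmann (\<lambda>x. cnj (m x) * p x)) g"
      using ex[of g] by blast
    have "blinfun_apply A g = h"
      by (rule fock_eqI_kernel) (simp add: A(3) L_def h[OF bargmann_rel_kernel])
    then show "cinner f (blinfun_apply A g) = cinner (bargmann (\<lambda>x. cnj (m x) * p x)) g"
      using h[OF rel] by simp
  qed
qed

text \<open>The operator on the Fock space to which the Bargmann transform takes multiplication by \<open>m\<close>,
  described by its matrix with respect to the reproducing kernels.\<close>

definition mult_op :: "(real \<Rightarrow> complex) \<Rightarrow> (fock \<Rightarrow>\<^sub>L fock)" where
  "mult_op m = (SOME A. A \<in> bounded_clinear_ops \<and> (\<forall>u v. fock_fun (blinfun_apply A (fock_kernel u)) v =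
     (LINT x|lborel. m x * bargmann_kernel u x * cnj (bargmann_kernel v x))))"

text \<open>The kernel matrix determines an operator. This is how sums, compositions with Weyl
  operators and Toeplitz operators are recognised as multiplication operators.\<close>

lemma mult_op_eqI:
  assumes "A \<in> bounded_clinear_ops"
    and "\<And>u v. fock_fun (blinfun_apply A (fock_kernel u)) v =
     (LINT x|lborel. m x * bargmann_kernel u x * cnj (bargmann_kernel v x))"
  shows "mult_op m = A"
proof -
  have "mult_op m \<in> bounded_clinear_ops \<and> (\<forall>u v. fock_fun (blinfun_apply (mult_op m) (fock_kernel u)) v =
     (LINT x|lborel. m x * bargmann_kernel u x * cnj (bargmann_kernel v x)))"
    unfolding mult_op_def by (rule someI[of _ A]) (use assms in auto)
  then show ?thesis
    using assms by (intro bounded_clinear_ops_eqI fock_eqI) auto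
qed

lemma mult_op:
  assumes m: "ess_bounded m C"
  shows mult_op_in_ops: "mult_op m \<in> bounded_clinear_ops"
    and norm_mult_op: "norm (mult_op m) \<le> C"
    and cinner_mult_op: "bargmann_rel f p \<Longrightarrow>
      cinner f (blinfun_apply (mult_op m) g) = cinner (bargmann (\<lambda>x. cnj (m x) * p x)) g"
    and cinner_mult_op': "bargmann_rel f p \<Longrightarrow> bargmann_rel g q \<Longrightarrow>
      cinner (blinfun_apply (mult_op m) g) f = (LINT x|lborel. m x * q x * cnj (p x))"
    and mult_op_kernel: "fock_fun (blinfun_apply (mult_op m) (fock_kernel u)) v =
      (LINT x|lborel. m x * bargmann_kernel u x * cnj (bargmann_kernel v x))"
proof -
  obtain A :: "fock \<Rightarrow>\<^sub>L fock" where A: "A \<in> bounded_clinear_ops" "norm A \<le> C"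
    "\<And>f p g. bargmann_rel f p \<Longrightarrow> cinner f (blinfun_apply A g) = cinner (bargmann (\<lambda>x. cnj (m x) * p x)) g"
    using ex_mult_op[OF m] by blast
  have mp: "L2_line (\<lambda>x. cnj (m x) * p x)" if "bargmann_rel f p" for f p
    by (rule L2_line_mult[OF ess_bounded_cnj[OF m] L2_line_bargmann_rel[OF that]])
  have A': "cinner (blinfun_apply A g) f = (LINT x|lborel. m x * q x * cnj (p x))"
    if p: "bargmann_rel f p" and q: "bargmann_rel g q" for f p g q
  proof -
    have "cinner (blinfun_apply A g) f = cinner g (bargmann (\<lambda>x. cnj (m x) * p x))"
      by (subst (1 2) cinner_commute) (simp add: A(3)[OF p])
    also have "\<dots> = (LINT x|lborel. q x * cnj (cnj (m x) * p x))"
      by (rule cinner_bargmann[OF mp[OF p] q])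
    finally show ?thesis by (simp add: mult_ac)
  qed
  have eq: "mult_op m = A"
    by (rule mult_op_eqI[OF A(1)])
       (simp only: cinner_fock_kernel[symmetric] A'[OF bargmann_rel_kernel bargmann_rel_kernel])
  show "mult_op m \<in> bounded_clinear_ops" "norm (mult_op m) \<le> C"
    using A eq by auto
  show "cinner f (blinfun_apply (mult_op m) g) = cinner (bargmann (\<lambda>x. cnj (m x) * p x)) g" if "bargmann_rel f p"
    using A(3)[OF that] eq by simp
  show "cinner (blinfun_apply (mult_op m) g) f = (LINT x|lborel. m x * q x * cnj (p x))"
    if "bargmann_rel f p" "bargmann_rel g q" using A'[OF that] eq by simp
  show "fock_fun (blinfun_apply (mult_op m) (fock_kernel u)) v =
      (LINT x|lborel. m x * bargmann_kernel u x * cnj (bargmann_kernel v x))"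
    unfolding eq by (simp only: cinner_fock_kernel[symmetric] A'[OF bargmann_rel_kernel bargmann_rel_kernel])
qed

lemma integrable_mult_bargmann_kernel:
  assumes m: "ess_bounded m C"
  shows "integrable lborel (\<lambda>x. m x * bargmann_kernel u x * cnj (bargmann_kernel v x))"
  by (rule integrable_L2_line[OF L2_line_mult(1)[OF m L2_line_bargmann_kernel] L2_line_bargmann_kernel])

lemma mult_op_cong_AE:
  assumes "ess_bounded m C" "ess_bounded m' C'" "AE x in lborel. m x = m' x"
  shows "mult_op m = mult_op m'"
proof (rule mult_op_eqI)
  have [measurable]: "m \<in> borel_measurable borel" "m' \<in> borel_measurable borel"
    using assms by (auto simp: ess_bounded_def)
  fix u v
  show "fock_fun (blinfun_apply (mult_op m') (fock_kernel u)) v =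
     (LINT x|lborel. m x * bargmann_kernel u x * cnj (bargmann_kernel v x))"
    unfolding mult_op_kernel[OF assms(2)] using assms(3) by (intro integral_cong_AE) auto
qed (rule mult_op_in_ops[OF assms(2)])

lemma ess_bounded_add:
  assumes "ess_bounded m C" "ess_bounded m' C'"
  shows "ess_bounded (\<lambda>x. m x + m' x) (C + C')"
proof -
  have "AE x in lborel. norm (m x) \<le> C" "AE x in lborel. norm (m' x) \<le> C'"
    using assms by (auto simp: ess_bounded_def)
  then have "AE x in lborel. norm (m x + m' x) \<le> C + C'"
    by eventually_elim (intro norm_triangle_le add_mono)
  then show ?thesis using assms by (auto simp: ess_bounded_def)
qed

lemma ess_bounded_mult:
  assumes "ess_bounded m C" "ess_bounded m' C'"
  shows "ess_bounded (\<lambda>x. m x * m' x) (C * C')"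
proof -
  have "AE x in lborel. norm (m x) \<le> C" "AE x in lborel. norm (m' x) \<le> C'"
    using assms by (auto simp: ess_bounded_def)
  then have "AE x in lborel. norm (m x * m' x) \<le> C * C'"
    by eventually_elim (auto simp: norm_mult intro: mult_mono order_trans[OF norm_ge_zero])
  then show ?thesis using assms by (auto simp: ess_bounded_def)
qed

lemma bounded_clinear_ops_add:
  "A \<in> bounded_clinear_ops \<Longrightarrow> B \<in> bounded_clinear_ops \<Longrightarrow> A + B \<in> bounded_clinear_ops"
  by (simp add: bounded_clinear_ops_iff blinfun.add_left cscale_add)

lemma bounded_clinear_ops_cscale_op:
  "A \<in> bounded_clinear_ops \<Longrightarrow> cscale_op c A \<in> bounded_clinear_ops"
  by (simp add: bounded_clinear_ops_iff cscale_op.rep_eq cscale_cscale mult.commute)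

lemma bounded_clinear_ops_compose:
  "A \<in> bounded_clinear_ops \<Longrightarrow> B \<in> bounded_clinear_ops \<Longrightarrow> A o\<^sub>L B \<in> bounded_clinear_ops"
  by (simp add: bounded_clinear_ops_iff)

lemma mult_op_add:
  assumes m: "ess_bounded m C" and m': "ess_bounded m' C'"
  shows "mult_op (\<lambda>x. m x + m' x) = mult_op m + mult_op m'"
  by (rule mult_op_eqI)
     (simp_all add: bounded_clinear_ops_add mult_op_in_ops[OF m] mult_op_in_ops[OF m'] blinfun.add_left
       mult_op_kernel[OF m] mult_op_kernel[OF m'] distrib_right integrable_mult_bargmann_kernel[OF m]
       integrable_mult_bargmann_kernel[OF m'])

lemma mult_op_cmult:
  assumes m: "ess_bounded m C"
  shows "mult_op (\<lambda>x. c * m x) = cscale_op c (mult_op m)"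
  by (rule mult_op_eqI)
     (simp_all add: bounded_clinear_ops_cscale_op mult_op_in_ops[OF m] cscale_op.rep_eq
       mult_op_kernel[OF m] mult.assoc)

lemma mult_op_diff:
  assumes m: "ess_bounded m C" and m': "ess_bounded m' C'"
  shows "mult_op (\<lambda>x. m x - m' x) = mult_op m - mult_op m'"
proof -
  have "cscale_op (-1) (mult_op m') = - mult_op m'"
    by (intro blinfun_eqI fock_eqI) (simp add: cscale_op.rep_eq blinfun.minus_left)
  then show ?thesis
    using mult_op_add[OF m ess_bounded_mult[OF ess_bounded_const[of "-1"] m']]
      mult_op_cmult[OF m', of "-1"] by simp
qed

lemma cscale_op_eq: "blinfun_apply (cscale_op c A) f = cscale c (blinfun_apply A f)"
  by (simp add: cscale_op.rep_eq)

section \<open>Weyl operators on the line: modulations and shifts\<close>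

lemma weyl_kernel:
  "blinfun_apply (weyl a) (fock_kernel u) = cscale (exp (- of_real ((norm a)^2 / 2) - a * cnj u)) (fock_kernel (u + a))"
proof (rule fock_eqI)
  fix z
  have "z * cnj a - complex_of_real ((norm a)^2 / 2) + (z - a) * cnj u = (- of_real ((norm a)^2 / 2) - a * cnj u) + z * cnj (u + a)"
    by (simp add: algebra_simps)
  then show "fock_fun (blinfun_apply (weyl a) (fock_kernel u)) z =
      fock_fun (cscale (exp (- of_real ((norm a)^2 / 2) - a * cnj u)) (fock_kernel (u + a))) z"
    by (simp only: fock_fun_weyl fock_fun_simps fock_kernel_apply exp_add[symmetric])
qed

text \<open>The prefactor is the scalar of \<open>weyl_kernel\<close>; so a real Weyl translation
  acts on the line as multiplication by exp (- 2 i a x).\<close>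

lemma bargmann_kernel_add_real:
  "exp (- of_real ((norm (complex_of_real a))^2 / 2) - of_real a * cnj u) * bargmann_kernel (u + of_real a) x =
    exp (- 2 * \<i> * of_real a * of_real x) * bargmann_kernel u x"
proof -
  have "(- of_real ((norm (complex_of_real a))^2 / 2) - of_real a * cnj u) +
      (- 2 * \<i> * cnj (u + of_real a) * of_real x - of_real (x^2) + (cnj (u + of_real a))^2 / 2) =
    (- 2 * \<i> * of_real a * of_real x) + (- 2 * \<i> * cnj u * of_real x - of_real (x^2) + (cnj u)^2 / 2)"
    by (simp add: power2_eq_square field_simps)
  then have "exp (- of_real ((norm (complex_of_real a))^2 / 2) - of_real a * cnj u) *
      exp (- 2 * \<i> * cnj (u + of_real a) * of_real x - of_real (x^2) + (cnj (u + of_real a))^2 / 2) =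
    exp (- 2 * \<i> * of_real a * of_real x) * exp (- 2 * \<i> * cnj u * of_real x - of_real (x^2) + (cnj u)^2 / 2)"
    by (simp only: exp_add[symmetric])
  then show ?thesis
    unfolding bargmann_kernel_def mult.left_commute[of _ "complex_of_real (sqrt (sqrt (2 / pi)))"]
    by (simp only:)
qed

text \<open>With the scalar of \<open>weyl_kernel\<close> again in front, an imaginary Weyl
  translation acts on the line as a pure shift.\<close>

lemma bargmann_kernel_add_imaginary:
  "exp (- of_real ((norm (\<i> * complex_of_real s))^2 / 2) - (\<i> * of_real s) * cnj u) * bargmann_kernel (u + \<i> * of_real s) x =
    bargmann_kernel u (x + s)"
proof -
  have "(- of_real ((norm (\<i> * complex_of_real s))^2 / 2) - (\<i> * of_real s) * cnj u) +
      (- 2 * \<i> * cnj (u + \<i> * of_real s) * of_real x - of_real (x^2) + (cnj (u + \<i> * of_real s))^2 / 2) =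
    - 2 * \<i> * cnj u * of_real (x + s) - of_real ((x + s)^2) + (cnj u)^2 / 2"
    by (simp add: norm_mult power2_eq_square field_simps)
  then have "exp (- of_real ((norm (\<i> * complex_of_real s))^2 / 2) - (\<i> * of_real s) * cnj u) *
      exp (- 2 * \<i> * cnj (u + \<i> * of_real s) * of_real x - of_real (x^2) + (cnj (u + \<i> * of_real s))^2 / 2) =
    exp (- 2 * \<i> * cnj u * of_real (x + s) - of_real ((x + s)^2) + (cnj u)^2 / 2)"
    by (simp only: exp_add[symmetric])
  then show ?thesis
    unfolding bargmann_kernel_def mult.left_commute[of _ "complex_of_real (sqrt (sqrt (2 / pi)))"]
    by (simp only:)
qed

lemma blinfun_cscale:
  "A \<in> bounded_clinear_ops \<Longrightarrow> blinfun_apply A (cscale c f) = cscale c (blinfun_apply A f)"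
  by (simp add: bounded_clinear_ops_iff)

lemma bargmann_rel_weyl_real:
  assumes "bargmann_rel f p"
  shows "bargmann_rel (blinfun_apply (weyl (of_real a)) f) (\<lambda>x. exp (- 2 * \<i> * of_real a * of_real x) * p x)"
  using assms
proof (induction rule: bargmann_rel.induct)
  case zero
  then show ?case by (simp add: bargmann_rel.zero)
next
  case (step f p c u)
  have "bargmann_rel (blinfun_apply (weyl (of_real a)) f +
      cscale (c * exp (- of_real ((norm (complex_of_real a))^2 / 2) - of_real a * cnj u)) (fock_kernel (u + of_real a)))
    (\<lambda>x. exp (- 2 * \<i> * of_real a * of_real x) * p x +
      c * exp (- of_real ((norm (complex_of_real a))^2 / 2) - of_real a * cnj u) * bargmann_kernel (u + of_real a) x)"
    by (rule bargmann_rel.step[OF step.IH])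
  then show ?case
    unfolding mult.assoc[of c] bargmann_kernel_add_real
    by (simp add: blinfun.add_right blinfun_cscale[OF weyl_in_ops] weyl_kernel cscale_cscale distrib_left mult.left_commute[of c])
qed

lemma bargmann_rel_weyl_imaginary:
  assumes "bargmann_rel f p"
  shows "bargmann_rel (blinfun_apply (weyl (\<i> * of_real s)) f) (\<lambda>x. p (x + s))"
  using assms
proof (induction rule: bargmann_rel.induct)
  case zero
  then show ?case by (simp add: bargmann_rel.zero)
next
  case (step f p c u)
  have "bargmann_rel (blinfun_apply (weyl (\<i> * of_real s)) f +
      cscale (c * exp (- of_real ((norm (\<i> * complex_of_real s))^2 / 2) - (\<i> * of_real s) * cnj u)) (fock_kernel (u + \<i> * of_real s)))
    (\<lambda>x. p (x + s) +
      c * exp (- of_real ((norm (\<i> * complex_of_real s))^2 / 2) - (\<i> * of_real s) * cnj u) * bargmann_kernel (u + \<i> * of_real s) x)"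
    by (rule bargmann_rel.step[OF step.IH])
  then show ?case
    unfolding mult.assoc[of c] bargmann_kernel_add_imaginary
    by (simp add: blinfun.add_right blinfun_cscale[OF weyl_in_ops] weyl_kernel cscale_cscale)
qed

lemma mult_op_compose_weyl_real:
  assumes m: "ess_bounded m C"
  shows "mult_op m o\<^sub>L weyl (of_real a) = mult_op (\<lambda>x. exp (- 2 * \<i> * of_real a * of_real x) * m x)"
proof (rule mult_op_eqI[symmetric])
  show "mult_op m o\<^sub>L weyl (of_real a) \<in> bounded_clinear_ops"
    by (intro bounded_clinear_ops_compose mult_op_in_ops[OF m] weyl_in_ops)
  fix u v
  show "fock_fun (blinfun_apply (mult_op m o\<^sub>L weyl (of_real a)) (fock_kernel u)) v =
    (LINT x|lborel. exp (- 2 * \<i> * of_real a * of_real x) * m x * bargmann_kernel u x * cnj (bargmann_kernel v x))"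
    unfolding blinfun_apply_blinfun_compose cinner_fock_kernel[symmetric]
      cinner_mult_op'[OF m bargmann_rel_kernel bargmann_rel_weyl_real[OF bargmann_rel_kernel]]
    by (simp add: mult_ac)
qed

lemma span_fock_kernel: "fock_kernel u \<in> module.span cscale (range fock_kernel)"
proof -
  interpret vector_space cscale by (rule vector_space_cscale)
  show ?thesis by (rule span_base) simp
qed

text \<open>The form of \<phi> turns exp (z cnj w) \<phi>(z - cnj w) into the kernel matrix of
  \<open>mult_op m\<close>. As a function of w this is the conjugate of a Bargmann transform, so for
  each z the singular integral is an inner product with a fixed vector and equals
  \<open>mult_op m\<close> on the whole space. Uniqueness in \<open>singular_integral_def\<close>
  comes from the kernels.\<close>

lemma singular_integral_eq_mult_op:
  assumes m: "ess_bounded m C"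
    and \<phi>: "\<And>z. fock_fun \<phi> z = complex_of_real (sqrt (2 / pi)) *
           (LINT x|lborel. m x * exp (- 2 * (complex_of_real x - \<i> / 2 * z)^2))"
  shows "singular_integral \<phi> = mult_op m"
proof -
  have kernel: "exp (z * cnj w) * fock_fun \<phi> (z - cnj w) =
      (LINT x|lborel. m x * bargmann_kernel w x * cnj (bargmann_kernel z x))" for z w
  proof -
    have "m x * bargmann_kernel w x * cnj (bargmann_kernel z x) =
        exp (z * cnj w) * (of_real (sqrt (2 / pi)) * (m x * exp (- 2 * (complex_of_real x - \<i> / 2 * (z - cnj w))^2)))" for x
    proof -
      have sq: "(complex_of_real x - \<i> / 2 * \<zeta>)^2 = of_real (x^2) - \<i> * \<zeta> * of_real x - \<zeta>^2 / 4" for \<zeta>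
        by (simp add: power2_eq_square field_simps)
      have "(z^2 + (cnj w)^2) / 2 + (2 * \<i> * (z - cnj w) * of_real x - of_real (2 * x^2)) =
          z * cnj w + (- 2 * (complex_of_real x - \<i> / 2 * (z - cnj w))^2)"
        unfolding sq by (simp add: power2_diff field_simps)
      then have eq: "exp ((z^2 + (cnj w)^2) / 2) * exp (2 * \<i> * (z - cnj w) * of_real x - of_real (2 * x^2)) =
          exp (z * cnj w) * exp (- 2 * (complex_of_real x - \<i> / 2 * (z - cnj w))^2)"
        by (simp only: exp_add[symmetric])
      have "m x * bargmann_kernel w x * cnj (bargmann_kernel z x) =
          m x * (of_real (sqrt (2 / pi)) * (exp ((z^2 + (cnj w)^2) / 2) * exp (2 * \<i> * (z - cnj w) * of_real x - of_real (2 * x^2))))"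
        by (simp only: mult.assoc[of "m x"] bargmann_kernel_mult_cnj mult.assoc[of "complex_of_real (sqrt (2 / pi))"])
      also have "\<dots> = exp (z * cnj w) * (of_real (sqrt (2 / pi)) * (m x * exp (- 2 * (complex_of_real x - \<i> / 2 * (z - cnj w))^2)))"
        unfolding eq by (simp only: mult_ac)
      finally show ?thesis .
    qed
    then have eq: "m x * bargmann_kernel w x * cnj (bargmann_kernel z x) =
        exp (z * cnj w) * (of_real (sqrt (2 / pi)) * (m x * exp (- 2 * (complex_of_real x - \<i> / 2 * (z - cnj w))^2)))" for x .
    show ?thesis unfolding eq \<phi> by (simp only: integral_mult_right_zero)
  qed
  have formula: "fock_fun (blinfun_apply (mult_op m) f) z =
      (LINT w|fock_measure. fock_fun f w * exp (z * cnj w) * fock_fun \<phi> (z - cnj w))" for f z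
  proof -
    define g where "g = bargmann (\<lambda>x. cnj (m x) * bargmann_kernel z x)"
    have L2: "L2_line (\<lambda>x. cnj (m x) * bargmann_kernel z x)"
      by (rule L2_line_mult[OF ess_bounded_cnj[OF m] L2_line_bargmann_kernel])
    have "cnj (fock_fun g w) = exp (z * cnj w) * fock_fun \<phi> (z - cnj w)" for w
      unfolding kernel g_def cinner_fock_kernel_left[symmetric] cinner_bargmann[OF L2 bargmann_rel_kernel]
      by (simp add: mult_ac)
    moreover have "fock_fun (blinfun_apply (mult_op m) f) z = cinner f g"
      unfolding g_def cinner_fock_kernel[symmetric]
      by (subst (1 2) cinner_commute) (simp add: cinner_mult_op[OF m bargmann_rel_kernel])
    ultimately show ?thesis by (simp add: cinner_def mult.assoc)
  qed
  show ?thesis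
    unfolding singular_integral_def
  proof (rule the_equality)
    show "mult_op m \<in> bounded_clinear_ops \<and> (\<forall>f\<in>module.span cscale (range fock_kernel). \<forall>z.
        fock_fun (blinfun_apply (mult_op m) f) z =
        (LINT w|fock_measure. fock_fun f w * exp (z * cnj w) * fock_fun \<phi> (z - cnj w)))"
      using mult_op_in_ops[OF m] formula by blast
    fix A :: "fock \<Rightarrow>\<^sub>L fock"
    assume A: "A \<in> bounded_clinear_ops \<and> (\<forall>f\<in>module.span cscale (range fock_kernel). \<forall>z.
        fock_fun (blinfun_apply A f) z = (LINT w|fock_measure. fock_fun f w * exp (z * cnj w) * fock_fun \<phi> (z - cnj w)))"
    show "A = mult_op m"
    proof (rule bounded_clinear_ops_eqI[OF _ mult_op_in_ops[OF m]])
      show "A \<in> bounded_clinear_ops" using A by blast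
      show "blinfun_apply A (fock_kernel u) = blinfun_apply (mult_op m) (fock_kernel u)" for u
        using A span_fock_kernel[of u] formula[of "fock_kernel u"] by (intro fock_eqI) metis
    qed
  qed
qed

subsection \<open>Vertical symbols and Gaussian convolutions\<close>

text \<open>The positive and the negative part of h have equal Fourier transforms, hence equal mass
  c. If c > 0, both become probability densities with the same characteristic function, so by Levy's
  theorem they define the same measure; but the set where the positive part is nonzero has mass 1
  for one and 0 for the other.\<close>

lemma fourier_injective_real:
  fixes h :: "real \<Rightarrow> real"
  assumes int: "integrable lborel h"
    and zero: "\<And>t. (LINT x|lborel. complex_of_real (h x) * iexp (t * x)) = 0"
  shows "AE x in lborel. h x = 0"
proof -
  have [measurable]: "h \<in> borel_measurable borel" using int by auto
  define a b where "a x = max (h x) 0" and "b x = max (- h x) 0" for x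
  have [measurable]: "a \<in> borel_measurable borel" "b \<in> borel_measurable borel"
    unfolding a_def b_def by measurable
  have ia: "integrable lborel a" and ib: "integrable lborel b"
    unfolding a_def b_def using int by (auto intro!: integrable_max)
  have hab: "h x = a x - b x" and nn: "a x \<ge> 0" "b x \<ge> 0" and disj: "a x = 0 \<or> b x = 0" for x
    by (auto simp: a_def b_def)
  have i_exp: "integrable lborel (\<lambda>x. complex_of_real (f x) * iexp (t * x))" if "integrable lborel f" for f :: "real \<Rightarrow> real" and t
    by (rule Bochner_Integration.integrable_bound[OF that]) (use that in \<open>auto simp: norm_mult\<close>)
  have eq: "(LINT x|lborel. complex_of_real (a x) * iexp (t * x)) = (LINT x|lborel. complex_of_real (b x) * iexp (t * x))" for t
  proof -
    have "0 = (LINT x|lborel. complex_of_real (a x) * iexp (t * x) - complex_of_real (b x) * iexp (t * x))"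
      using zero[of t] by (simp add: hab left_diff_distrib)
    then show ?thesis
      by (subst (asm) Bochner_Integration.integral_diff[OF i_exp[OF ia] i_exp[OF ib]]) simp
  qed
  define c where "c = (LINT x|lborel. a x)"
  have cb: "(LINT x|lborel. b x) = c"
  proof -
    have "complex_of_real (LINT x|lborel. a x) = complex_of_real (LINT x|lborel. b x)"
      unfolding integral_complex_of_real[symmetric] using eq[of 0] by (simp only: of_real_mult mult_zero_left of_real_0 mult_zero_right exp_zero mult_1_right)
    then show ?thesis unfolding of_real_eq_iff c_def by (rule sym)
  qed
  have "c \<ge> 0" unfolding c_def using nn by simp
  show ?thesis
  proof (cases "c = 0")
    case True
    have "AE x in lborel. a x = 0" "AE x in lborel. b x = 0"
      using True cb integral_nonneg_eq_0_iff_AE[OF ia] integral_nonneg_eq_0_iff_AE[OF ib] nn by (auto simp: c_def)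
    then show ?thesis by eventually_elim (simp add: hab)
  next
    case False
    then have c: "c > 0" using \<open>c \<ge> 0\<close> by simp
    define M where "M f = density lborel (\<lambda>x. ennreal (f x / c))" for f :: "real \<Rightarrow> real"
    have one: "(\<integral>\<^sup>+ x. ennreal (f x / c) \<partial>lborel) = 1"
      if "integrable lborel f" "\<And>x. f x \<ge> 0" "(LINT x|lborel. f x) = c" for f
      using that c by (subst nn_integral_eq_integral) auto
    have rd: "real_distribution (M f)"
      if "integrable lborel f" "\<And>x. f x \<ge> 0" "(LINT x|lborel. f x) = c" for f
    proof -
      have [measurable]: "f \<in> borel_measurable borel" using that(1) by auto
      have "prob_space (M f)"
        using one[OF that] by (intro prob_spaceI) (simp add: M_def emeasure_density)
      then show ?thesis
        by (simp add: real_distribution_def real_distribution_axioms_def M_def)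
    qed
    have char: "char (M f) t = (1 / c) *\<^sub>R (LINT x|lborel. complex_of_real (f x) * iexp (t * x))"
      if "integrable lborel f" "\<And>x. f x \<ge> 0" for f t
    proof -
      have [measurable]: "f \<in> borel_measurable borel" using that(1) by auto
      have "char (M f) t = (LINT x|lborel. (f x / c) *\<^sub>R iexp (t * x))"
        unfolding char_def M_def using that c by (subst integral_density) auto
      also have "\<dots> = (LINT x|lborel. (1 / c) *\<^sub>R (complex_of_real (f x) * iexp (t * x)))"
        by (simp add: scaleR_conv_of_real)
      finally show ?thesis by simp
    qed
    have "char (M a) = char (M b)"
      by (rule ext) (simp only: char[OF ia nn(1)] char[OF ib nn(2)] eq)
    then have "M a = M b"
      by (rule Levy_uniqueness[OF rd[OF ia nn(1) c_def[symmetric]] rd[OF ib nn(2) cb]])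
    moreover have "emeasure (M a) {x. a x > 0} = 1"
    proof -
      have "emeasure (M a) {x. a x > 0} = (\<integral>\<^sup>+ x. ennreal (a x / c) * indicator {x. a x > 0} x \<partial>lborel)"
        unfolding M_def by (rule emeasure_density) simp_all
      also have "\<dots> = (\<integral>\<^sup>+ x. ennreal (a x / c) \<partial>lborel)"
      proof (intro nn_integral_cong)
        show "ennreal (a x / c) * indicator {x. a x > 0} x = ennreal (a x / c)" for x
          using nn(1)[of x] by (cases "a x = 0") (auto simp: indicator_def)
      qed
      finally show ?thesis using one[OF ia nn(1)] by (simp add: c_def)
    qed
    moreover have "emeasure (M b) {x. a x > 0} = 0"
    proof -
      have "emeasure (M b) {x. a x > 0} = (\<integral>\<^sup>+ x. ennreal (b x / c) * indicator {x. a x > 0} x \<partial>lborel)"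
        unfolding M_def by (rule emeasure_density) simp_all
      also have "\<dots> = (\<integral>\<^sup>+ x. 0 \<partial>(lborel::real measure))"
      proof (intro nn_integral_cong)
        show "ennreal (b x / c) * indicator {x. a x > 0} x = 0" for x
          using disj[of x] by (cases "a x = 0") (auto simp: indicator_def)
      qed
      finally show ?thesis by simp
    qed
    ultimately show ?thesis by simp
  qed
qed

text \<open>The transform of cnj h at t is the conjugate of that of h at - t, so the transforms of
  the real and the imaginary part vanish too.\<close>

lemma fourier_injective:
  fixes h :: "real \<Rightarrow> complex"
  assumes int: "integrable lborel h" and zero: "\<And>t. (LINT x|lborel. h x * iexp (t * x)) = 0"
  shows "AE x in lborel. h x = 0"
proof -
  have [measurable]: "h \<in> borel_measurable borel" using int by auto
  have i_exp: "integrable lborel (\<lambda>x. h x * iexp (t * x))" for t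
    by (rule Bochner_Integration.integrable_bound[OF int]) (auto simp: norm_mult)
  have i_exp': "integrable lborel (\<lambda>x. cnj (h x) * iexp (t * x))" for t
    by (rule Bochner_Integration.integrable_bound[OF int]) (auto simp: norm_mult)
  have zero': "(LINT x|lborel. cnj (h x) * iexp (t * x)) = 0" for t
  proof -
    have "(LINT x|lborel. cnj (h x) * iexp (t * x)) = (LINT x|lborel. cnj (h x * iexp ((- t) * x)))"
      by (simp add: exp_cnj)
    also have "\<dots> = 0" unfolding Bochner_Integration.integral_cnj zero by simp
    finally show ?thesis .
  qed
  have "AE x in lborel. Re (h x) = 0"
  proof (rule fourier_injective_real)
    fix t
    have eq: "complex_of_real (Re (h x)) * iexp (t * x) = (1 / 2) * (h x * iexp (t * x) + cnj (h x) * iexp (t * x))" for x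
      by (simp add: complex_add_cnj distrib_right[symmetric])
    show "(LINT x|lborel. complex_of_real (Re (h x)) * iexp (t * x)) = 0"
      unfolding eq integral_mult_right_zero Bochner_Integration.integral_add[OF i_exp i_exp'] zero zero' by simp
  qed (use int in auto)
  moreover have "AE x in lborel. Im (h x) = 0"
  proof (rule fourier_injective_real)
    fix t
    have eq: "complex_of_real (Im (h x)) * iexp (t * x) = (1 / (2 * \<i>)) * (h x * iexp (t * x) - cnj (h x) * iexp (t * x))" for x
    proof -
      have "complex_of_real (Im (h x)) = (1 / (2 * \<i>)) * (h x - cnj (h x))"
        by (simp add: complex_eq_iff)
      then show ?thesis by (simp only: mult.assoc left_diff_distrib)
    qed
    show "(LINT x|lborel. complex_of_real (Im (h x)) * iexp (t * x)) = 0"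
      unfolding eq integral_mult_right_zero Bochner_Integration.integral_diff[OF i_exp i_exp'] zero zero' by simp
  qed (use int in auto)
  ultimately show ?thesis by eventually_elim (simp add: complex_eq_iff)
qed

lemma integrable_ess_bounded_mult:
  fixes k :: "real \<Rightarrow> complex"
  assumes "ess_bounded m C" "integrable lborel k"
  shows "integrable lborel (\<lambda>x. m x * k x)"
proof (rule Bochner_Integration.integrable_bound)
  show "integrable lborel (\<lambda>x. C * norm (k x))" using assms(2) by simp
  have [measurable]: "m \<in> borel_measurable borel" "k \<in> borel_measurable borel"
    using assms by (auto simp: ess_bounded_def)
  show "(\<lambda>x. m x * k x) \<in> borel_measurable lborel" by simp
  have "AE x in lborel. norm (m x) \<le> C" using assms by (simp add: ess_bounded_def)
  then show "AE x in lborel. norm (m x * k x) \<le> norm (C * norm (k x))"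
  proof eventually_elim
    case (elim x)
    then show ?case using assms(1) by (auto simp: norm_mult ess_bounded_def intro!: mult_right_mono)
  qed
qed

lemma ess_bounded_diff:
  assumes "ess_bounded m C" "ess_bounded m' C'"
  shows "ess_bounded (\<lambda>x. m x - m' x) (C + C')"
  using ess_bounded_add[OF assms(1) ess_bounded_mult[OF ess_bounded_const[of "-1"] assms(2)]] by simp

lemma ess_bounded_uminus_arg:
  assumes "ess_bounded (m :: real \<Rightarrow> complex) C"
  shows "ess_bounded (\<lambda>x. m (- x)) C"
proof -
  have "AE x in distr lborel borel uminus. norm (m x) \<le> C"
    unfolding lborel_distr_uminus using assms by (simp add: ess_bounded_def)
  moreover have [measurable]: "m \<in> borel_measurable borel" using assms by (simp add: ess_bounded_def)
  ultimately show ?thesis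
    using assms by (subst (asm) AE_distr_iff) (auto simp: ess_bounded_def)
qed

text \<open>Both \<open>mult_op\<close> and the Toeplitz operators with vertical symbols turn out to be determined
  by Fourier transforms of a Gaussian multiple of the symbol.\<close>

lemma ess_bounded_fourier_gaussian_injective:
  assumes m: "ess_bounded m C" and m': "ess_bounded m' C'" and s: "s > 0"
    and eq: "\<And>t. (LINT x|lborel. m x * exp (\<i> * of_real t * of_real x - of_real (s * x^2))) =
      (LINT x|lborel. m' x * exp (\<i> * of_real t * of_real x - of_real (s * x^2)))"
  shows "AE x in lborel. m x = m' x"
proof -
  \<comment> \<open>The Gaussian makes the bounded difference integrable; the term
    \<open>0 * of_real x\<close> gives it the shape of \<open>integrable_gaussian\<close>.\<close>
  define h where "h x = (m x - m' x) * exp (0 * of_real x - of_real (s * x^2))" for x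
  have int: "integrable lborel h"
    unfolding h_def by (intro integrable_ess_bounded_mult[OF ess_bounded_diff[OF m m']] integrable_gaussian s)
  have "(LINT x|lborel. h x * iexp (t * x)) = 0" for t
  proof -
    have "h x * iexp (t * x) = m x * exp (\<i> * of_real t * of_real x - of_real (s * x^2)) -
        m' x * exp (\<i> * of_real t * of_real x - of_real (s * x^2))" for x
      by (simp add: h_def exp_diff exp_minus field_simps)
    then have "(LINT x|lborel. h x * iexp (t * x)) = (LINT x|lborel. m x * exp (\<i> * of_real t * of_real x - of_real (s * x^2)) -
        m' x * exp (\<i> * of_real t * of_real x - of_real (s * x^2)))" by simp
    also have "\<dots> = 0"
    proof -
      have i: "integrable lborel (\<lambda>x. m x * exp (\<i> * of_real t * of_real x - of_real (s * x^2)))"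
        "integrable lborel (\<lambda>x. m' x * exp (\<i> * of_real t * of_real x - of_real (s * x^2)))"
        by (intro integrable_ess_bounded_mult[OF m] integrable_ess_bounded_mult[OF m'] integrable_gaussian s)+
      show ?thesis unfolding Bochner_Integration.integral_diff[OF i] eq by simp
    qed
    finally show ?thesis .
  qed
  then have "AE x in lborel. h x = 0" by (rule fourier_injective[OF int])
  then show ?thesis by eventually_elim (simp add: h_def)
qed

text \<open>The matrix entry at u = 0 and v = t / 2 is a nonzero multiple of the Fourier transform
  of m(x) exp (- 2 x^2) at t.\<close>

lemma mult_op_injective:
  assumes m: "ess_bounded m C" and m': "ess_bounded m' C'" and eq: "mult_op m = mult_op m'"
  shows "AE x in lborel. m x = m' x"
proof (rule ess_bounded_fourier_gaussian_injective[OF m m'])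
  fix t
  define K where "K = complex_of_real (sqrt (2 / pi)) * exp (((of_real t / 2)^2 + (cnj 0)^2) / 2)"
  have K: "K \<noteq> 0" by (simp add: K_def)
  have "bargmann_kernel 0 x * cnj (bargmann_kernel (of_real t / 2) x) = K * exp (\<i> * of_real t * of_real x - of_real (2 * x^2))" for x
    unfolding bargmann_kernel_mult_cnj K_def by simp
  then have "n x * bargmann_kernel 0 x * cnj (bargmann_kernel (of_real t / 2) x) = K * (n x * exp (\<i> * of_real t * of_real x - of_real (2 * x^2)))" for x and n :: "real \<Rightarrow> complex"
    by (simp only: mult.assoc mult.left_commute[of K])
  then show "(LINT x|lborel. m x * exp (\<i> * of_real t * of_real x - of_real (2 * x^2))) =
      (LINT x|lborel. m' x * exp (\<i> * of_real t * of_real x - of_real (2 * x^2)))"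
    using mult_op_kernel[OF m, of 0 "of_real t / 2"] mult_op_kernel[OF m', of 0 "of_real t / 2"] K
    unfolding eq by (simp only: integral_mult_right_zero) simp
qed simp

section \<open>Toeplitz operators with vertical symbols\<close>

lemma integral_complex_product:
  fixes a b :: "real \<Rightarrow> complex"
  assumes a: "integrable lborel a" and b: "integrable lborel b"
  shows "(LINT z|lborel. a (Re z) * b (Im z)) = (LINT x|lborel. a x) * (LINT y|lborel. b y)"
proof -
  have [measurable]: "a \<in> borel_measurable borel" "b \<in> borel_measurable borel" using a b by auto
  have [measurable]: "Re \<in> borel_measurable borel" "Im \<in> borel_measurable borel"
    by (intro borel_measurable_continuous_onI continuous_intros)+
  have "integrable (lborel \<Otimes>\<^sub>M lborel) (\<lambda>(x, y). a x * b y)"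
  proof (rule lborel_pair.Fubini_integrable)
    show "integrable lborel (\<lambda>x. LINT y|lborel. norm (case (x, y) of (x, y) \<Rightarrow> a x * b y))"
      using a by (simp add: norm_mult)
    show "AE x in lborel. integrable lborel (\<lambda>y. case (x, y) of (x, y) \<Rightarrow> a x * b y)"
      using b by simp
  qed simp
  then have "(LINT p|(lborel \<Otimes>\<^sub>M lborel). (case p of (x, y) \<Rightarrow> a x * b y)) = (LINT x|lborel. LINT y|lborel. a x * b y)"
    by (rule lborel_pair.integral_fst[symmetric])
  moreover have "(LINT z|lborel. a (Re z) * b (Im z)) = (LINT p|(lborel \<Otimes>\<^sub>M lborel). (case p of (x, y) \<Rightarrow> a x * b y))"
    by (subst lborel_complex[symmetric], subst integral_distr) (auto simp: case_prod_unfold)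
  ultimately show ?thesis by simp
qed

lemma AE_lborel_Im:
  assumes "AE t in lborel. P t" and [measurable]: "Measurable.pred borel P"
  shows "AE z in lborel. P (Im z)"
proof -
  have [measurable]: "Im \<in> borel_measurable borel"
    by (intro borel_measurable_continuous_onI continuous_intros)
  have "AE p in (lborel :: real measure) \<Otimes>\<^sub>M lborel. P (snd p)"
  proof (rule lborel_pair.AE_pair_measure)
    show "{p \<in> space ((lborel :: real measure) \<Otimes>\<^sub>M lborel). P (snd p)} \<in> sets (lborel \<Otimes>\<^sub>M lborel)"
      by measurable
  qed (use assms(1) in simp)
  then show ?thesis
    by (subst lborel_complex[symmetric], subst AE_distr_iff) (auto simp: case_prod_unfold)
qed

lemma ess_bounded_Im:
  assumes f: "ess_bounded f C"
  shows "ess_bounded (\<lambda>z. f (Im z)) C"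
proof -
  have [measurable]: "f \<in> borel_measurable borel" "Im \<in> borel_measurable borel"
    using f by (auto simp: ess_bounded_def intro!: borel_measurable_continuous_onI continuous_intros)
  have "AE z in lborel. norm (f (Im z)) \<le> C"
    by (rule AE_lborel_Im) (use f in \<open>auto simp: ess_bounded_def\<close>)
  then show ?thesis using f by (simp add: ess_bounded_def)
qed

text \<open>Gaussian weight and kernels factor into a function of \<open>Re w\<close> and one of
  \<open>Im w\<close>. The symbol enters the second factor only; the first is an explicit Gaussian
  integral.\<close>

lemma toeplitz_Im_kernel:
  assumes f: "ess_bounded f C"
  shows "fock_fun (blinfun_apply (toeplitz (\<lambda>z. f (Im z))) (fock_kernel u)) v =
    of_real (1 / sqrt pi) * exp ((cnj u + v)^2 / 4) *
    (LINT t|lborel. f t * exp (\<i> * (cnj u - v) * of_real t - of_real (1 * t^2)))"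
proof -
  have [measurable]: "f \<in> borel_measurable borel" "Im \<in> borel_measurable borel"
    using f by (auto simp: ess_bounded_def intro!: borel_measurable_continuous_onI continuous_intros)
  define a where "a x = of_real (1 / pi) * exp ((cnj u + v) * of_real x - of_real (1 * x^2))" for x
  define b where "b t = f t * exp (\<i> * (cnj u - v) * of_real t - of_real (1 * t^2))" for t
  have ia: "integrable lborel a"
    unfolding a_def by (intro integrable_mult_right integrable_gaussian) simp
  have ib: "integrable lborel b"
    unfolding b_def by (intro integrable_ess_bounded_mult[OF f] integrable_gaussian) simp
  have a: "(LINT x|lborel. a x) = of_real (1 / sqrt pi) * exp ((cnj u + v)^2 / 4)"
  proof -
    have "(LINT x|lborel. a x) = of_real (1 / pi * sqrt pi) * exp ((cnj u + v)^2 / 4)"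
      unfolding a_def integral_mult_right_zero by (subst gaussian_integral(2)) simp_all
    also have "1 / pi * sqrt pi = 1 / sqrt pi"
      by (simp add: field_simps)
    finally show ?thesis .
  qed
  have pt: "(exp (- ((norm w)^2)) / pi) *\<^sub>R (f (Im w) * exp (w * cnj u) * exp (v * cnj w)) = a (Re w) * b (Im w)" for w
  proof -
    have "complex_of_real (- ((norm w)^2)) + w * cnj u + v * cnj w =
        ((cnj u + v) * of_real (Re w) - of_real (1 * (Re w)^2)) + (\<i> * (cnj u - v) * of_real (Im w) - of_real (1 * (Im w)^2))"
      by (simp add: complex_eq_iff cmod_power2 algebra_simps)
    then have "exp (complex_of_real (- ((norm w)^2))) * exp (w * cnj u) * exp (v * cnj w) =
        exp ((cnj u + v) * of_real (Re w) - of_real (1 * (Re w)^2)) * exp (\<i> * (cnj u - v) * of_real (Im w) - of_real (1 * (Im w)^2))"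
      by (simp only: exp_add[symmetric])
    then show ?thesis
      unfolding a_def b_def exp_of_real by (simp add: scaleR_conv_of_real mult_ac)
  qed
  have "fock_fun (blinfun_apply (toeplitz (\<lambda>z. f (Im z))) (fock_kernel u)) v =
      (LINT w|fock_measure. f (Im w) * exp (w * cnj u) * exp (v * cnj w))"
    unfolding cinner_fock_kernel[of "blinfun_apply _ _", symmetric] cinner_toeplitz[OF ess_bounded_Im[OF f]]
    by (simp add: exp_cnj mult.commute[of v])
  also have "\<dots> = (LINT w|lborel. a (Re w) * b (Im w))"
    unfolding pt[symmetric]
  proof (rule integral_fock_measure)
    have [measurable]: "(\<lambda>w. exp (w * cnj u) * exp (v * cnj w)) \<in> borel_measurable borel"
      by (intro borel_measurable_continuous_onI continuous_intros)
    show "(\<lambda>w. f (Im w) * exp (w * cnj u) * exp (v * cnj w)) \<in> borel_measurable borel"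
      unfolding mult.assoc by measurable
  qed
  also have "\<dots> = (LINT x|lborel. a x) * (LINT y|lborel. b y)"
    by (rule integral_complex_product[OF ia ib])
  finally show ?thesis unfolding a b_def .
qed

text \<open>The matrix entry at u = 0 and v = - t is a nonzero multiple of the Fourier transform of
  f(x) exp (- x^2) at t.\<close>

lemma toeplitz_Im_injective:
  assumes f: "ess_bounded f C" and f': "ess_bounded f' C'"
    and eq: "toeplitz (\<lambda>z. f (Im z)) = toeplitz (\<lambda>z. f' (Im z))"
  shows "AE x in lborel. f x = f' x"
proof (rule ess_bounded_fourier_gaussian_injective[OF f f'])
  fix t
  show "(LINT x|lborel. f x * exp (\<i> * of_real t * of_real x - of_real (1 * x^2))) =
      (LINT x|lborel. f' x * exp (\<i> * of_real t * of_real x - of_real (1 * x^2)))"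
    using toeplitz_Im_kernel[OF f, of 0 "- of_real t"] toeplitz_Im_kernel[OF f', of 0 "- of_real t"]
    unfolding eq by simp
qed simp

lemma toeplitz_cong_AE:
  assumes f: "ess_bounded f C" and f': "ess_bounded f' C'" and eq: "AE z in lborel. f z = f' z"
  shows "toeplitz f = toeplitz f'"
proof (rule bounded_clinear_ops_eqI[OF toeplitz_in_ops[OF f] toeplitz_in_ops[OF f']], rule fock_eqI)
  have [measurable]: "f \<in> borel_measurable borel" "f' \<in> borel_measurable borel"
    using f f' by (auto simp: ess_bounded_def)
  have ae: "AE z in fock_measure. f z = f' z" using eq by (simp add: AE_fock_measure)
  fix u v
  show "fock_fun (blinfun_apply (toeplitz f) (fock_kernel u)) v = fock_fun (blinfun_apply (toeplitz f') (fock_kernel u)) v"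
    unfolding cinner_fock_kernel[of "blinfun_apply _ _", symmetric] cinner_toeplitz[OF f] cinner_toeplitz[OF f']
    using ae by (intro integral_cong_AE) auto
qed

text \<open>\<open>vertical\<close> allows a different null set for each translation h. Fubini
  exchanges the quantifiers: for almost every z, f (z + h) = f z holds for almost every h. The
  Gaussian average of f over the horizontal line through z then reproduces f z and depends on
  \<open>Im z\<close> only.\<close>

lemma vertical_eq_Im:
  assumes f: "ess_bounded f C" and vert: "vertical f"
  obtains f0 where "ess_bounded f0 C" "AE z in lborel. f z = f0 (Im z)"
proof -
  have [measurable]: "f \<in> borel_measurable borel" and C: "C \<ge> 0" and bound: "AE z in lborel. norm (f z) \<le> C"
    using f by (auto simp: ess_bounded_def)
  define \<gamma> where "\<gamma> = normal_density 0 1"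
  have [measurable]: "\<gamma> \<in> borel_measurable borel" by (simp add: \<gamma>_def)
  have i\<gamma>: "integrable lborel \<gamma>" "(LINT x|lborel. \<gamma> x) = 1"
    by (auto simp: \<gamma>_def)
  define f1 where "f1 t = (LINT s|lborel. \<gamma> s *\<^sub>R f (Complex s t))" for t
  \<comment> \<open>On exceptional heights the average may violate the bound C; the default 0 there
    makes the bound hold everywhere.\<close>
  define f0 where "f0 t = (if norm (f1 t) \<le> C then f1 t else 0)" for t
  have [measurable]: "(\<lambda>p. Complex (snd p) (fst p)) \<in> borel \<Otimes>\<^sub>M borel \<rightarrow>\<^sub>M borel"
    unfolding borel_prod by (intro borel_measurable_continuous_onI) (auto simp: Complex_eq intro!: continuous_intros)
  have m1[measurable]: "f1 \<in> borel_measurable borel"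
    unfolding f1_def by (intro lborel.borel_measurable_lebesgue_integral) (simp add: case_prod_unfold)
  have "f0 \<in> borel_measurable borel" unfolding f0_def by measurable
  then have "ess_bounded f0 C" using C by (auto simp: ess_bounded_def f0_def)
  moreover have "AE z in lborel. f z = f0 (Im z)"
  proof -
    have m2[measurable]: "(\<lambda>p. snd p + complex_of_real (fst p)) \<in> borel \<Otimes>\<^sub>M borel \<rightarrow>\<^sub>M borel"
      unfolding borel_prod by (intro borel_measurable_continuous_onI continuous_intros)
    have "{p \<in> space (lborel \<Otimes>\<^sub>M lborel). f (snd p + complex_of_real (fst p)) = f (snd p)} \<in> sets (lborel \<Otimes>\<^sub>M lborel)"
      by measurable
    from lborel_pair.AE_commute[OF this] have "AE z in lborel. AE h in lborel. f (z + complex_of_real h) = f z"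
      using vert by (simp add: vertical_def)
    then show ?thesis
      using bound
    proof eventually_elim
      case (elim z)
      have mz[measurable]: "(\<lambda>s. Complex s (Im z)) \<in> borel_measurable borel"
        by (intro borel_measurable_continuous_onI) (auto simp: Complex_eq intro!: continuous_intros)
      have mz'[measurable]: "(\<lambda>h. z + complex_of_real h) \<in> borel_measurable borel"
        by (intro borel_measurable_continuous_onI continuous_intros)
      have "f1 (Im z) = (LINT h|lborel. \<gamma> (Re z + 1 * h) *\<^sub>R f (Complex (Re z + 1 * h) (Im z)))"
        unfolding f1_def by (subst lborel_integral_real_affine[where c = 1 and t = "Re z"]) simp_all
      also have "\<dots> = (LINT h|lborel. \<gamma> (Re z + 1 * h) *\<^sub>R f (z + complex_of_real h))"
        by (intro Bochner_Integration.integral_cong refl arg_cong2[where f = scaleR] arg_cong[where f = f]) (simp add: complex_eq_iff)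
      also have "\<dots> = (LINT h|lborel. \<gamma> (Re z + 1 * h) *\<^sub>R f z)"
        using elim(1) by (intro integral_cong_AE) auto
      also have "\<dots> = (LINT h|lborel. \<gamma> h *\<^sub>R f z)"
        using lborel_integral_real_affine[of 1 "\<lambda>h. \<gamma> h *\<^sub>R f z" "Re z"] by simp
      also have "\<dots> = f z" using i\<gamma> by simp
      finally show ?case using elim(2) by (simp add: f0_def)
    qed
  qed
  ultimately show ?thesis by (rule that)
qed

section \<open>Convolution with integrable kernels\<close>

lemma integrable_convolve:
  fixes k m :: "real \<Rightarrow> complex"
  assumes k: "integrable lborel k" and m: "ess_bounded m C"
  shows "integrable lborel (\<lambda>y. k (x - y) * m y)"
proof -
  have "integrable lborel (\<lambda>y. k (x + (-1) * y))"
    using k by (subst lborel_integrable_real_affine_iff) auto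
  from integrable_ess_bounded_mult[OF m this] show ?thesis by (simp add: mult.commute)
qed

lemma convolve_bounds:
  fixes k m :: "real \<Rightarrow> complex"
  assumes k: "integrable lborel k" and m: "ess_bounded m C"
  shows norm_convolve: "norm (convolve k m x) \<le> (LINT y|lborel. norm (k y)) * C"
    and ess_bounded_convolve: "ess_bounded (convolve k m) ((LINT y|lborel. norm (k y)) * C)"
proof -
  have [measurable]: "k \<in> borel_measurable borel" "m \<in> borel_measurable borel"
    using k m by (auto simp: ess_bounded_def)
  have C: "C \<ge> 0" using m by (simp add: ess_bounded_def)
  show b: "norm (convolve k m x) \<le> (LINT y|lborel. norm (k y)) * C" for x
  proof -
    have ik: "integrable lborel (\<lambda>y. k (x - y))"
      using integrable_convolve[OF k ess_bounded_const[of 1], of x] by simp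
    have "AE y in lborel. norm (m y) \<le> C" using m by (simp add: ess_bounded_def)
    then have "AE y in lborel. norm (k (x - y) * m y) \<le> norm (k (x - y)) * C"
      by eventually_elim (auto simp: norm_mult intro!: mult_left_mono)
    then have "(LINT y|lborel. norm (k (x - y) * m y)) \<le> (LINT y|lborel. norm (k (x - y)) * C)"
      using ik integrable_convolve[OF k m, of x] by (intro integral_mono_AE) auto
    also have "\<dots> = (LINT y|lborel. norm (k y)) * C"
      using lborel_integral_real_affine[of "-1" "\<lambda>y. norm (k y)" x] by simp
    finally show ?thesis
      unfolding convolve_def by (rule order_trans[OF integral_norm_bound])
  qed
  have "convolve k m \<in> borel_measurable borel"
    unfolding convolve_def[abs_def] by (intro lborel.borel_measurable_lebesgue_integral) simp
  then show "ess_bounded (convolve k m) ((LINT y|lborel. norm (k y)) * C)"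
    using C b by (auto simp: ess_bounded_def)
qed

lemma integrable_gauss: "integrable lborel gauss"
proof -
  have "gauss x = of_real (sqrt (2 / pi)) * exp (0 * of_real x - of_real (2 * x^2))" for x
    by (simp add: gauss_def exp_of_real[symmetric])
  then have eq: "gauss = (\<lambda>x. of_real (sqrt (2 / pi)) * exp (0 * of_real x - of_real (2 * x^2)))" by blast
  show ?thesis
    unfolding eq by (intro integrable_mult_right integrable_gaussian) simp
qed

text \<open>Completing the square in x. The result is, prefactor included, the weight against which
  \<open>toeplitz_Im_kernel\<close> integrates the symbol, taken at t = - y; this is the source of
  the sign in \<open>m\<^sub>0 (- Im z)\<close>.\<close>

lemma gauss_mult_bargmann_kernel_integral:
  "(LINT x|lborel. gauss (x - y) * (bargmann_kernel u x * cnj (bargmann_kernel v x))) =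
    of_real (1 / sqrt pi) * exp ((cnj u + v)^2 / 4) * exp (\<i> * (v - cnj u) * of_real y - of_real (1 * y^2))"
proof -
  define K where "K = of_real (2 / pi) * exp ((v^2 + (cnj u)^2) / 2) * exp (- of_real (2 * y^2))"
  have "gauss (x - y) * (bargmann_kernel u x * cnj (bargmann_kernel v x)) =
      K * exp ((4 * of_real y + 2 * \<i> * (v - cnj u)) * of_real x - of_real (4 * x^2))" for x
  proof -
    have s: "complex_of_real (2 / pi) = of_real (sqrt (2 / pi)) * of_real (sqrt (2 / pi))"
      unfolding of_real_mult[symmetric] by (subst real_sqrt_mult_self) simp
    have "of_real (- 2 * (x - y)^2) + ((v^2 + (cnj u)^2) / 2 + (2 * \<i> * (v - cnj u) * of_real x - of_real (2 * x^2))) =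
       (v^2 + (cnj u)^2) / 2 + (- of_real (2 * y^2)) + ((4 * of_real y + 2 * \<i> * (v - cnj u)) * of_real x - of_real (4 * x^2))"
      by (simp add: power2_eq_square algebra_simps)
    then have "exp (of_real (- 2 * (x - y)^2)) * (exp ((v^2 + (cnj u)^2) / 2) * exp (2 * \<i> * (v - cnj u) * of_real x - of_real (2 * x^2))) =
       exp ((v^2 + (cnj u)^2) / 2) * exp (- of_real (2 * y^2)) * exp ((4 * of_real y + 2 * \<i> * (v - cnj u)) * of_real x - of_real (4 * x^2))"
      by (simp only: exp_add[symmetric])
    note E = this
    have "gauss (x - y) * (bargmann_kernel u x * cnj (bargmann_kernel v x)) =
        of_real (2 / pi) * (exp (of_real (- 2 * (x - y)^2)) * (exp ((v^2 + (cnj u)^2) / 2) * exp (2 * \<i> * (v - cnj u) * of_real x - of_real (2 * x^2))))"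
      by (simp only: gauss_def bargmann_kernel_mult_cnj s of_real_mult[of "sqrt _"] exp_of_real[symmetric] mult_ac)
    then show ?thesis unfolding E K_def by (simp only: mult.assoc)
  qed
  then have "(LINT x|lborel. gauss (x - y) * (bargmann_kernel u x * cnj (bargmann_kernel v x))) =
      K * (of_real (sqrt (pi / 4)) * exp ((4 * of_real y + 2 * \<i> * (v - cnj u))^2 / of_real (4 * 4)))"
    by (simp only: integral_mult_right_zero) (subst gaussian_integral(2), simp_all)
  also have "\<dots> = of_real (2 / pi * sqrt (pi / 4)) * exp ((v^2 + (cnj u)^2) / 2 + (- of_real (2 * y^2)) + (4 * of_real y + 2 * \<i> * (v - cnj u))^2 / of_real (4 * 4))"
    unfolding K_def exp_add of_real_mult by (simp only: mult_ac)
  also have "2 / pi * sqrt (pi / 4) = 1 / sqrt pi"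
    by (simp add: real_sqrt_divide field_simps)
  also have "(v^2 + (cnj u)^2) / 2 + (- of_real (2 * y^2)) + (4 * of_real y + 2 * \<i> * (v - cnj u))^2 / of_real (4 * 4) =
      (cnj u + v)^2 / 4 + (\<i> * (v - cnj u) * of_real y - of_real (1 * y^2))"
    by (simp add: power2_eq_square field_simps)
  finally show ?thesis by (simp add: exp_add mult.assoc)
qed

text \<open>Fubini moves the x integral inside, where
  \<open>gauss_mult_bargmann_kernel_integral\<close> evaluates it; the reflection y = - t then gives
  the kernel matrix of the Toeplitz operator.\<close>

lemma mult_op_convolve_gauss:
  assumes f: "ess_bounded f C"
  shows "mult_op (convolve gauss f) = toeplitz (\<lambda>z. f (- Im z))"
proof (rule mult_op_eqI)
  note f' = ess_bounded_uminus_arg[OF f]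
  have [measurable]: "f \<in> borel_measurable borel" "gauss \<in> borel_measurable borel"
    using f integrable_gauss by (auto simp: ess_bounded_def)
  show "toeplitz (\<lambda>z. f (- Im z)) \<in> bounded_clinear_ops"
    by (rule toeplitz_in_ops[OF ess_bounded_Im[OF f']])
  fix u v
  define k where "k x = bargmann_kernel u x * cnj (bargmann_kernel v x)" for x
  have ik: "integrable lborel k"
    unfolding k_def by (intro integrable_L2_line L2_line_bargmann_kernel)
  have [measurable]: "k \<in> borel_measurable borel" using ik by auto
  have "integrable (lborel \<Otimes>\<^sub>M lborel) (\<lambda>(x, y). gauss (x - y) * f y * k x)"
  proof (rule lborel_pair.Fubini_integrable)
    show "AE x in lborel. integrable lborel (\<lambda>y. case (x, y) of (x, y) \<Rightarrow> gauss (x - y) * f y * k x)"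
      using integrable_convolve[OF integrable_gauss f] by simp
    \<comment> \<open>The inner integral of absolute values is the convolution of |gauss| with |f|,
      hence bounded, and k is integrable.\<close>
    define N where "N x = (LINT y|lborel. norm (gauss (x - y) * f y))" for x
    have [measurable]: "N \<in> borel_measurable borel"
      unfolding N_def by (intro lborel.borel_measurable_lebesgue_integral) simp
    have N: "norm (N x) \<le> (LINT y|lborel. norm (gauss y)) * C" for x
    proof -
      have fn: "ess_bounded (\<lambda>y. complex_of_real (norm (f y))) C"
        using f by (simp add: ess_bounded_def)
      have gn: "integrable lborel (\<lambda>y. complex_of_real (norm (gauss y)))"
        using integrable_gauss by simp
      have "convolve (\<lambda>y. complex_of_real (norm (gauss y))) (\<lambda>y. complex_of_real (norm (f y))) x = complex_of_real (N x)"
        unfolding convolve_def N_def norm_mult of_real_mult[symmetric] integral_complex_of_real ..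
      then show ?thesis using norm_convolve[OF gn fn, of x] by simp
    qed
    show "integrable lborel (\<lambda>x. LINT y|lborel. norm (case (x, y) of (x, y) \<Rightarrow> gauss (x - y) * f y * k x))"
    proof (rule Bochner_Integration.integrable_bound)
      show "integrable lborel (\<lambda>x. ((LINT y|lborel. norm (gauss y)) * C) * norm (k x))"
        using ik by simp
      have eq: "(LINT y|lborel. norm (case (x, y) of (x, y) \<Rightarrow> gauss (x - y) * f y * k x)) = N x * norm (k x)" for x
        unfolding N_def by (simp add: norm_mult)
      show "(\<lambda>x. LINT y|lborel. norm (case (x, y) of (x, y) \<Rightarrow> gauss (x - y) * f y * k x)) \<in> borel_measurable lborel"
        unfolding eq by simp
      show "AE x in lborel. norm (LINT y|lborel. norm (case (x, y) of (x, y) \<Rightarrow> gauss (x - y) * f y * k x)) \<le>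
          norm (((LINT y|lborel. norm (gauss y)) * C) * norm (k x))"
      proof (rule AE_I2)
        fix x
        have "norm (N x) * norm (k x) \<le> norm ((LINT y|lborel. norm (gauss y)) * C) * norm (k x)"
          by (intro mult_right_mono order_trans[OF N]) auto
        then show "norm (LINT y|lborel. norm (case (x, y) of (x, y) \<Rightarrow> gauss (x - y) * f y * k x)) \<le>
            norm (((LINT y|lborel. norm (gauss y)) * C) * norm (k x))"
          unfolding eq by (simp only: norm_mult real_norm_def abs_mult abs_norm_cancel)
      qed
    qed
  qed simp
  from lborel_pair.Fubini_integral[OF this]
  have "(LINT x|lborel. LINT y|lborel. gauss (x - y) * f y * k x) = (LINT y|lborel. LINT x|lborel. gauss (x - y) * f y * k x)"
    by simp
  moreover have "(LINT x|lborel. LINT y|lborel. gauss (x - y) * f y * k x) =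
      (LINT x|lborel. convolve gauss f x * bargmann_kernel u x * cnj (bargmann_kernel v x))"
    unfolding integral_mult_left_zero convolve_def[symmetric] by (simp only: k_def mult.assoc)
  moreover have "(LINT y|lborel. LINT x|lborel. gauss (x - y) * f y * k x) =
      (LINT y|lborel. of_real (1 / sqrt pi) * exp ((cnj u + v)^2 / 4) * (f y * exp (\<i> * (v - cnj u) * of_real y - of_real (1 * y^2))))"
  proof (intro Bochner_Integration.integral_cong refl)
    fix y
    have "(LINT x|lborel. gauss (x - y) * f y * k x) = f y * (LINT x|lborel. gauss (x - y) * k x)"
      unfolding mult.commute[of _ "f y"] mult.assoc by simp
    then show "(LINT x|lborel. gauss (x - y) * f y * k x) =
        of_real (1 / sqrt pi) * exp ((cnj u + v)^2 / 4) * (f y * exp (\<i> * (v - cnj u) * of_real y - of_real (1 * y^2)))"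
      unfolding k_def gauss_mult_bargmann_kernel_integral by (simp only: mult_ac)
  qed
  moreover have "(LINT y|lborel. f y * exp (\<i> * (v - cnj u) * of_real y - of_real (1 * y^2))) =
      (LINT t|lborel. f (- t) * exp (\<i> * (cnj u - v) * of_real t - of_real (1 * t^2)))"
    using lborel_integral_real_affine[of "-1" "\<lambda>y. f y * exp (\<i> * (v - cnj u) * of_real y - of_real (1 * y^2))" 0]
    by (simp add: algebra_simps)
  ultimately show "fock_fun (blinfun_apply (toeplitz (\<lambda>z. f (- Im z))) (fock_kernel u)) v =
      (LINT x|lborel. convolve gauss f x * bargmann_kernel u x * cnj (bargmann_kernel v x))"
    unfolding toeplitz_Im_kernel[OF f'] by (simp only: integral_mult_right_zero)
qed

subsection \<open>Approximation by Gaussian convolutions\<close>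

text \<open>cos (y / sqrt n) is 1 - y^2 / (2 n) up to order n^(-2), and the exponent 2 n turns this
  into exp (- y^2). Negative y reduces to positive y by evenness.\<close>

lemma cos_power_tendsto_gaussian: "(\<lambda>n. cos (y / sqrt (real n)) ^ (2 * n)) \<longlonglongrightarrow> exp (- (y^2))"
proof -
  have pos: "(\<lambda>n. cos (y / sqrt (real n)) ^ (2 * n)) \<longlonglongrightarrow> exp (- (y * y))" if "y > 0" for y :: real
    using that by real_asymp
  consider "y > 0" | "y = 0" | "- y > 0" by linarith
  then show ?thesis
  proof cases
    case 3
    from pos[OF 3] show ?thesis by (simp add: power2_eq_square)
  qed (use pos[of y] in \<open>auto simp: power2_eq_square\<close>)
qed

definition gauss_density :: "real \<Rightarrow> real \<Rightarrow> complex" where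
  "gauss_density \<sigma> x = complex_of_real (normal_density 0 \<sigma> x)"

text \<open>The standard deviation of \<open>gauss\<close> is 1 / 2, whence the recurrent condition
  \<open>\<sigma> \<le> 1 / 2\<close> on Gaussians obtained from it by a further Gaussian
  factor.\<close>

lemma gauss_eq: "gauss = gauss_density (1 / 2)"
proof (rule ext)
  have "sqrt (2 / pi) = 1 / sqrt (2 * pi * (1 / 2)^2)"
    by (simp add: power2_eq_square real_sqrt_divide field_simps)
  then show "gauss x = gauss_density (1 / 2) x" for x
    by (simp add: gauss_def gauss_density_def normal_density_def power2_eq_square)
qed

lemma gauss_density:
  assumes "\<sigma> > 0"
  shows integrable_gauss_density: "integrable lborel (gauss_density \<sigma>)"
    and norm_integral_gauss_density: "(LINT x|lborel. norm (gauss_density \<sigma> x)) = 1"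
  using assms by (simp_all add: gauss_density_def[abs_def] norm_of_real abs_of_nonneg normal_density_nonneg integral_normal_density integrable_normal_density)

lemma convolve_swap:
  "convolve k m t = (LINT v|lborel. k v * m (t - v))"
  unfolding convolve_def
  using lborel_integral_real_affine[of "-1" "\<lambda>v. k v * m (t - v)" t] by simp

text \<open>Both sides are the double integral of k(v) l(w) m(t - v - w), taken in the two orders;
  the bound C on m gives an integrable majorant.\<close>

lemma convolve_commute:
  assumes k: "integrable lborel k" and l: "integrable lborel l"
    and [measurable]: "m \<in> borel_measurable borel" and m: "\<And>x. norm (m x) \<le> C"
  shows "convolve k (convolve l m) = convolve l (convolve k m)"
proof (rule ext)
  fix t
  have [measurable]: "k \<in> borel_measurable borel" "l \<in> borel_measurable borel"
    using k l by auto
  have C: "C \<ge> 0" by (rule order_trans[OF norm_ge_zero m])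
  have bm: "ess_bounded m C" using m C by (simp add: ess_bounded_def)
  have "integrable (lborel \<Otimes>\<^sub>M lborel) (\<lambda>(v, w). k v * l w * m (t - v - w))"
  proof (rule Bochner_Integration.integrable_bound)
    show "integrable (lborel \<Otimes>\<^sub>M lborel) (\<lambda>(v, w). k v * l w * of_real C)"
    proof (rule lborel_pair.Fubini_integrable)
      show "integrable lborel (\<lambda>v. LINT w|lborel. norm (case (v, w) of (v, w) \<Rightarrow> k v * l w * of_real C))"
        using k by (simp add: norm_mult)
      show "AE v in lborel. integrable lborel (\<lambda>w. case (v, w) of (v, w) \<Rightarrow> k v * l w * of_real C)"
        using l by simp
    qed simp
    show "AE p in lborel \<Otimes>\<^sub>M lborel. norm (case p of (v, w) \<Rightarrow> k v * l w * m (t - v - w)) \<le>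
        norm (case p of (v, w) \<Rightarrow> k v * l w * complex_of_real C)"
      using m C by (auto simp: norm_mult intro!: AE_I2 mult_left_mono)
  qed simp
  from lborel_pair.Fubini_integral[OF this]
  have "(LINT w|lborel. LINT v|lborel. k v * l w * m (t - v - w)) = (LINT v|lborel. LINT w|lborel. k v * l w * m (t - v - w))" .
  moreover have "(LINT v|lborel. LINT w|lborel. k v * l w * m (t - v - w)) = convolve k (convolve l m) t"
    unfolding convolve_swap mult.assoc integral_mult_right_zero ..
  moreover have "(LINT w|lborel. LINT v|lborel. k v * l w * m (t - v - w)) = convolve l (convolve k m) t"
    unfolding convolve_swap mult.commute[of "k _" "l _"] mult.assoc integral_mult_right_zero
    by (intro Bochner_Integration.integral_cong refl arg_cong2[where f = times] arg_cong[where f = m]) simp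
  ultimately show "convolve k (convolve l m) t = convolve l (convolve k m) t" by simp
qed

text \<open>Beyond distance \<open>d\<close> the crude bound \<open>2 * C\<close> is weighted by the quotient of the variance by \<open>d^2\<close>.\<close>

lemma convolve_gauss_density_approx:
  assumes [measurable]: "F \<in> borel_measurable borel" and F: "\<And>x. norm (F x) \<le> C"
    and \<sigma>: "\<sigma> > 0" and d: "d > 0" and e: "\<And>s. \<bar>s\<bar> < d \<Longrightarrow> norm (F (t + s) - F t) \<le> e"
  shows "norm (convolve (gauss_density \<sigma>) F t - F t) \<le> e + 2 * C * \<sigma>^2 / d^2"
proof -
  define n where "n = normal_density 0 \<sigma>"
  have [measurable]: "n \<in> borel_measurable borel" by (simp add: n_def)
  have n: "n x \<ge> 0" "integrable lborel n" "(LINT x|lborel. n x) = 1" for x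
    using \<sigma> by (auto simp: n_def normal_density_nonneg)
  have n2: "integrable lborel (\<lambda>x. n x * x^2)" "(LINT x|lborel. n x * x^2) = \<sigma>^2"
    using integrable_normal_moment[OF \<sigma>, of 0 2] integral_normal_moment_even[OF \<sigma>, of 0 1]
    by (auto simp: n_def)
  have C: "C \<ge> 0" by (rule order_trans[OF norm_ge_zero F])
  have e0: "e \<ge> 0" using e[of 0] d by simp
  have gd: "gauss_density \<sigma> v = of_real (n v)" for v by (simp add: gauss_density_def n_def)
  have i1: "integrable lborel (\<lambda>v. of_real (n v) * F (t - v))"
    by (rule Bochner_Integration.integrable_bound[of _ "\<lambda>v. n v * C"])
      (use n F C in \<open>auto simp: norm_mult intro!: mult_left_mono\<close>)
  have i2: "integrable lborel (\<lambda>v. of_real (n v) * F t)"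
    using n(2) by simp
  have "convolve (gauss_density \<sigma>) F t - F t = (LINT v|lborel. of_real (n v) * F (t - v)) - (LINT v|lborel. of_real (n v) * F t)"
    unfolding convolve_swap gd by (simp add: n(3))
  also have "\<dots> = (LINT v|lborel. of_real (n v) * F (t - v) - of_real (n v) * F t)"
    by (rule Bochner_Integration.integral_diff[OF i1 i2, symmetric])
  also have "norm \<dots> \<le> (LINT v|lborel. e * n v + 2 * C / d^2 * (n v * v^2))"
  proof (rule order_trans[OF integral_norm_bound], rule integral_mono)
    show "integrable lborel (\<lambda>v. norm (of_real (n v) * F (t - v) - of_real (n v) * F t))"
      using i1 i2 by simp
    show "integrable lborel (\<lambda>v. e * n v + 2 * C / d^2 * (n v * v^2))"
      using n n2 by simp
    fix v
    have "norm (F (t - v) - F t) \<le> e + 2 * C / d^2 * v^2"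
    proof (cases "\<bar>v\<bar> < d")
      case True
      then have "norm (F (t - v) - F t) \<le> e" using e[of "- v"] by simp
      then show ?thesis using C by (smt (verit) divide_nonneg_nonneg mult_nonneg_nonneg zero_le_power2)
    next
      case False
      then have "d^2 \<le> v^2" using d by (simp add: abs_le_square_iff[symmetric])
      then have "1 \<le> v^2 / d^2" using d by simp
      then have "2 * C * 1 \<le> 2 * C * (v^2 / d^2)" using C by (intro mult_left_mono) auto
      moreover have "norm (F (t - v) - F t) \<le> 2 * C"
        using norm_triangle_ineq4[of "F (t - v)" "F t"] F[of "t - v"] F[of t] by linarith
      ultimately show ?thesis using e0 by simp
    qed
    then have "n v * norm (F (t - v) - F t) \<le> n v * (e + 2 * C / d^2 * v^2)"
      using n by (intro mult_left_mono) auto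
    moreover have "norm (of_real (n v) * F (t - v) - of_real (n v) * F t) = n v * norm (F (t - v) - F t)"
      unfolding right_diff_distrib[symmetric] norm_mult using n by simp
    ultimately show "norm (of_real (n v) * F (t - v) - of_real (n v) * F t) \<le> e * n v + 2 * C / d^2 * (n v * v^2)"
      by (simp add: algebra_simps)
  qed
  also have "\<dots> = e + 2 * C / d^2 * \<sigma>^2"
    using n n2 by simp
  finally show ?thesis by simp
qed

lemma convolve_diff_bound:
  assumes k: "integrable lborel k" and l: "integrable lborel l" and m: "ess_bounded m C"
  shows "ess_bounded (\<lambda>x. convolve k m x - convolve l m x) ((LINT x|lborel. norm (k x - l x)) * C)"
proof -
  have "convolve (\<lambda>x. k x - l x) m = (\<lambda>x. convolve k m x - convolve l m x)"
    unfolding convolve_def[abs_def] left_diff_distrib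
    by (rule ext) (rule Bochner_Integration.integral_diff[OF integrable_convolve[OF k m] integrable_convolve[OF l m]])
  then show ?thesis
    using ess_bounded_convolve[of "\<lambda>x. k x - l x" m C] k l m by simp
qed

lemma borel_measurable_gauss_density [measurable]: "gauss_density \<sigma> \<in> borel_measurable borel"
  unfolding gauss_density_def[abs_def] by measurable

text \<open>N is what remains of the coefficient 1 / (2 \<sigma>^2) once the factor exp (- 2 x^2) of
  \<open>gauss\<close> is split off; for positive \<sigma>, N \<ge> 0 means \<sigma> \<le> 1 / 2.
  The second exponential is the limit of cosine powers at y = x sqrt N.\<close>

lemma gauss_density_eq_exp:
  assumes "\<sigma> > 0" "N = 1 / (2 * \<sigma>^2) - 2" "N \<ge> 0"
  shows "gauss_density \<sigma> x = of_real (1 / sqrt (2 * pi * \<sigma>^2) * (exp (- 2 * x^2) * exp (- ((x * sqrt N)^2))))"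
proof -
  have "- 2 * x^2 + - ((x * sqrt N)^2) = - (x^2) * (2 + N)"
    using assms(3) by (simp add: power_mult_distrib algebra_simps)
  also have "\<dots> = - (x^2) / (2 * \<sigma>^2)"
    using assms by simp
  finally show ?thesis
    by (simp add: gauss_density_def normal_density_def exp_add[symmetric])
qed

subsection \<open>Translation continuous operators\<close>

text \<open>With W the Weyl operator, a surjective isometry, the commutator has the same norm as W A
  W^(-1) - A, and it is linear in W and in A. Imaginary translations are used because real ones act
  as modulations, which commute with every multiplication operator.\<close>

definition translation_continuous_ops :: "(fock \<Rightarrow>\<^sub>L fock) set" where
  "translation_continuous_ops = {A \<in> bounded_clinear_ops. \<forall>e>0. \<exists>d>0. \<forall>s. \<bar>s\<bar> < d \<longrightarrow>
     norm ((weyl (\<i> * of_real s) o\<^sub>L A) - (A o\<^sub>L weyl (\<i> * of_real s))) \<le> e}"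

lemma translation_continuous_opsD:
  assumes "A \<in> translation_continuous_ops" "e > 0"
  obtains d where "d > 0" "\<And>s. \<bar>s\<bar> < d \<Longrightarrow>
     norm ((weyl (\<i> * of_real s) o\<^sub>L A) - (A o\<^sub>L weyl (\<i> * of_real s))) \<le> e"
  using assms unfolding translation_continuous_ops_def by blast

lemma norm_weyl_op: "norm (weyl a) \<le> 1"
  by (rule norm_blinfun_bound) auto

lemma norm_cscale_op: "norm (cscale_op c A) \<le> norm c * norm A"
proof (rule norm_blinfun_bound)
  show "norm (blinfun_apply (cscale_op c A) f) \<le> norm c * norm A * norm f" for f
    unfolding cscale_op_eq norm_cscale mult.assoc by (intro mult_left_mono norm_blinfun) auto
qed simp

lemma closed_bounded_clinear_ops: "closed bounded_clinear_ops"
  unfolding closed_sequential_limits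
proof (intro allI impI, elim conjE)
  fix X A assume X: "\<forall>n. X n \<in> bounded_clinear_ops" and lim: "X \<longlonglongrightarrow> A"
  have ap: "(\<lambda>n. blinfun_apply (X n) f) \<longlonglongrightarrow> blinfun_apply A f" for f
    by (intro tendsto_intros lim)
  have "blinfun_apply A (cscale c f) = cscale c (blinfun_apply A f)" for c f
  proof (rule LIMSEQ_unique)
    show "(\<lambda>n. blinfun_apply (X n) (cscale c f)) \<longlonglongrightarrow> blinfun_apply A (cscale c f)" by (rule ap)
    have "(\<lambda>n. cscale c (blinfun_apply (X n) f)) \<longlonglongrightarrow> cscale c (blinfun_apply A f)"
      by (rule bounded_linear.tendsto[OF bounded_linear_cscale ap])
    then show "(\<lambda>n. blinfun_apply (X n) (cscale c f)) \<longlonglongrightarrow> cscale c (blinfun_apply A f)"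
      using X by (simp add: bounded_clinear_ops_iff)
  qed
  then show "A \<in> bounded_clinear_ops" by (simp add: bounded_clinear_ops_iff)
qed

text \<open>The commutator with W is a derivation, which settles products. The commutator of the
  adjoint at s is minus the adjoint of the commutator at - s, and the condition on s is symmetric.
  Closedness uses that every W is a contraction.\<close>

lemma cstar_subalgebra_translation_continuous: "cstar_subalgebra translation_continuous_ops"
proof -
  let ?T = translation_continuous_ops
  let ?W = "\<lambda>s::real. weyl (\<i> * of_real s)"
  let ?c = "\<lambda>A s. (?W s o\<^sub>L A) - (A o\<^sub>L ?W s)"
  interpret V: vector_space cscale_op by (rule vector_space_cscale_op)
  have ops: "?T \<subseteq> bounded_clinear_ops" by (auto simp: translation_continuous_ops_def)
  have TI: "A \<in> ?T" if "A \<in> bounded_clinear_ops" "\<And>e. e > 0 \<Longrightarrow> \<exists>d>0. \<forall>s. \<bar>s\<bar> < d \<longrightarrow> norm (?c A s) \<le> e" for A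
    using that by (simp add: translation_continuous_ops_def)
  have TD: "\<exists>d>0. \<forall>s. \<bar>s\<bar> < d \<longrightarrow> norm (?c A s) \<le> e" if "A \<in> ?T" "e > 0" for A e
    using that by (auto simp: translation_continuous_ops_def)
  have zero: "0 \<in> ?T"
  proof (rule TI)
    have "cscale c 0 = 0" for c by (rule fock_eqI) simp
    then show "0 \<in> bounded_clinear_ops" by (simp add: bounded_clinear_ops_iff)
    have "?c 0 s = 0" for s by (rule blinfun_eqI) (simp add: blinfun.diff_left)
    then show "\<exists>d>0. \<forall>s. \<bar>s\<bar> < d \<longrightarrow> norm (?c 0 s) \<le> e" if "e > 0" for e
      using that by (intro exI[of _ 1]) simp
  qed
  have add: "A + B \<in> ?T" if A: "A \<in> ?T" and B: "B \<in> ?T" for A B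
  proof (rule TI)
    show "A + B \<in> bounded_clinear_ops" using A B ops by (auto intro: bounded_clinear_ops_add)
    fix e :: real assume e: "e > 0"
    obtain d1 where d1: "d1 > 0" "\<And>s. \<bar>s\<bar> < d1 \<Longrightarrow> norm (?c A s) \<le> e / 2" using TD[OF A, of "e / 2"] e by auto
    obtain d2 where d2: "d2 > 0" "\<And>s. \<bar>s\<bar> < d2 \<Longrightarrow> norm (?c B s) \<le> e / 2" using TD[OF B, of "e / 2"] e by auto
    have "norm (?c (A + B) s) \<le> e" if "\<bar>s\<bar> < min d1 d2" for s
    proof -
      have "?c (A + B) s = ?c A s + ?c B s"
        by (rule blinfun_eqI) (simp add: blinfun.bilinear_simps)
      then show ?thesis
        using norm_triangle_mono[OF d1(2)[of s] d2(2)[of s]] that by simp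
    qed
    then show "\<exists>d>0. \<forall>s. \<bar>s\<bar> < d \<longrightarrow> norm (?c (A + B) s) \<le> e"
      using d1(1) d2(1) by (intro exI[of _ "min d1 d2"]) auto
  qed
  have scale: "cscale_op c A \<in> ?T" if A: "A \<in> ?T" for c A
  proof (rule TI)
    show "cscale_op c A \<in> bounded_clinear_ops" using A ops by (auto intro: bounded_clinear_ops_cscale_op)
    fix e :: real assume e: "e > 0"
    \<comment> \<open>The added 1 allows for c = 0.\<close>
    obtain d where d: "d > 0" "\<And>s. \<bar>s\<bar> < d \<Longrightarrow> norm (?c A s) \<le> e / (norm c + 1)"
      using TD[OF A, of "e / (norm c + 1)"] e by (auto simp: add_nonneg_pos)
    have "norm (?c (cscale_op c A) s) \<le> e" if "\<bar>s\<bar> < d" for s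
    proof -
      have "?c (cscale_op c A) s = cscale_op c (?c A s)"
        by (intro blinfun_eqI fock_eqI) (simp add: blinfun.bilinear_simps cscale_op_eq blinfun_cscale[OF weyl_in_ops] algebra_simps)
      then have "norm (?c (cscale_op c A) s) \<le> norm c * norm (?c A s)"
        using norm_cscale_op by simp
      also have "\<dots> \<le> (norm c + 1) * (e / (norm c + 1))"
        using d(2)[OF that] by (intro mult_mono) auto
      also have "\<dots> = e" by (simp add: add_nonneg_eq_0_iff)
      finally show ?thesis .
    qed
    then show "\<exists>d>0. \<forall>s. \<bar>s\<bar> < d \<longrightarrow> norm (?c (cscale_op c A) s) \<le> e"
      using d(1) by blast
  qed
  have comp: "A o\<^sub>L B \<in> ?T" if A: "A \<in> ?T" and B: "B \<in> ?T" for A B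
  proof (rule TI)
    show "A o\<^sub>L B \<in> bounded_clinear_ops" using A B ops by (auto intro: bounded_clinear_ops_compose)
    fix e :: real assume e: "e > 0"
    define K where "K = norm A + norm B + 1"
    have K: "K > 0" "norm A \<le> K" "norm B \<le> K" by (auto simp: K_def add_nonneg_pos)
    obtain d1 where d1: "d1 > 0" "\<And>s. \<bar>s\<bar> < d1 \<Longrightarrow> norm (?c A s) \<le> e / (2 * K)" using TD[OF A, of "e / (2 * K)"] e K by auto
    obtain d2 where d2: "d2 > 0" "\<And>s. \<bar>s\<bar> < d2 \<Longrightarrow> norm (?c B s) \<le> e / (2 * K)" using TD[OF B, of "e / (2 * K)"] e K by auto
    have "norm (?c (A o\<^sub>L B) s) \<le> e" if s: "\<bar>s\<bar> < min d1 d2" for s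
    proof -
      have "?c (A o\<^sub>L B) s = (?c A s o\<^sub>L B) + (A o\<^sub>L ?c B s)"
        by (rule blinfun_eqI) (simp add: blinfun.bilinear_simps)
      also have "norm \<dots> \<le> norm (?c A s) * norm B + norm A * norm (?c B s)"
        by (rule norm_triangle_mono[OF norm_blinfun_compose norm_blinfun_compose])
      also have "\<dots> \<le> e / (2 * K) * K + K * (e / (2 * K))"
        using s d1(2)[of s] d2(2)[of s] K e by (intro add_mono mult_mono) auto
      also have "\<dots> = e" using K by simp
      finally show ?thesis .
    qed
    then show "\<exists>d>0. \<forall>s. \<bar>s\<bar> < d \<longrightarrow> norm (?c (A o\<^sub>L B) s) \<le> e"
      using d1(1) d2(1) by (intro exI[of _ "min d1 d2"]) auto
  qed
  have adj: "hilbert_adjoint A \<in> ?T" if A: "A \<in> ?T" for A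
  proof (rule TI)
    have A': "A \<in> bounded_clinear_ops" using A ops by auto
    show "hilbert_adjoint A \<in> bounded_clinear_ops" by (rule hilbert_adjoint(1)[OF A'])
    have adj': "cinner (blinfun_apply (hilbert_adjoint A) f) g = cinner f (blinfun_apply A g)" for f g
      by (subst (1 2) cinner_commute) (simp add: hilbert_adjoint(3)[OF A'])
    fix e :: real assume e: "e > 0"
    obtain d where d: "d > 0" "\<And>s. \<bar>s\<bar> < d \<Longrightarrow> norm (?c A s) \<le> e" using TD[OF A e] by auto
    have "norm (?c (hilbert_adjoint A) s) \<le> e" if s: "\<bar>s\<bar> < d" for s
    proof (rule norm_blinfun_le_cinner)
      fix f g
      have "cinner (blinfun_apply (?c (hilbert_adjoint A) s) f) g = - cinner f (blinfun_apply (?c A (- s)) g)"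
        by (simp add: blinfun.bilinear_simps cinner_simps cinner_weyl_adjoint adj')
      then have "norm (cinner (blinfun_apply (?c (hilbert_adjoint A) s) f) g) \<le> norm f * norm (blinfun_apply (?c A (- s)) g)"
        using cinner_cauchy_schwarz by (metis norm_minus_cancel)
      also have "\<dots> \<le> norm f * (e * norm g)"
        by (intro mult_left_mono order_trans[OF norm_blinfun] mult_right_mono d(2)) (use s in auto)
      finally show "norm (cinner (blinfun_apply (?c (hilbert_adjoint A) s) f) g) \<le> e * norm f * norm g"
        by (simp add: mult_ac)
    qed (use e in simp)
    then show "\<exists>d>0. \<forall>s. \<bar>s\<bar> < d \<longrightarrow> norm (?c (hilbert_adjoint A) s) \<le> e"
      using d(1) by blast
  qed
  have cl: "closed ?T"
    unfolding closed_sequential_limits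
  proof (intro allI impI, elim conjE)
    fix X A assume X: "\<forall>n. X n \<in> ?T" and lim: "X \<longlonglongrightarrow> A"
    show "A \<in> ?T"
    proof (rule TI)
      show "A \<in> bounded_clinear_ops"
        using closed_bounded_clinear_ops X lim ops unfolding closed_sequential_limits by blast
      fix e :: real assume e: "e > 0"
      obtain n where n: "norm (X n - A) < e / 4"
        using LIMSEQ_D[OF lim, of "e / 4"] e by auto
      obtain d where d: "d > 0" "\<And>s. \<bar>s\<bar> < d \<Longrightarrow> norm (?c (X n) s) \<le> e / 2"
        using TD[of "X n" "e / 2"] X e by auto
      have "norm (?c A s) \<le> e" if s: "\<bar>s\<bar> < d" for s
      proof -
        have "?c A s = ?c (X n) s + (((X n - A) o\<^sub>L ?W s) - (?W s o\<^sub>L (X n - A)))"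
          by (rule blinfun_eqI) (simp add: blinfun.bilinear_simps)
        also have "norm \<dots> \<le> e / 2 + (norm (X n - A) * 1 + 1 * norm (X n - A))"
          by (intro norm_triangle_mono d(2)[OF s] order_trans[OF norm_triangle_ineq4] add_mono
              order_trans[OF norm_blinfun_compose] mult_left_mono mult_right_mono norm_weyl_op) auto
        also have "\<dots> \<le> e" using n by simp
        finally show ?thesis .
      qed
      then show "\<exists>d>0. \<forall>s. \<bar>s\<bar> < d \<longrightarrow> norm (?c A s) \<le> e" using d(1) by blast
    qed
  qed
  show ?thesis
    unfolding cstar_subalgebra_def using ops zero add scale comp adj cl by (auto intro!: V.subspaceI)
qed

lemma toeplitz_translation_continuous:
  assumes f: "ess_bounded f C"
  shows "toeplitz f \<in> translation_continuous_ops"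
proof -
  define \<omega> where "\<omega> s = 2 * C * sqrt (2 * (1 - exp (- (s^2 / 2))))" for s :: real
  have "isCont \<omega> 0" unfolding \<omega>_def by (intro continuous_intros) auto
  then have lim: "\<exists>d>0. \<forall>s. \<bar>s\<bar> < d \<longrightarrow> \<bar>\<omega> s\<bar> < e" if "e > 0" for e
    using that unfolding continuous_at_eps_delta by (auto simp: dist_real_def \<omega>_def)
  show ?thesis
    unfolding translation_continuous_ops_def
  proof (intro CollectI conjI allI impI)
    show "toeplitz f \<in> bounded_clinear_ops" by (rule toeplitz_in_ops[OF f])
    fix e :: real assume "e > 0"
    then obtain d where d: "d > 0" "\<And>s. \<bar>s\<bar> < d \<Longrightarrow> \<bar>\<omega> s\<bar> < e" using lim by blast
    have "norm ((weyl (\<i> * of_real s) o\<^sub>L toeplitz f) - (toeplitz f o\<^sub>L weyl (\<i> * of_real s))) \<le> e" if "\<bar>s\<bar> < d" for s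
      using norm_commutator_weyl_toeplitz[OF f, of "\<i> * of_real s"] d(2)[OF that]
      by (simp add: \<omega>_def norm_mult)
    then show "\<exists>d>0. \<forall>s. \<bar>s\<bar> < d \<longrightarrow>
        norm ((weyl (\<i> * of_real s) o\<^sub>L toeplitz f) - (toeplitz f o\<^sub>L weyl (\<i> * of_real s))) \<le> e"
      using d(1) by blast
  qed
qed

lemma toeplitz_algebra_translation_continuous: "toeplitz_algebra \<subseteq> translation_continuous_ops"
  unfolding toeplitz_algebra_def cstar_generated_def
  using cstar_subalgebra_translation_continuous toeplitz_translation_continuous by (auto elim!: LinftyE)

text \<open>The frequency is halved because the real Weyl translation by a modulates with exp (- 2 i
  a x).\<close>

lemma of_real_cos_eq_modulations:
  "1 / 2 * (exp (- 2 * \<i> * of_real (\<delta> / 2) * of_real x) * z + exp (- 2 * \<i> * of_real (- \<delta> / 2) * of_real x) * z) =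
    of_real (cos (\<delta> * x)) * z"
proof -
  have "complex_of_real (cos (\<delta> * x)) = (exp (\<i> * (of_real \<delta> * of_real x)) + exp (- (\<i> * (of_real \<delta> * of_real x)))) / 2"
    unfolding cos_of_real[symmetric] cos_exp_eq by simp
  then show ?thesis by (simp add: field_simps)
qed

text \<open>exp (- x^2) is a multiple of \<open>bargmann_kernel 0\<close>, and each factor cos
  (\<delta> x) is the mean of two real Weyl translations, which preserve the span of the
  kernels.\<close>

lemma ex_bargmann_rel_cos_power:
  "\<exists>f. bargmann_rel f (\<lambda>x. complex_of_real (exp (- (x^2)) * cos (\<delta> * x) ^ n))"
proof (induction n)
  case 0
  define c where "c = complex_of_real (sqrt (sqrt (2 / pi)))"
  have "c \<noteq> 0" by (simp add: c_def)
  then have "1 / c * bargmann_kernel 0 x = complex_of_real (exp (- (x^2)) * cos (\<delta> * x) ^ 0)" for x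
    by (simp add: bargmann_kernel_def c_def[symmetric] exp_of_real[symmetric])
  then show ?case
    using bargmann_rel_cscale[OF bargmann_rel_kernel[of 0], of "1 / c"] by auto
next
  case (Suc n)
  then obtain f where f: "bargmann_rel f (\<lambda>x. complex_of_real (exp (- (x^2)) * cos (\<delta> * x) ^ n))" by blast
  from bargmann_rel_cscale[OF bargmann_rel_add[OF bargmann_rel_weyl_real[OF f, of "\<delta> / 2"] bargmann_rel_weyl_real[OF f, of "- \<delta> / 2"]], of "1 / 2"]
  show ?case unfolding of_real_cos_eq_modulations by (auto simp: mult_ac)
qed

text \<open>Write M for \<open>mult_op m\<close> and W for the translation by s. As W is unitary, <M
  g, g> = <W M g, W g>, so the increment of the quadratic form from g to W g is a commutator applied
  to g and paired with W g. The shift by t moves the test function anywhere without changing its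
  norm.\<close>

lemma mult_op_translation_estimate:
  assumes m: "ess_bounded m C" and rel: "bargmann_rel f (\<lambda>x. complex_of_real (p x))"
    and \<omega>: "norm ((weyl (\<i> * of_real s) o\<^sub>L mult_op m) - (mult_op m o\<^sub>L weyl (\<i> * of_real s))) \<le> \<omega>"
  shows "norm ((LINT x|lborel. m x * complex_of_real ((p (x + t + s))^2)) - (LINT x|lborel. m x * complex_of_real ((p (x + t))^2)))
    \<le> \<omega> * (LINT x|lborel. (p x)^2)"
proof -
  let ?W = "weyl (\<i> * of_real s)"
  define g where "g = blinfun_apply (weyl (\<i> * of_real t)) f"
  have g: "bargmann_rel g (\<lambda>x. complex_of_real (p (x + t)))"
    unfolding g_def by (rule bargmann_rel_weyl_imaginary[OF rel])
  have Wg: "bargmann_rel (blinfun_apply ?W g) (\<lambda>x. complex_of_real (p (x + t + s)))"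
    using bargmann_rel_weyl_imaginary[OF g, of s] by (simp add: add_ac)
  have 1: "cinner (blinfun_apply (mult_op m) g) g = (LINT x|lborel. m x * complex_of_real ((p (x + t))^2))"
    by (subst cinner_mult_op'[OF m g g]) (simp add: power2_eq_square mult.assoc)
  have 2: "cinner (blinfun_apply (mult_op m) (blinfun_apply ?W g)) (blinfun_apply ?W g) = (LINT x|lborel. m x * complex_of_real ((p (x + t + s))^2))"
    by (subst cinner_mult_op'[OF m Wg Wg]) (simp add: power2_eq_square mult.assoc)
  have "(LINT x|lborel. m x * complex_of_real ((p (x + t + s))^2)) - (LINT x|lborel. m x * complex_of_real ((p (x + t))^2)) =
      cinner (blinfun_apply (mult_op m) (blinfun_apply ?W g)) (blinfun_apply ?W g) -
      cinner (blinfun_apply ?W (blinfun_apply (mult_op m) g)) (blinfun_apply ?W g)"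
    unfolding 1[symmetric] 2[symmetric] cinner_weyl ..
  also have "\<dots> = - cinner (blinfun_apply ((?W o\<^sub>L mult_op m) - (mult_op m o\<^sub>L ?W)) g) (blinfun_apply ?W g)"
    by (simp add: blinfun.bilinear_simps cinner_simps)
  also have "norm \<dots> \<le> norm (blinfun_apply ((?W o\<^sub>L mult_op m) - (mult_op m o\<^sub>L ?W)) g) * norm g"
    using cinner_cauchy_schwarz[of _ "blinfun_apply ?W g"] by (simp only: norm_minus_cancel norm_weyl)
  also have "\<dots> \<le> (\<omega> * norm g) * norm g"
    by (intro mult_right_mono order_trans[OF norm_blinfun] \<omega>) auto
  also have "\<dots> = \<omega> * (norm f)^2"
    by (simp add: g_def power2_eq_square mult.assoc)
  also have "(norm f)^2 = (LINT x|lborel. (p x)^2)"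
    unfolding bargmann_rel_norm[OF rel, symmetric] by simp
  finally show ?thesis .
qed

lemma cos_power_dominated:
  fixes N x :: real
  shows "\<bar>exp (- 2 * x^2) * cos (x * sqrt N / sqrt (real n)) ^ (2 * n)\<bar> \<le> exp (- 2 * x^2)"
proof -
  have "\<bar>cos (x * sqrt N / sqrt (real n))\<bar> ^ (2 * n) \<le> 1"
    by (intro power_le_one) auto
  then show ?thesis by (simp add: abs_mult mult_left_le power_even_abs)
qed

lemma integrable_exp_neg_square: "integrable lborel (\<lambda>x::real. exp (- 2 * x^2))"
proof -
  have "complex_of_real (exp (- 2 * x^2)) = exp (0 * of_real x - of_real (2 * x^2))" for x
    by (simp add: exp_of_real[symmetric])
  then have "integrable lborel (\<lambda>x. complex_of_real (exp (- 2 * x^2)))"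
    using integrable_gaussian[of 2 0] by simp
  then show ?thesis unfolding complex_of_real_integrable_eq .
qed

text \<open>The estimate for p^2 carries the integral of p^2 as a factor. Dividing by it in the
  limit leaves the bound \<omega> for every width, which is the equicontinuity needed later.\<close>

lemma convolve_gauss_density_translation:
  assumes m: "ess_bounded m C" and \<sigma>: "0 < \<sigma>" "\<sigma> \<le> 1 / 2"
    and \<omega>: "norm ((weyl (\<i> * of_real s) o\<^sub>L mult_op m) - (mult_op m o\<^sub>L weyl (\<i> * of_real s))) \<le> \<omega>"
  shows "norm (convolve (gauss_density \<sigma>) m (t - s) - convolve (gauss_density \<sigma>) m t) \<le> \<omega>"
proof -
  define N where "N = 1 / (2 * \<sigma>^2) - 2"
  have "\<sigma>^2 \<le> (1 / 2)^2" using \<sigma> by (intro power_mono) auto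
  then have N: "N \<ge> 0" using \<sigma> by (simp add: N_def field_simps power2_eq_square)
  define c where "c = sqrt (2 * pi * \<sigma>^2)"
  have c: "c > 0" using \<sigma> by (simp add: c_def)
  define G where "G x = exp (- 2 * x^2) * exp (- ((x * sqrt N)^2))" for x
  have gd: "gauss_density \<sigma> x = of_real (G x / c)" for x
    unfolding gauss_density_eq_exp[OF \<sigma>(1) N_def N] G_def c_def by simp
  define q where "q n x = exp (- 2 * x^2) * cos (x * sqrt N / sqrt (real n)) ^ (2 * n)" for n x
  have q_lim: "(\<lambda>n. q n x) \<longlonglongrightarrow> G x" for x
    unfolding q_def G_def by (intro tendsto_mult tendsto_const cos_power_tendsto_gaussian)
  have q_dom: "\<bar>q n x\<bar> \<le> exp (- 2 * x^2)" for n x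
    unfolding q_def by (rule cos_power_dominated)
  have [measurable]: "q n \<in> borel_measurable borel" "G \<in> borel_measurable borel" for n
    unfolding q_def G_def by measurable
  have [measurable]: "m \<in> borel_measurable borel" using m by (simp add: ess_bounded_def)
  have lim1: "(\<lambda>n. LINT x|lborel. m x * complex_of_real (q n (x + a))) \<longlonglongrightarrow> (LINT x|lborel. m x * complex_of_real (G (x + a)))" for a
  proof (rule integral_dominated_convergence[where w = "\<lambda>x. C * exp (- 2 * (x + a)^2)"])
    have "integrable lborel (\<lambda>x. exp (- 2 * (a + 1 * x)^2))"
      using integrable_exp_neg_square by (subst lborel_integrable_real_affine_iff) auto
    then show "integrable lborel (\<lambda>x. C * exp (- 2 * (x + a)^2))" by (simp add: add.commute)
    show "AE x in lborel. (\<lambda>n. m x * complex_of_real (q n (x + a))) \<longlonglongrightarrow> m x * complex_of_real (G (x + a))"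
      by (intro AE_I2 tendsto_intros q_lim)
    have "AE x in lborel. norm (m x) \<le> C" using m by (simp add: ess_bounded_def)
    then show "AE x in lborel. norm (m x * complex_of_real (q n (x + a))) \<le> C * exp (- 2 * (x + a)^2)" for n
    proof eventually_elim
      case (elim x)
      show ?case
        unfolding norm_mult norm_of_real using m elim
        by (intro mult_mono q_dom) (auto simp: ess_bounded_def)
    qed
  qed simp_all
  have lim2: "(\<lambda>n. LINT x|lborel. q n x) \<longlonglongrightarrow> (LINT x|lborel. G x)"
    by (rule integral_dominated_convergence[where w = "\<lambda>x. exp (- 2 * x^2)"])
      (use q_dom q_lim integrable_exp_neg_square in auto)
  have est: "norm ((LINT x|lborel. m x * complex_of_real (q n (x + (- t + s)))) - (LINT x|lborel. m x * complex_of_real (q n (x + - t))))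
      \<le> \<omega> * (LINT x|lborel. q n x)" for n
  proof -
    \<comment> \<open>The square of p is \<open>q n\<close>: squaring doubles the Gaussian exponent
      to - 2 x^2 and the power of the cosine to 2 n.\<close>
    define p where "p x = exp (- (x^2)) * cos (sqrt N / sqrt (real n) * x) ^ n" for x
    obtain f where "bargmann_rel f (\<lambda>x. complex_of_real (p x))"
      using ex_bargmann_rel_cos_power[of "sqrt N / sqrt (real n)" n] unfolding p_def by blast
    from mult_op_translation_estimate[OF m this \<omega>, of "- t"]
    have *: "norm ((LINT x|lborel. m x * complex_of_real ((p (x + - t + s))^2)) - (LINT x|lborel. m x * complex_of_real ((p (x + - t))^2)))
      \<le> \<omega> * (LINT x|lborel. (p x)^2)" .
    have pq: "(p x)^2 = q n x" for x
      by (simp add: p_def q_def power_mult_distrib exp_double[symmetric] power_mult[symmetric] mult_ac)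
    show ?thesis using * unfolding pq by (simp only: add.assoc)
  qed
  have le: "norm ((LINT x|lborel. m x * complex_of_real (G (x + (- t + s)))) - (LINT x|lborel. m x * complex_of_real (G (x + - t))))
      \<le> \<omega> * (LINT x|lborel. G x)"
    by (rule LIMSEQ_le[OF tendsto_norm[OF tendsto_diff[OF lim1 lim1]] tendsto_mult[OF tendsto_const lim2]])
       (use est in blast)
  have conv: "(LINT x|lborel. m x * complex_of_real (G (x + - a))) = of_real c * convolve (gauss_density \<sigma>) m a" for a
  proof -
    have "G (x + - a) = G (a - x)" for x
      by (simp add: G_def power_mult_distrib power2_commute[of x a])
    then have eq: "m x * complex_of_real (G (x + - a)) = of_real c * (gauss_density \<sigma> (a - x) * m x)" for x
      using c by (simp add: gd)
    show ?thesis unfolding eq convolve_def integral_mult_right_zero ..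
  qed
  have Gc: "(LINT x|lborel. G x) = c"
  proof -
    have "norm (gauss_density \<sigma> x) = G x / c" for x
      unfolding gd norm_of_real using c by (simp add: G_def)
    then show ?thesis using norm_integral_gauss_density[OF \<sigma>(1)] c by simp
  qed
  \<comment> \<open>The convolution at a tests m against G (x - a), so the shift of the test
    function by + s leads to the point t - s.\<close>
  have ts: "- t + s = - (t - s)" by simp
  from le have "norm (of_real c * convolve (gauss_density \<sigma>) m (t - s) - of_real c * convolve (gauss_density \<sigma>) m t) \<le> \<omega> * c"
    unfolding ts Gc conv .
  then have "c * norm (convolve (gauss_density \<sigma>) m (t - s) - convolve (gauss_density \<sigma>) m t) \<le> c * \<omega>"
    unfolding right_diff_distrib[symmetric] norm_mult using c by (simp add: mult.commute)
  then show ?thesis using c by simp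
qed

lemma ess_boundedI: "m \<in> borel_measurable borel \<Longrightarrow> (\<And>x. norm (m x) \<le> C) \<Longrightarrow> ess_bounded m C"
  using order_trans[OF norm_ge_zero] by (auto simp: ess_bounded_def)

lemma eventually_variance_small:
  fixes c d e :: real
  assumes "e > 0"
  shows "\<exists>N. \<forall>n\<ge>N. c * (1 / real (n + 2))^2 / d^2 < e"
proof -
  have "(\<lambda>n. 1 / real (n + 2)) \<longlonglongrightarrow> 0" by real_asymp
  then have "(\<lambda>n. c / d^2 * (1 / real (n + 2))^2) \<longlonglongrightarrow> c / d^2 * 0^2"
    by (intro tendsto_mult tendsto_const tendsto_power)
  then have "(\<lambda>n. c / d^2 * (1 / real (n + 2))^2) \<longlonglongrightarrow> 0"
    by (simp only: power2_eq_square mult_zero_right)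
  then have "\<forall>\<^sub>F n in sequentially. c / d^2 * (1 / real (n + 2))^2 < e"
    using assms by (rule order_tendstoD(2))
  then show ?thesis
    unfolding eventually_sequentially by (simp only: times_divide_eq_left)
qed

text \<open>M \<sigma> is the Gaussian mean of m of width \<sigma>. Smoothing M \<sigma> with width
  \<tau> changes it little by equicontinuity and gives the same function as smoothing M \<tau> with
  width \<sigma>; hence the means are uniformly Cauchy as the widths shrink. Their limit b inherits
  the common modulus of continuity and is compared with m after convolution with
  \<open>gauss\<close>.\<close>

lemma translation_continuous_mult_op_BUC:
  assumes [measurable]: "m \<in> borel_measurable borel" and bound: "\<And>x. norm (m x) \<le> C"
    and A: "mult_op m \<in> translation_continuous_ops"
  shows "\<exists>b\<in>BUC. AE x in lborel. m x = b x"
proof -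
  have m: "ess_bounded m C" by (rule ess_boundedI) (simp_all add: bound)
  then have C: "C \<ge> 0" by (simp add: ess_bounded_def)
  define M where "M \<sigma> = convolve (gauss_density \<sigma>) m" for \<sigma>
  have bM: "norm (M \<sigma> t) \<le> C" if "\<sigma> > 0" for \<sigma> t
    using norm_convolve[OF integrable_gauss_density[OF that] m, of t] by (simp add: M_def norm_integral_gauss_density[OF that])
  have mM[measurable]: "M \<sigma> \<in> borel_measurable borel" if "\<sigma> > 0" for \<sigma>
    using ess_bounded_convolve[OF integrable_gauss_density[OF that] m] by (simp add: M_def ess_bounded_def)
  have equi: "\<exists>d>0. \<forall>\<sigma> t s. 0 < \<sigma> \<longrightarrow> \<sigma> \<le> 1 / 2 \<longrightarrow> \<bar>s\<bar> < d \<longrightarrow> norm (M \<sigma> (t + s) - M \<sigma> t) \<le> e" if e: "e > 0" for e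
  proof -
    obtain d where d: "d > 0" "\<And>s. \<bar>s\<bar> < d \<Longrightarrow>
        norm ((weyl (\<i> * of_real s) o\<^sub>L mult_op m) - (mult_op m o\<^sub>L weyl (\<i> * of_real s))) \<le> e"
      using translation_continuous_opsD[OF A e] by blast
    have "norm (M \<sigma> (t + s) - M \<sigma> t) \<le> e" if "0 < \<sigma>" "\<sigma> \<le> 1 / 2" "\<bar>s\<bar> < d" for \<sigma> t s
      using convolve_gauss_density_translation[OF m that(1,2) d(2)[of "- s"], of t] that(3) by (simp add: M_def)
    then show ?thesis using d(1) by blast
  qed
  have approx: "norm (convolve (gauss_density \<tau>) (M \<sigma>) t - M \<sigma> t) \<le> e + 2 * C * \<tau>^2 / d^2"
    if "\<tau> > 0" "0 < \<sigma>" "\<sigma> \<le> 1 / 2" "d > 0"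
      "\<forall>\<sigma> t s. 0 < \<sigma> \<longrightarrow> \<sigma> \<le> 1 / 2 \<longrightarrow> \<bar>s\<bar> < d \<longrightarrow> norm (M \<sigma> (t + s) - M \<sigma> t) \<le> e" for \<tau> \<sigma> t e d
    by (rule convolve_gauss_density_approx[OF mM bM]) (use that in auto)
  have swap: "convolve (gauss_density \<tau>) (M \<sigma>) = convolve (gauss_density \<sigma>) (M \<tau>)" if "\<tau> > 0" "\<sigma> > 0" for \<tau> \<sigma>
    unfolding M_def by (rule convolve_commute[OF integrable_gauss_density[OF that(1)] integrable_gauss_density[OF that(2)] _ bound]) simp
  \<comment> \<open>Starting at 1 / 2 keeps every width in the range of \<open>equi\<close>.\<close>
  define \<sigma> where "\<sigma> n = 1 / real (n + 2)" for n
  have \<sigma>: "\<sigma> n > 0" "\<sigma> n \<le> 1 / 2" for n by (auto simp: \<sigma>_def field_simps)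
  have small: "\<exists>N. \<forall>n\<ge>N. 2 * C * (\<sigma> n)^2 / d^2 < e" if "e > 0" for d e
    unfolding \<sigma>_def using that by (rule eventually_variance_small)
  have "uniformly_Cauchy_on UNIV (\<lambda>n. M (\<sigma> n))"
  proof (rule uniformly_Cauchy_onI)
    fix e :: real assume e: "e > 0"
    obtain d where d: "d > 0" "\<forall>\<sigma> t s. 0 < \<sigma> \<longrightarrow> \<sigma> \<le> 1 / 2 \<longrightarrow> \<bar>s\<bar> < d \<longrightarrow> norm (M \<sigma> (t + s) - M \<sigma> t) \<le> e / 5"
      using equi[of "e / 5"] e by auto
    obtain N where N: "\<And>n. n \<ge> N \<Longrightarrow> 2 * C * (\<sigma> n)^2 / d^2 < e / 5"
      using small[of "e / 5" d] e by auto
    show "\<exists>N. \<forall>t\<in>UNIV. \<forall>k\<ge>N. \<forall>n\<ge>N. dist (M (\<sigma> k) t) (M (\<sigma> n) t) < e"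
    proof (intro exI ballI allI impI)
      fix t k n assume kn: "N \<le> k" "N \<le> n"
      \<comment> \<open>By \<open>swap\<close> both lines concern the same smoothed function. It is
        within 2 e / 5 of either mean, so the means differ by at most 4 e / 5.\<close>
      have "norm (convolve (gauss_density (\<sigma> n)) (M (\<sigma> k)) t - M (\<sigma> k) t) \<le> e / 5 + 2 * C * (\<sigma> n)^2 / d^2"
        "norm (convolve (gauss_density (\<sigma> k)) (M (\<sigma> n)) t - M (\<sigma> n) t) \<le> e / 5 + 2 * C * (\<sigma> k)^2 / d^2"
        using d by (auto intro!: approx \<sigma>)
      then have "norm (convolve (gauss_density (\<sigma> n)) (M (\<sigma> k)) t - M (\<sigma> k) t) \<le> 2 * (e / 5)"
        "norm (convolve (gauss_density (\<sigma> n)) (M (\<sigma> k)) t - M (\<sigma> n) t) \<le> 2 * (e / 5)"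
        using N[OF kn(1)] N[OF kn(2)] unfolding swap[OF \<sigma>(1) \<sigma>(1), of n k] by linarith+
      then have "dist (M (\<sigma> k) t) (M (\<sigma> n) t) \<le> 2 * (e / 5) + 2 * (e / 5)"
        by (intro order_trans[OF dist_triangle2[of _ _ "convolve (gauss_density (\<sigma> n)) (M (\<sigma> k)) t"]] add_mono)
           (simp_all add: dist_norm norm_minus_commute)
      then show "dist (M (\<sigma> k) t) (M (\<sigma> n) t) < e" using e by simp
    qed
  qed
  then obtain b where b: "uniform_limit UNIV (\<lambda>n. M (\<sigma> n)) b sequentially"
    using Cauchy_uniformly_convergent by (auto simp: uniformly_convergent_on_def)
  have lim: "(\<lambda>n. M (\<sigma> n) t) \<longlonglongrightarrow> b t" for t
    by (rule tendsto_uniform_limitI[OF b]) simp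
  have bb: "norm (b t) \<le> C" for t
    by (rule LIMSEQ_le_const2[OF tendsto_norm[OF lim]]) (use bM \<sigma> in blast)
  have uc: "uniformly_continuous_on UNIV b"
    unfolding uniformly_continuous_on_def
  proof (intro allI impI)
    fix e :: real assume e: "e > 0"
    obtain d where d: "d > 0" "\<forall>\<sigma> t s. 0 < \<sigma> \<longrightarrow> \<sigma> \<le> 1 / 2 \<longrightarrow> \<bar>s\<bar> < d \<longrightarrow> norm (M \<sigma> (t + s) - M \<sigma> t) \<le> e / 2"
      using equi[of "e / 2"] e by auto
    have "dist (b x') (b x) < e" if "dist x' x < d" for x x'
    proof -
      have "norm (M (\<sigma> n) (x + (x' - x)) - M (\<sigma> n) x) \<le> e / 2" for n
        using d(2)[rule_format, OF \<sigma>, of "x' - x" n x] that by (simp add: dist_real_def)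
      then have le: "norm (M (\<sigma> n) x' - M (\<sigma> n) x) \<le> e / 2" for n by simp
      have "norm (b x' - b x) \<le> e / 2"
        by (rule LIMSEQ_le_const2[OF tendsto_norm[OF tendsto_diff[OF lim lim]]]) (use le in blast)
      then show ?thesis using e by (simp add: dist_norm)
    qed
    then show "\<exists>d>0. \<forall>x\<in>UNIV. \<forall>x'\<in>UNIV. dist x' x < d \<longrightarrow> dist (b x') (b x) < e"
      using d(1) by blast
  qed
  then have mb[measurable]: "b \<in> borel_measurable borel"
    by (intro borel_measurable_continuous_onI uniformly_continuous_imp_continuous)
  have b_ess: "ess_bounded b C" by (rule ess_boundedI) (simp_all add: bb)
  have "b \<in> BUC" unfolding BUC_def using uc bb by (auto intro!: boundedI)
  \<comment> \<open>Both sides are limits of \<open>convolve gauss (M (\<sigma> n)) t\<close>: one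
    by uniform convergence, the other by exchanging the convolutions, since
    \<open>convolve gauss m\<close> is the member \<open>M (1 / 2)\<close> of the equicontinuous
    family.\<close>
  have "convolve gauss b t = convolve gauss m t" for t
  proof (rule LIMSEQ_unique)
    show "(\<lambda>n. convolve gauss (M (\<sigma> n)) t) \<longlonglongrightarrow> convolve gauss b t"
    proof (rule LIMSEQ_I)
      fix e :: real assume e: "e > 0"
      have "\<forall>\<^sub>F n in sequentially. \<forall>x\<in>UNIV. dist (M (\<sigma> n) x) (b x) < e / 2"
        using uniform_limitD[OF b, of "e / 2"] e by simp
      then obtain N where N: "\<And>n x. n \<ge> N \<Longrightarrow> norm (M (\<sigma> n) x - b x) < e / 2"
        by (auto simp: eventually_sequentially dist_norm)
      have "norm (convolve gauss (M (\<sigma> n)) t - convolve gauss b t) < e" if "n \<ge> N" for n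
      proof -
        have Mn: "ess_bounded (M (\<sigma> n)) C" by (rule ess_boundedI) (simp_all add: bM \<sigma> mM)
        have db: "ess_bounded (\<lambda>x. M (\<sigma> n) x - b x) (e / 2)"
        proof (rule ess_boundedI)
          show "(\<lambda>x. M (\<sigma> n) x - b x) \<in> borel_measurable borel"
            using mM[OF \<sigma>(1), of n] by measurable
        qed (use N[OF that] in \<open>auto intro: less_imp_le\<close>)
        have "convolve gauss (M (\<sigma> n)) t - convolve gauss b t = convolve gauss (\<lambda>x. M (\<sigma> n) x - b x) t"
          unfolding convolve_def right_diff_distrib
          by (rule Bochner_Integration.integral_diff[OF integrable_convolve[OF integrable_gauss Mn] integrable_convolve[OF integrable_gauss b_ess], symmetric])
        also have "norm \<dots> \<le> e / 2"
          using norm_convolve[OF integrable_gauss db, of t] unfolding gauss_eq by (simp add: norm_integral_gauss_density)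
        finally show ?thesis using e by simp
      qed
      then show "\<exists>N. \<forall>n\<ge>N. norm (convolve gauss (M (\<sigma> n)) t - convolve gauss b t) < e" by blast
    qed
    have eq: "convolve gauss (M (\<sigma> n)) t = convolve (gauss_density (\<sigma> n)) (M (1 / 2)) t" for n
      unfolding gauss_eq by (subst swap) (simp_all add: \<sigma>)
    have gm: "convolve gauss m t = M (1 / 2) t" by (simp add: M_def gauss_eq)
    show "(\<lambda>n. convolve gauss (M (\<sigma> n)) t) \<longlonglongrightarrow> convolve gauss m t"
      unfolding eq gm
    proof (rule LIMSEQ_I)
      fix e :: real assume e: "e > 0"
      obtain d where d: "d > 0" "\<forall>\<sigma> t s. 0 < \<sigma> \<longrightarrow> \<sigma> \<le> 1 / 2 \<longrightarrow> \<bar>s\<bar> < d \<longrightarrow> norm (M \<sigma> (t + s) - M \<sigma> t) \<le> e / 2"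
        using equi[of "e / 2"] e by auto
      obtain N where N: "\<And>n. n \<ge> N \<Longrightarrow> 2 * C * (\<sigma> n)^2 / d^2 < e / 2"
        using small[of "e / 2" d] e by auto
      have "norm (convolve (gauss_density (\<sigma> n)) (M (1 / 2)) t - M (1 / 2) t) < e" if "n \<ge> N" for n
        using approx[of "\<sigma> n" "1 / 2" d "e / 2" t] N[OF that] d \<sigma>[of n] by auto
      then show "\<exists>N. \<forall>n\<ge>N. norm (convolve (gauss_density (\<sigma> n)) (M (1 / 2)) t - M (1 / 2) t) < e" by blast
    qed
  qed
  \<comment> \<open>Injectivity of the convolution with \<open>gauss\<close>: read as Toeplitz
    operators, equal convolutions have symbols that agree almost everywhere.\<close>
  then have "mult_op (convolve gauss b) = mult_op (convolve gauss m)" by presburger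
  then have "AE x in lborel. b (- x) = m (- x)"
    unfolding mult_op_convolve_gauss[OF b_ess] mult_op_convolve_gauss[OF m]
    by (rule toeplitz_Im_injective[OF ess_bounded_uminus_arg[OF b_ess] ess_bounded_uminus_arg[OF m]])
  then have "AE x in distr lborel borel uminus. m x = b x"
    by (subst AE_distr_iff) (auto elim: eventually_mono)
  then have "AE x in lborel. m x = b x" unfolding lborel_distr_uminus .
  with \<open>b \<in> BUC\<close> show ?thesis by blast
qed

subsection \<open>Membership in the Toeplitz algebra\<close>

lemma toeplitz_algebraI:
  "(\<And>\<A>. cstar_subalgebra \<A> \<Longrightarrow> toeplitz ` Linfty \<subseteq> \<A> \<Longrightarrow> A \<in> \<A>) \<Longrightarrow> A \<in> toeplitz_algebra"
  by (auto simp: toeplitz_algebra_def cstar_generated_def)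

lemma toeplitz_algebraD:
  "A \<in> toeplitz_algebra \<Longrightarrow> cstar_subalgebra \<A> \<Longrightarrow> toeplitz ` Linfty \<subseteq> \<A> \<Longrightarrow> A \<in> \<A>"
  by (auto simp: toeplitz_algebra_def cstar_generated_def)

lemma toeplitz_in_algebra: "ess_bounded f C \<Longrightarrow> toeplitz f \<in> toeplitz_algebra"
proof (rule toeplitz_algebraI)
  fix \<A> assume f: "ess_bounded f C" and A: "toeplitz ` Linfty \<subseteq> \<A>"
  from f have "f \<in> Linfty" unfolding Linfty_iff by blast
  with A show "toeplitz f \<in> \<A>" by blast
qed

lemma toeplitz_algebra_closed_under:
  shows toeplitz_algebra_add: "A \<in> toeplitz_algebra \<Longrightarrow> B \<in> toeplitz_algebra \<Longrightarrow> A + B \<in> toeplitz_algebra"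
    and toeplitz_algebra_cscale_op: "A \<in> toeplitz_algebra \<Longrightarrow> cscale_op c A \<in> toeplitz_algebra"
    and toeplitz_algebra_compose: "A \<in> toeplitz_algebra \<Longrightarrow> B \<in> toeplitz_algebra \<Longrightarrow> A o\<^sub>L B \<in> toeplitz_algebra"
proof -
  interpret V: vector_space cscale_op by (rule vector_space_cscale_op)
  show "A + B \<in> toeplitz_algebra" if "A \<in> toeplitz_algebra" "B \<in> toeplitz_algebra"
    by (rule toeplitz_algebraI) (use toeplitz_algebraD[OF that(1)] toeplitz_algebraD[OF that(2)] in \<open>auto simp: cstar_subalgebra_def V.subspace_def\<close>)
  show "cscale_op c A \<in> toeplitz_algebra" if "A \<in> toeplitz_algebra"
    by (rule toeplitz_algebraI) (use toeplitz_algebraD[OF that(1)] in \<open>auto simp: cstar_subalgebra_def V.subspace_def\<close>)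
  show "A o\<^sub>L B \<in> toeplitz_algebra" if "A \<in> toeplitz_algebra" "B \<in> toeplitz_algebra"
    by (rule toeplitz_algebraI) (use toeplitz_algebraD[OF that(1)] toeplitz_algebraD[OF that(2)] in \<open>auto simp: cstar_subalgebra_def\<close>)
qed

lemma closed_toeplitz_algebra: "closed toeplitz_algebra"
  unfolding toeplitz_algebra_def cstar_generated_def
  by (intro closed_Inter) (auto simp: cstar_subalgebra_def)

lemma toeplitz_algebra_limit:
  assumes X: "\<And>n. X n \<in> toeplitz_algebra" and r: "r \<longlonglongrightarrow> 0" and le: "\<And>n::nat. norm (X n - A) \<le> r n"
  shows "A \<in> toeplitz_algebra"
proof -
  have "(\<lambda>n. X n - A) \<longlonglongrightarrow> 0"
    by (rule Lim_null_comparison[OF _ r]) (simp add: le)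
  then have "X \<longlonglongrightarrow> A" by (rule LIM_zero_cancel)
  then show ?thesis
    using closed_toeplitz_algebra X unfolding closed_sequential_limits by blast
qed

text \<open>All bounded m are taken at once, because modulating the kernel also modulates m.\<close>

definition convolutor :: "(real \<Rightarrow> complex) \<Rightarrow> bool" where
  "convolutor k \<longleftrightarrow> integrable lborel k \<and> (\<forall>m C. ess_bounded m C \<longrightarrow> mult_op (convolve k m) \<in> toeplitz_algebra)"

lemma convolutor_gauss: "convolutor gauss"
  unfolding convolutor_def
proof (intro conjI allI impI integrable_gauss)
  fix m :: "real \<Rightarrow> complex" and C assume m: "ess_bounded m C"
  show "mult_op (convolve gauss m) \<in> toeplitz_algebra"
    unfolding mult_op_convolve_gauss[OF m]
    by (rule toeplitz_in_algebra[OF ess_bounded_Im[OF ess_bounded_uminus_arg[OF m]]])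
qed

lemma convolutor_add:
  assumes "convolutor k" "convolutor l"
  shows "convolutor (\<lambda>x. k x + l x)"
  unfolding convolutor_def
proof (intro conjI allI impI)
  have k: "integrable lborel k" and l: "integrable lborel l" using assms by (auto simp: convolutor_def)
  show "integrable lborel (\<lambda>x. k x + l x)" using k l by simp
  fix m :: "real \<Rightarrow> complex" and C assume m: "ess_bounded m C"
  have "convolve (\<lambda>x. k x + l x) m = (\<lambda>x. convolve k m x + convolve l m x)"
    unfolding convolve_def[abs_def] distrib_right
    by (rule ext) (rule Bochner_Integration.integral_add[OF integrable_convolve[OF k m] integrable_convolve[OF l m]])
  then have "mult_op (convolve (\<lambda>x. k x + l x) m) = mult_op (convolve k m) + mult_op (convolve l m)"
    using mult_op_add[OF ess_bounded_convolve[OF k m] ess_bounded_convolve[OF l m]] by simp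
  then show "mult_op (convolve (\<lambda>x. k x + l x) m) \<in> toeplitz_algebra"
    using assms m by (auto simp: convolutor_def intro: toeplitz_algebra_add)
qed

lemma convolutor_cmult:
  assumes "convolutor k"
  shows "convolutor (\<lambda>x. c * k x)"
  unfolding convolutor_def
proof (intro conjI allI impI)
  have k: "integrable lborel k" using assms by (auto simp: convolutor_def)
  show "integrable lborel (\<lambda>x. c * k x)" using k by simp
  fix m :: "real \<Rightarrow> complex" and C assume m: "ess_bounded m C"
  have "convolve (\<lambda>x. c * k x) m = (\<lambda>x. c * convolve k m x)"
    unfolding convolve_def[abs_def] mult.assoc by simp
  then have "mult_op (convolve (\<lambda>x. c * k x) m) = cscale_op c (mult_op (convolve k m))"
    using mult_op_cmult[OF ess_bounded_convolve[OF k m]] by simp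
  then show "mult_op (convolve (\<lambda>x. c * k x) m) \<in> toeplitz_algebra"
    using assms m by (auto simp: convolutor_def intro: toeplitz_algebra_cscale_op)
qed

text \<open>Modulating the kernel amounts to modulating the argument and the result of the convolution,
  and modulation of a multiplier is composition with a Weyl operator.\<close>

lemma convolutor_modulate:
  assumes "convolutor k"
  shows "convolutor (\<lambda>x. exp (- 2 * \<i> * of_real a * of_real x) * k x)"
  unfolding convolutor_def
proof (intro conjI allI impI)
  let ?e = "\<lambda>a x. exp (- 2 * \<i> * complex_of_real a * complex_of_real x)"
  have eb: "ess_bounded (?e a) 1" for a
    by (rule ess_boundedI) (auto intro!: borel_measurable_continuous_onI continuous_intros)
  have k: "integrable lborel k" using assms by (auto simp: convolutor_def)
  show "integrable lborel (\<lambda>x. ?e a x * k x)"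
    by (rule integrable_ess_bounded_mult[OF eb k])
  fix m :: "real \<Rightarrow> complex" and C assume m: "ess_bounded m C"
  have em: "ess_bounded (\<lambda>x. ?e (- a) x * m x) (1 * C)" by (rule ess_bounded_mult[OF eb m])
  have "?e a (x - y) * k (x - y) * m y = ?e a x * (k (x - y) * (?e (- a) y * m y))" for x y
  proof -
    have "?e a (x - y) = ?e a x * ?e (- a) y"
      by (simp add: exp_add[symmetric] algebra_simps)
    then show ?thesis by simp
  qed
  then have "convolve (\<lambda>x. ?e a x * k x) m = (\<lambda>x. ?e a x * convolve k (\<lambda>y. ?e (- a) y * m y) x)"
    unfolding convolve_def[abs_def] by (simp only: integral_mult_right_zero)
  then have "mult_op (convolve (\<lambda>x. ?e a x * k x) m) = mult_op (convolve k (\<lambda>y. ?e (- a) y * m y)) o\<^sub>L weyl (of_real a)"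
    using mult_op_compose_weyl_real[OF ess_bounded_convolve[OF k em], of a] by simp
  moreover have "weyl (of_real a) \<in> toeplitz_algebra"
    unfolding weyl_def by (intro toeplitz_algebra_cscale_op toeplitz_in_algebra[OF ess_bounded_weyl_symbol])
  moreover have "mult_op (convolve k (\<lambda>y. ?e (- a) y * m y)) \<in> toeplitz_algebra"
    using assms em by (auto simp: convolutor_def)
  ultimately show "mult_op (convolve (\<lambda>x. ?e a x * k x) m) \<in> toeplitz_algebra"
    by (simp add: toeplitz_algebra_compose)
qed

lemma convolutor_cos:
  assumes "convolutor k"
  shows "convolutor (\<lambda>x. of_real (cos (\<delta> * x)) * k x)"
  using convolutor_cmult[OF convolutor_add[OF convolutor_modulate[OF assms, of "\<delta> / 2"] convolutor_modulate[OF assms, of "- \<delta> / 2"]], of "1 / 2"]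
  unfolding of_real_cos_eq_modulations .

lemma convolutor_cos_power: "convolutor (\<lambda>x. of_real (cos (\<delta> * x)) ^ n * gauss x)"
proof (induction n)
  case (Suc n)
  from convolutor_cos[OF this, of \<delta>] show ?case by (simp add: mult.assoc)
qed (simp add: convolutor_gauss)

text \<open>The sup norm of a convolution is at most the L^1 norm of the kernel times the bound of
  m, and it bounds the norm of the multiplication operator. So L^1 convergence of kernels becomes
  norm convergence of operators.\<close>

lemma convolutor_limit:
  assumes X: "\<And>n::nat. convolutor (X n)" and k: "integrable lborel k"
    and lim: "(\<lambda>n. LINT x|lborel. norm (X n x - k x)) \<longlonglongrightarrow> 0"
  shows "convolutor k"
  unfolding convolutor_def
proof (intro conjI allI impI)
  fix m :: "real \<Rightarrow> complex" and C assume m: "ess_bounded m C"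
  have Xi: "integrable lborel (X n)" for n using X by (auto simp: convolutor_def)
  show "mult_op (convolve k m) \<in> toeplitz_algebra"
  proof (rule toeplitz_algebra_limit)
    show "mult_op (convolve (X n) m) \<in> toeplitz_algebra" for n
      using X m by (auto simp: convolutor_def)
    show "(\<lambda>n. (LINT x|lborel. norm (X n x - k x)) * C) \<longlonglongrightarrow> 0"
      using tendsto_mult_right[OF lim, of C] by simp
    show "norm (mult_op (convolve (X n) m) - mult_op (convolve k m)) \<le> (LINT x|lborel. norm (X n x - k x)) * C" for n
      unfolding mult_op_diff[OF ess_bounded_convolve[OF Xi m] ess_bounded_convolve[OF k m], symmetric]
      by (rule norm_mult_op[OF convolve_diff_bound[OF Xi k m]])
  qed
qed (rule k)

text \<open>\<open>gauss\<close> times cosine powers converges in L^1 to a multiple of the narrow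
  Gaussian, by dominated convergence with a multiple of exp (- 2 x^2) as majorant.\<close>

lemma convolutor_gauss_density:
  assumes \<sigma>: "0 < \<sigma>" "\<sigma> \<le> 1 / 2"
  shows "convolutor (gauss_density \<sigma>)"
proof -
  define N where "N = 1 / (2 * \<sigma>^2) - 2"
  have "\<sigma>^2 \<le> (1 / 2)^2" using \<sigma> by (intro power_mono) auto
  then have N: "N \<ge> 0" using \<sigma> by (simp add: N_def field_simps power2_eq_square)
  define c where "c = 1 / sqrt (2 * pi * \<sigma>^2)"
  define g where "g = sqrt (2 / pi)"
  have g: "g \<noteq> 0" by (simp add: g_def)
  define q where "q n x = exp (- 2 * x^2) * cos (x * sqrt N / sqrt (real n)) ^ (2 * n)" for n x
  define G where "G x = exp (- 2 * x^2) * exp (- ((x * sqrt N)^2))" for x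
  have gd: "gauss_density \<sigma> x = of_real (c * G x)" for x
    unfolding gauss_density_eq_exp[OF \<sigma>(1) N_def N] c_def G_def ..
  have q_lim: "(\<lambda>n. q n x) \<longlonglongrightarrow> G x" for x
    unfolding q_def G_def by (intro tendsto_mult tendsto_const cos_power_tendsto_gaussian)
  have q_dom: "\<bar>q n x\<bar> \<le> exp (- 2 * x^2)" for n x
    unfolding q_def by (rule cos_power_dominated)
  have G_dom: "\<bar>G x\<bar> \<le> exp (- 2 * x^2)" for x
    by (simp add: G_def abs_mult mult_left_le)
  have [measurable]: "q n \<in> borel_measurable borel" "G \<in> borel_measurable borel" for n
    unfolding q_def G_def by measurable
  show ?thesis
  proof (rule convolutor_limit)
    \<comment> \<open>The factor c / g exchanges the normalising constant of \<open>gauss\<close>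
      for that of \<open>gauss_density \<sigma>\<close>; the frequency sqrt N / sqrt n corresponds
      to y = x sqrt N in \<open>cos_power_tendsto_gaussian\<close>.\<close>
    show "convolutor (\<lambda>x. of_real (c / g) * (of_real (cos (sqrt N / sqrt (real n) * x)) ^ (2 * n) * gauss x))" for n
      by (rule convolutor_cmult[OF convolutor_cos_power])
    show "integrable lborel (gauss_density \<sigma>)" by (rule integrable_gauss_density[OF \<sigma>(1)])
    have eq: "norm (of_real (c / g) * (of_real (cos (sqrt N / sqrt (real n) * x)) ^ (2 * n) * gauss x) - gauss_density \<sigma> x) =
        \<bar>c\<bar> * \<bar>q n x - G x\<bar>" for n x
    proof -
      have "complex_of_real (c / g) * (of_real (cos (sqrt N / sqrt (real n) * x)) ^ (2 * n) * gauss x) - gauss_density \<sigma> x =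
          of_real (c * (q n x - G x))"
        using g by (simp add: gauss_def g_def[symmetric] gd q_def right_diff_distrib mult_ac)
      then show ?thesis by (simp only: norm_of_real abs_mult)
    qed
    have "(\<lambda>n. LINT x|lborel. \<bar>c\<bar> * \<bar>q n x - G x\<bar>) \<longlonglongrightarrow> (LINT x|lborel. \<bar>c\<bar> * \<bar>G x - G x\<bar>)"
    proof (rule integral_dominated_convergence[where w = "\<lambda>x. \<bar>c\<bar> * (2 * exp (- 2 * x^2))"])
      show "AE x in lborel. (\<lambda>n. \<bar>c\<bar> * \<bar>q n x - G x\<bar>) \<longlonglongrightarrow> \<bar>c\<bar> * \<bar>G x - G x\<bar>"
        by (intro AE_I2 tendsto_intros q_lim)
      show "AE x in lborel. norm (\<bar>c\<bar> * \<bar>q n x - G x\<bar>) \<le> \<bar>c\<bar> * (2 * exp (- 2 * x^2))" for n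
      proof (rule AE_I2)
        fix x
        have "\<bar>q n x - G x\<bar> \<le> 2 * exp (- 2 * x^2)" using q_dom[of n x] G_dom[of x] by linarith
        then show "norm (\<bar>c\<bar> * \<bar>q n x - G x\<bar>) \<le> \<bar>c\<bar> * (2 * exp (- 2 * x^2))"
          by (simp add: abs_mult mult_left_mono)
      qed
      show "integrable lborel (\<lambda>x. \<bar>c\<bar> * (2 * exp (- 2 * x^2)))"
        using integrable_exp_neg_square by simp
    qed simp_all
    then show "(\<lambda>n. LINT x|lborel. norm (of_real (c / g) * (of_real (cos (sqrt N / sqrt (real n) * x)) ^ (2 * n) * gauss x) - gauss_density \<sigma> x)) \<longlonglongrightarrow> 0"
      unfolding eq by simp
  qed
qed

lemma BUC_mult_op_in_toeplitz_algebra: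
  assumes b: "b \<in> BUC"
  shows "mult_op b \<in> toeplitz_algebra"
proof -
  obtain C where C: "\<And>x. norm (b x) \<le> C" using b by (auto simp: BUC_def bounded_iff)
  have uc: "uniformly_continuous_on UNIV b" using b by (simp add: BUC_def)
  then have [measurable]: "b \<in> borel_measurable borel"
    by (intro borel_measurable_continuous_onI uniformly_continuous_imp_continuous)
  have be: "ess_bounded b C" by (rule ess_boundedI) (simp_all add: C)
  have "\<exists>A\<in>toeplitz_algebra. norm (A - mult_op b) \<le> e" if e: "e > 0" for e
  proof -
    obtain d where d: "d > 0" "\<And>s t. \<bar>s\<bar> < d \<Longrightarrow> norm (b (t + s) - b t) \<le> e / 2"
    proof -
      obtain d where "d > 0" "\<And>x x'. dist x' x < d \<Longrightarrow> dist (b x') (b x) < e / 2"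
        using uc e unfolding uniformly_continuous_on_def by (meson UNIV_I half_gt_zero)
      then show ?thesis by (intro that[of d]) (force simp: dist_norm intro: less_imp_le)+
    qed
    define \<sigma> where "\<sigma> n = 1 / real (n + 2)" for n
    have \<sigma>: "\<sigma> n > 0" "\<sigma> n \<le> 1 / 2" for n by (auto simp: \<sigma>_def field_simps)
    \<comment> \<open>Half of e pays for the tails beyond distance d; the modulus of continuity
      within distance d takes the other half.\<close>
    obtain n where n: "2 * C * (\<sigma> n)^2 / d^2 < e / 2"
      using eventually_variance_small[of "e / 2" "2 * C" d] e unfolding \<sigma>_def by (auto simp del: of_nat_add)
    let ?k = "gauss_density (\<sigma> n)"
    have k: "integrable lborel ?k" by (rule integrable_gauss_density[OF \<sigma>(1)])
    have "ess_bounded (\<lambda>x. convolve ?k b x - b x) e"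
    proof (rule ess_boundedI)
      have "convolve ?k b \<in> borel_measurable borel"
        using ess_bounded_convolve[OF k be] by (simp add: ess_bounded_def)
      then show "(\<lambda>x. convolve ?k b x - b x) \<in> borel_measurable borel" by measurable
      show "norm (convolve ?k b x - b x) \<le> e" for x
        using convolve_gauss_density_approx[of b C "\<sigma> n" d x "e / 2"] C d \<sigma>(1)[of n] n by force
    qed
    then have "norm (mult_op (convolve ?k b) - mult_op b) \<le> e"
      unfolding mult_op_diff[OF ess_bounded_convolve[OF k be] be, symmetric] by (rule norm_mult_op)
    moreover have "mult_op (convolve ?k b) \<in> toeplitz_algebra"
      using convolutor_gauss_density[OF \<sigma>] be by (auto simp: convolutor_def)
    ultimately show ?thesis by blast
  qed
  then have "\<exists>A\<in>toeplitz_algebra. norm (A - mult_op b) \<le> 1 / real (Suc n)" for n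
    by simp
  then obtain X where "\<And>n. X n \<in> toeplitz_algebra" "\<And>n. norm (X n - mult_op b) \<le> 1 / real (Suc n)"
    by metis
  from toeplitz_algebra_limit[OF this(1) LIMSEQ_Suc[OF lim_const_over_n] this(2)] show ?thesis .
qed

lemma mult_op_in_toeplitz_algebra_iff:
  assumes m: "ess_bounded m C"
  shows "mult_op m \<in> toeplitz_algebra \<longleftrightarrow> (\<exists>b\<in>BUC. AE x in lborel. m x = b x)"
proof
  assume A: "mult_op m \<in> toeplitz_algebra"
  \<comment> \<open>A representative bounded everywhere, as
    \<open>translation_continuous_mult_op_BUC\<close> requires; it takes the value 0 on the
    exceptional null set.\<close>
  define m' where "m' x = (if norm (m x) \<le> C then m x else 0)" for x
  have [measurable]: "m \<in> borel_measurable borel" and C: "C \<ge> 0" using m by (auto simp: ess_bounded_def)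
  have mm: "m' \<in> borel_measurable borel" unfolding m'_def by measurable
  have bm: "norm (m' x) \<le> C" for x using C by (simp add: m'_def)
  have "AE x in lborel. norm (m x) \<le> C" using m by (simp add: ess_bounded_def)
  then have ae: "AE x in lborel. m x = m' x" by eventually_elim (simp add: m'_def)
  have "mult_op m = mult_op m'" by (rule mult_op_cong_AE[OF m ess_boundedI[OF mm bm] ae])
  then have "mult_op m' \<in> translation_continuous_ops"
    using A toeplitz_algebra_translation_continuous by auto
  from translation_continuous_mult_op_BUC[OF mm bm this] obtain b where b: "b \<in> BUC" "AE x in lborel. m' x = b x"
    by blast
  from ae b(2) have "AE x in lborel. m x = b x" by eventually_elim simp
  with b(1) show "\<exists>b\<in>BUC. AE x in lborel. m x = b x" by blast
next
  assume "\<exists>b\<in>BUC. AE x in lborel. m x = b x"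
  then obtain b where b: "b \<in> BUC" "AE x in lborel. m x = b x" by blast
  obtain C' where "\<And>x. norm (b x) \<le> C'" using b by (auto simp: BUC_def bounded_iff)
  moreover have "b \<in> borel_measurable borel"
    using b by (auto simp: BUC_def intro!: borel_measurable_continuous_onI uniformly_continuous_imp_continuous)
  ultimately have "ess_bounded b C'" by (intro ess_boundedI)
  from mult_op_cong_AE[OF m this b(2)] BUC_mult_op_in_toeplitz_algebra[OF b(1)]
  show "mult_op m \<in> toeplitz_algebra" by simp
qed

lemma vertical_Im: "vertical (\<lambda>z. f (Im z))"
  by (simp add: vertical_def)

text \<open>The last conjunct expresses the formula for f as an equivalence: the symbol m0 (- Im z)
  does represent the operator, and among vertical symbols it is the only one up to null
  sets.\<close>

theorem theorem3p19:
  fixes \<phi> :: fock and m :: "real \<Rightarrow> complex"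
  assumes "m \<in> Linfty"
    and "\<forall>z. \<phi> z = complex_of_real (sqrt (2 / pi)) *
           (LINT x|lborel. m x * exp (- 2 * (complex_of_real x - \<i> / 2 * z)^2))"
  shows "(singular_integral \<phi> \<in> toeplitz_algebra \<longleftrightarrow>
            (\<exists>b\<in>BUC. AE x in lborel. m x = b x)) \<and>
         ((\<exists>f\<in>Linfty. vertical f \<and> singular_integral \<phi> = toeplitz f) \<longleftrightarrow>
            (\<exists>m\<^sub>0\<in>Linfty. AE x in lborel. m x = convolve gauss m\<^sub>0 x)) \<and>
         (\<forall>m\<^sub>0\<in>Linfty. (AE x in lborel. m x = convolve gauss m\<^sub>0 x) \<longrightarrow>
            (\<forall>f\<in>Linfty. vertical f \<longrightarrow>
               (singular_integral \<phi> = toeplitz f \<longleftrightarrow>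
                (AE z in lborel. f z = m\<^sub>0 (- Im z)))))"
proof -
  obtain C where m: "ess_bounded m C" using assms(1) by (rule LinftyE)
  have S: "singular_integral \<phi> = mult_op m"
    using assms(2) by (intro singular_integral_eq_mult_op[OF m]) blast
  have conv: "mult_op m = toeplitz (\<lambda>z. m\<^sub>0 (- Im z))"
    if m0: "ess_bounded m\<^sub>0 K" and ae: "AE x in lborel. m x = convolve gauss m\<^sub>0 x" for m\<^sub>0 K
    using mult_op_cong_AE[OF m ess_bounded_convolve[OF integrable_gauss m0] ae]
    unfolding mult_op_convolve_gauss[OF m0] .
  have "singular_integral \<phi> \<in> toeplitz_algebra \<longleftrightarrow> (\<exists>b\<in>BUC. AE x in lborel. m x = b x)"
    unfolding S by (rule mult_op_in_toeplitz_algebra_iff[OF m])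
  moreover have "(\<exists>f\<in>Linfty. vertical f \<and> singular_integral \<phi> = toeplitz f) \<longleftrightarrow>
      (\<exists>m\<^sub>0\<in>Linfty. AE x in lborel. m x = convolve gauss m\<^sub>0 x)"
  proof
    assume "\<exists>f\<in>Linfty. vertical f \<and> singular_integral \<phi> = toeplitz f"
    then obtain f K where f: "ess_bounded f K" "vertical f" and eq: "mult_op m = toeplitz f"
      unfolding S by (auto elim: LinftyE)
    obtain f0 where f0: "ess_bounded f0 K" "AE z in lborel. f z = f0 (Im z)"
      using vertical_eq_Im[OF f] .
    \<comment> \<open>The reflection of \<open>f0\<close> is the candidate for
      \<open>m\<^sub>0\<close>, because convolution of f with \<open>gauss\<close> belongs to the
      symbol f (- Im z).\<close>
    note f0' = ess_bounded_uminus_arg[OF f0(1)]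
    have "mult_op m = mult_op (convolve gauss (\<lambda>x. f0 (- x)))"
      unfolding eq toeplitz_cong_AE[OF f(1) ess_bounded_Im[OF f0(1)] f0(2)] mult_op_convolve_gauss[OF f0'] by simp
    then have "AE x in lborel. m x = convolve gauss (\<lambda>x. f0 (- x)) x"
      by (rule mult_op_injective[OF m ess_bounded_convolve[OF integrable_gauss f0']])
    then show "\<exists>m\<^sub>0\<in>Linfty. AE x in lborel. m x = convolve gauss m\<^sub>0 x"
      using f0' by (intro bexI[of _ "\<lambda>x. f0 (- x)"]) (auto simp: Linfty_iff)
  next
    assume "\<exists>m\<^sub>0\<in>Linfty. AE x in lborel. m x = convolve gauss m\<^sub>0 x"
    then obtain m\<^sub>0 K where m0: "ess_bounded m\<^sub>0 K" "AE x in lborel. m x = convolve gauss m\<^sub>0 x"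
      by (auto elim: LinftyE)
    have "(\<lambda>z. m\<^sub>0 (- Im z)) \<in> Linfty"
      using ess_bounded_Im[OF ess_bounded_uminus_arg[OF m0(1)]] by (auto simp: Linfty_iff)
    then show "\<exists>f\<in>Linfty. vertical f \<and> singular_integral \<phi> = toeplitz f"
      unfolding S conv[OF m0] using vertical_Im[of "\<lambda>t. m\<^sub>0 (- t)"] by blast
  qed
  moreover have "singular_integral \<phi> = toeplitz f \<longleftrightarrow> (AE z in lborel. f z = m\<^sub>0 (- Im z))"
    if m0L: "m\<^sub>0 \<in> Linfty" and ae: "AE x in lborel. m x = convolve gauss m\<^sub>0 x" and fL: "f \<in> Linfty" and vert: "vertical f"
    for m\<^sub>0 f
  proof -
    obtain K where m0: "ess_bounded m\<^sub>0 K" using m0L by (rule LinftyE)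
    obtain L where f: "ess_bounded f L" using fL by (rule LinftyE)
    note m0' = ess_bounded_uminus_arg[OF m0]
    show ?thesis
    proof
      assume "singular_integral \<phi> = toeplitz f"
      obtain f0 where f0: "ess_bounded f0 L" "AE z in lborel. f z = f0 (Im z)"
        using vertical_eq_Im[OF f vert] .
      have "toeplitz (\<lambda>z. f0 (Im z)) = toeplitz (\<lambda>z. m\<^sub>0 (- Im z))"
        using \<open>singular_integral \<phi> = toeplitz f\<close> toeplitz_cong_AE[OF f ess_bounded_Im[OF f0(1)] f0(2)]
        unfolding S conv[OF m0 ae] by simp
      then have "AE t in lborel. f0 t = m\<^sub>0 (- t)"
        by (rule toeplitz_Im_injective[OF f0(1) m0'])
      then have "AE z in lborel. f0 (Im z) = m\<^sub>0 (- Im z)"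
      proof (rule AE_lborel_Im)
        have [measurable]: "f0 \<in> borel_measurable borel" "m\<^sub>0 \<in> borel_measurable borel"
          using f0(1) m0 by (auto simp: ess_bounded_def)
        show "Measurable.pred borel (\<lambda>t. f0 t = m\<^sub>0 (- t))" by measurable
      qed
      with f0(2) show "AE z in lborel. f z = m\<^sub>0 (- Im z)" by eventually_elim simp
    next
      assume "AE z in lborel. f z = m\<^sub>0 (- Im z)"
      then show "singular_integral \<phi> = toeplitz f"
        unfolding S conv[OF m0 ae] using toeplitz_cong_AE[OF f ess_bounded_Im[OF m0']] by simp
    qed
  qed
  ultimately show ?thesis by blast
qed

end
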